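(* Let $A$ be a GCR-algebra acting on a Hilbert space $H$. Then $A$ is a C*-algebra of von Neumann type I.
   Context: For a C*-algebra $B$: $B_+$ denotes its positive part. For $S\subseteq B$, the annihilator of $S$ is $\mathrm{Ann}(S)=\mathrm{Ann}_B(S)=\{a\in B: as+sa=0 \text{ for all } s\in S\}$. The set of annihilators of $B$ is $\mathcal{P}=\mathcal{P}_B=\{V\subseteq B: V=\mathrm{Ann}_B(\mathrm{Ann}_B(S)) \text{ for some } S\subseteq B_+\}$, ordered by inclusion (it is a complete lattice). For $V\subseteq B$ put ${}^dV=\{a\in B: xay+yax=0 \text{ for all } x,y\in V\}$. An annihilator $V\in\mathcal{P}$ is central if ${}^d(\mathrm{Ann}(\mathrm{Ann}(S)))\cap{}^d(\mathrm{Ann}(S))=\{0\}$, where $S\subseteq B_+$ and $V=\mathrm{Ann}(\mathrm{Ann}(S))$. The central support $c(V)$ of $V\in\mathcal{P}$ is the greatest lower bound in $\mathcal{P}$ of all central annihilators $W\in\mathcal{P}$ with $V\subseteq W$. An annihilator $V\in\mathcal{P}$ is Abelian if it is a commutative C*-subalgebra. $B$ is a C*-algebra of von Neumann type I if there exists an Abelian annihilator $V\in\mathcal{P}$ with $c(V)=B$. A C*-algebra is a CCR-algebra if for every representation $\pi:B\to B(K)$ with $K\neq 0$ and commutant of $\pi(B)$ equal to $\mathbb{C}1$, the operator $\pi(x)$ is compact for every $x\in B$. A C*-algebra is a GCR-algebra if each nonzero quotient C*-algebra of it has a nonzero closed two-sided ideal that is a CCR-algebra. *)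

theory Defs
  imports "HOL-Analysis.Analysis"
begin

class complex_inner = real_normed_vector +
  fixes scaleC :: "complex \<Rightarrow> 'a \<Rightarrow> 'a" (infixr \<open>*\<^sub>C\<close> 75)
    and cinner :: "'a \<Rightarrow> 'a \<Rightarrow> complex"
  assumes scaleC_add_right: "a *\<^sub>C (x + y) = a *\<^sub>C x + a *\<^sub>C y"
    and scaleC_add_left: "(a + b) *\<^sub>C x = a *\<^sub>C x + b *\<^sub>C x"
    and scaleC_scaleC: "a *\<^sub>C (b *\<^sub>C x) = (a * b) *\<^sub>C x"
    and scaleC_one: "1 *\<^sub>C x = x"
    and scaleR_scaleC: "scaleR r x = (complex_of_real r) *\<^sub>C x"
    and cinner_add_left: "cinner (x + y) z = cinner x z + cinner y z"
    and cinner_scaleC_left: "cinner (a *\<^sub>C x) y = cnj a * cinner x y"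
    and cinner_commute: "cinner x y = cnj (cinner y x)"
    and cinner_self_Im: "Im (cinner x x) = 0"
    and cinner_self_Re: "0 \<le> Re (cinner x x)"
    and cinner_eq_zero_iff: "cinner x x = 0 \<longleftrightarrow> x = 0"
    and norm_eq_sqrt_cinner: "norm x = sqrt (Re (cinner x x))"

class chilbert_space = complex_inner + complete_space

definition bounded_clinear :: "('a::complex_inner \<Rightarrow> 'b::complex_inner) \<Rightarrow> bool" where
  "bounded_clinear T \<longleftrightarrow>
     (\<forall>x y. T (x + y) = T x + T y) \<and> (\<forall>c x. T (c *\<^sub>C x) = c *\<^sub>C T x) \<and>
     (\<exists>K. \<forall>x. norm (T x) \<le> norm x * K)"

text \<open>Hilbert space adjoint (exists for every bounded operator on a Hilbert space).\<close>
definition cadj :: "('a::complex_inner \<Rightarrow> 'a) \<Rightarrow> ('a \<Rightarrow> 'a)" where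
  "cadj T = (SOME S. \<forall>x y. cinner (T x) y = cinner x (S y))"

definition zero_op :: "'a::complex_inner \<Rightarrow> 'a" where
  "zero_op = (\<lambda>_. 0)"

definition compact_op :: "('a::complex_inner \<Rightarrow> 'b::complex_inner) \<Rightarrow> bool" where
  "compact_op T \<longleftrightarrow> compact (closure (T ` {x. norm x \<le> 1}))"

definition cstar_algebra_on :: "('h::chilbert_space \<Rightarrow> 'h) set \<Rightarrow> bool" where
  "cstar_algebra_on A \<longleftrightarrow>
     (\<forall>T\<in>A. bounded_clinear T) \<and> zero_op \<in> A \<and>
     (\<forall>S\<in>A. \<forall>T\<in>A. (\<lambda>x. S x + T x) \<in> A) \<and>
     (\<forall>c. \<forall>T\<in>A. (\<lambda>x. c *\<^sub>C T x) \<in> A) \<and>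
     (\<forall>S\<in>A. \<forall>T\<in>A. S \<circ> T \<in> A) \<and>
     (\<forall>T\<in>A. cadj T \<in> A) \<and>
     (\<forall>f T. (\<forall>n. f n \<in> A) \<and> bounded_clinear T \<and>
            (\<lambda>n. onorm (\<lambda>x. f n x - T x)) \<longlonglongrightarrow> 0 \<longrightarrow> T \<in> A)"

definition closed_ideal :: "('h::chilbert_space \<Rightarrow> 'h) set \<Rightarrow> ('h \<Rightarrow> 'h) set \<Rightarrow> bool" where
  "closed_ideal A J \<longleftrightarrow>
     J \<subseteq> A \<and> zero_op \<in> J \<and>
     (\<forall>S\<in>J. \<forall>T\<in>J. (\<lambda>x. S x + T x) \<in> J) \<and>
     (\<forall>c. \<forall>T\<in>J. (\<lambda>x. c *\<^sub>C T x) \<in> J) \<and>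
     (\<forall>a\<in>A. \<forall>j\<in>J. a \<circ> j \<in> J \<and> j \<circ> a \<in> J) \<and>
     (\<forall>f T. (\<forall>n. f n \<in> J) \<and> bounded_clinear T \<and>
            (\<lambda>n. onorm (\<lambda>x. f n x - T x)) \<longlonglongrightarrow> 0 \<longrightarrow> T \<in> J)"

text \<open>Closed (complex) subspace K of a Hilbert space; operators in B(K) are
represented by functions on the ambient space, only their values on K matter.\<close>
definition closed_csubspace :: "'k::chilbert_space set \<Rightarrow> bool" where
  "closed_csubspace K \<longleftrightarrow> 0 \<in> K \<and> (\<forall>x\<in>K. \<forall>y\<in>K. x + y \<in> K) \<and>
     (\<forall>c. \<forall>x\<in>K. c *\<^sub>C x \<in> K) \<and> closed K"

definition bounded_op_on :: "'k::chilbert_space set \<Rightarrow> ('k \<Rightarrow> 'k) \<Rightarrow> bool" where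
  "bounded_op_on K T \<longleftrightarrow> (\<forall>x\<in>K. T x \<in> K) \<and>
     (\<forall>x\<in>K. \<forall>y\<in>K. T (x + y) = T x + T y) \<and> (\<forall>c. \<forall>x\<in>K. T (c *\<^sub>C x) = c *\<^sub>C T x) \<and>
     (\<exists>M. \<forall>x\<in>K. norm (T x) \<le> norm x * M)"

text \<open>A representation of the quotient C*-algebra I/J (J \<subseteq> I) on the Hilbert space K,
i.e. a *-homomorphism of I into B(K) vanishing on J.\<close>
definition quot_rep ::
  "('h::chilbert_space \<Rightarrow> 'h) set \<Rightarrow> ('h \<Rightarrow> 'h) set \<Rightarrow> 'k::chilbert_space set
    \<Rightarrow> (('h \<Rightarrow> 'h) \<Rightarrow> ('k \<Rightarrow> 'k)) \<Rightarrow> bool" where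
  "quot_rep I J K \<pi> \<longleftrightarrow> closed_csubspace K \<and>
     (\<forall>a\<in>I. bounded_op_on K (\<pi> a)) \<and>
     (\<forall>a\<in>I. \<forall>b\<in>I. \<forall>x\<in>K. \<pi> (\<lambda>y. a y + b y) x = \<pi> a x + \<pi> b x) \<and>
     (\<forall>c. \<forall>a\<in>I. \<forall>x\<in>K. \<pi> (\<lambda>y. c *\<^sub>C a y) x = c *\<^sub>C \<pi> a x) \<and>
     (\<forall>a\<in>I. \<forall>b\<in>I. \<forall>x\<in>K. \<pi> (a \<circ> b) x = \<pi> a (\<pi> b x)) \<and>
     (\<forall>a\<in>I. \<forall>x\<in>K. \<forall>y\<in>K. cinner (\<pi> a x) y = cinner x (\<pi> (cadj a) y)) \<and>
     (\<forall>j\<in>J. \<forall>x\<in>K. \<pi> j x = 0)"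

text \<open>The commutant of \<pi>(I) in B(K) is \<complex>1 (the inclusion of \<complex>1 is automatic).\<close>
definition commutant_trivial ::
  "('h::chilbert_space \<Rightarrow> 'h) set \<Rightarrow> 'k::chilbert_space set \<Rightarrow> (('h \<Rightarrow> 'h) \<Rightarrow> ('k \<Rightarrow> 'k)) \<Rightarrow> bool" where
  "commutant_trivial I K \<pi> \<longleftrightarrow>
     (\<forall>T. bounded_op_on K T \<and> (\<forall>a\<in>I. \<forall>x\<in>K. T (\<pi> a x) = \<pi> a (T x))
          \<longrightarrow> (\<exists>c. \<forall>x\<in>K. T x = c *\<^sub>C x))"

text \<open>The quotient C*-algebra I/J is CCR, with representation spaces taken to be the
closed subspaces of the Hilbert space of type 'k.\<close>
definition quot_CCR :: "'k::chilbert_space itself \<Rightarrow> ('h::chilbert_space \<Rightarrow> 'h) set \<Rightarrow> ('h \<Rightarrow> 'h) set \<Rightarrow> bool" where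
  "quot_CCR _ I J \<longleftrightarrow>
     (\<forall>(K::'k set) \<pi>. quot_rep I J K \<pi> \<and> (\<exists>x\<in>K. x \<noteq> 0) \<and> commutant_trivial I K \<pi>
        \<longrightarrow> (\<forall>a\<in>I. compact (closure (\<pi> a ` {x\<in>K. norm x \<le> 1}))))"

text \<open>GCR: every nonzero quotient A/J (J a closed ideal, J \<noteq> A) has a nonzero closed
ideal (I/J with I a closed ideal of A, J \<subset> I) which is CCR.\<close>
definition GCR :: "'k::chilbert_space itself \<Rightarrow> ('h::chilbert_space \<Rightarrow> 'h) set \<Rightarrow> bool" where
  "GCR k A \<longleftrightarrow>
     (\<forall>J. closed_ideal A J \<and> J \<noteq> A \<longrightarrow>
        (\<exists>I. closed_ideal A I \<and> J \<subset> I \<and> quot_CCR k I J))"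

definition orthonormal_family :: "('i \<Rightarrow> 'k::complex_inner) \<Rightarrow> bool" where
  "orthonormal_family e \<longleftrightarrow> (\<forall>i j. cinner (e i) (e j) = (if i = j then 1 else 0))"

definition pos_part :: "('h::chilbert_space \<Rightarrow> 'h) set \<Rightarrow> ('h \<Rightarrow> 'h) set" where
  "pos_part B = {a\<in>B. \<exists>b\<in>B. a = cadj b \<circ> b}"

definition Ann :: "('h::chilbert_space \<Rightarrow> 'h) set \<Rightarrow> ('h \<Rightarrow> 'h) set \<Rightarrow> ('h \<Rightarrow> 'h) set" where
  "Ann B S = {a\<in>B. \<forall>s\<in>S. (\<lambda>x. a (s x) + s (a x)) = zero_op}"

definition annihilators :: "('h::chilbert_space \<Rightarrow> 'h) set \<Rightarrow> ('h \<Rightarrow> 'h) set set" where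
  "annihilators B = {V. \<exists>S. S \<subseteq> pos_part B \<and> V = Ann B (Ann B S)}"

definition dset :: "('h::chilbert_space \<Rightarrow> 'h) set \<Rightarrow> ('h \<Rightarrow> 'h) set \<Rightarrow> ('h \<Rightarrow> 'h) set" where
  "dset B V = {a\<in>B. \<forall>x\<in>V. \<forall>y\<in>V. (\<lambda>z. x (a (y z)) + y (a (x z))) = zero_op}"

definition central_ann :: "('h::chilbert_space \<Rightarrow> 'h) set \<Rightarrow> ('h \<Rightarrow> 'h) set \<Rightarrow> bool" where
  "central_ann B V \<longleftrightarrow> (\<exists>S. S \<subseteq> pos_part B \<and> V = Ann B (Ann B S) \<and>
      dset B (Ann B (Ann B S)) \<inter> dset B (Ann B S) = {zero_op})"

definition is_glb_in :: "'a set set \<Rightarrow> 'a set set \<Rightarrow> 'a set \<Rightarrow> bool" where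
  "is_glb_in P X c \<longleftrightarrow> c \<in> P \<and> (\<forall>W\<in>X. c \<subseteq> W) \<and>
      (\<forall>c'\<in>P. (\<forall>W\<in>X. c' \<subseteq> W) \<longrightarrow> c' \<subseteq> c)"

definition central_support_is ::
  "('h::chilbert_space \<Rightarrow> 'h) set \<Rightarrow> ('h \<Rightarrow> 'h) set \<Rightarrow> ('h \<Rightarrow> 'h) set \<Rightarrow> bool" where
  "central_support_is B V c \<longleftrightarrow>
     is_glb_in (annihilators B) {W\<in>annihilators B. central_ann B W \<and> V \<subseteq> W} c"

definition abelian_ann :: "('h::chilbert_space \<Rightarrow> 'h) set \<Rightarrow> ('h \<Rightarrow> 'h) set \<Rightarrow> bool" where
  "abelian_ann B V \<longleftrightarrow> V \<in> annihilators B \<and> cstar_algebra_on V \<and>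
     (\<forall>a\<in>V. \<forall>b\<in>V. a \<circ> b = b \<circ> a)"

definition vN_type_I :: "('h::chilbert_space \<Rightarrow> 'h) set \<Rightarrow> bool" where
  "vN_type_I B \<longleftrightarrow> (\<exists>V. abelian_ann B V \<and> central_support_is B V B)"

end

theory Submission
  imports Defs
begin

text \<open>
  Call a positive \<open>x\<close> abelian if \<open>x A x\<close> is commutative. Take a maximal family \<open>S\<close> of abelian elements
  with \<open>s A t = 0\<close> for distinct members. Its double annihilator is commutative: the cubes \<open>s^3\<close> are
  central in it, and commutators are killed by \<open>S\<close>. A central annihilator \<open>W\<close> containing \<open>S\<close>
  satisfies \<open>W A N = 0\<close> for the annihilator \<open>N\<close> of \<open>W\<close>, so \<open>W = A\<close> as soon as the ideal generated by
  \<open>S\<close> is essential, that is, as soon as every nonzero closed ideal \<open>L\<close> contains a nonzero abelian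
  element.

  Suppose that some \<open>L\<close> contains none. With \<open>J\<close> the annihilator of \<open>L\<close> and \<open>I/J\<close> a CCR ideal of \<open>A/J\<close>,
  the ideal \<open>M = I \<inter> L\<close> is nonzero. A noncommutative C*-algebra contains a nonzero \<open>z\<close> with \<open>z^2 = 0\<close>, so
  one can choose inductively \<open>e n\<close> and \<open>z n\<close> in \<open>M\<close> such that \<open>e n\<close> is a unit for \<open>z n\<close> and for
  \<open>e (n + 1)\<close>, where \<open>e (n + 1)\<close> is a spectral cut-off of \<open>z n* z n\<close> and hence kills \<open>z n\<close>. A pure state
  for which all \<open>e n\<close> act as units yields an irreducible representation of \<open>I/J\<close> in which the vectors
  \<open>z n\<close> are orthogonal, bounded below and fixed by \<open>e 0\<close>. So \<open>e 0\<close> is not represented by a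
  compact operator.
\<close>

section \<open>Complex inner product spaces\<close>

text \<open>\<open>A\<close> need not have a unit, and the only functional calculus used is one
  square root: for selfadjoint T of norm at most 1, the operator 1 - sqrt(1 - T) is a norm limit of
  polynomials in T without constant term, so it lies in every closed algebra containing T. With T =
  4(x - x^2) it gives the cut-offs min(2x, 1) and max(2x - 1, 0) of x = \<open>adj z * z\<close> as
  x + Y/2 and x - Y/2 with norm Y at most 1; a state with value 1 at the first one is therefore at
  least 1/2 at x. Normalisation at a unit is replaced by the condition that every \<open>e n\<close>
  acts as a unit for the state. Vectors fixed by \<open>e 0\<close>, ..., \<open>e n\<close> exist
  for each n, but perhaps no vector serves all n; compactness of the state space bridges this gap.
  Quotients are never formed: the states vanish on \<open>J\<close>, and such states exist because
  \<open>J\<close> annihilates \<open>M\<close>. Finally, \<open>GCR\<close> speaks of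
  representations on closed subspaces of one fixed type, so the GNS space has to be built inside
  that type; an orthonormal family with one vector per operator provides the room.\<close>

lemma cinner_add_right: "cinner x (y + z) = cinner x y + cinner x z"
  for x :: "'a::complex_inner"
  by (metis cinner_add_left cinner_commute complex_cnj_add)

lemma cinner_scaleC_right: "cinner x (a *\<^sub>C y) = a * cinner x y"
  for x :: "'a::complex_inner"
  by (metis cinner_commute cinner_scaleC_left complex_cnj_cnj complex_cnj_mult)

lemma cinner_scaleR_left: "cinner (r *\<^sub>R x) y = complex_of_real r * cinner x y"
  for x :: "'a::complex_inner"
  by (simp add: scaleR_scaleC cinner_scaleC_left)

lemma cinner_scaleR_right: "cinner x (r *\<^sub>R y) = complex_of_real r * cinner x y"
  for x :: "'a::complex_inner"
  by (simp add: scaleR_scaleC cinner_scaleC_right)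

lemma cinner_zero_left [simp]: "cinner 0 y = 0" for y :: "'a::complex_inner"
  using cinner_scaleR_left[of 0 0 y] by simp

lemma cinner_zero_right [simp]: "cinner y 0 = 0" for y :: "'a::complex_inner"
  using cinner_scaleR_right[of y 0 0] by simp

lemma cinner_minus_left: "cinner (- x) y = - cinner x y" for x :: "'a::complex_inner"
  using cinner_scaleR_left[of "-1" x y] by simp

lemma cinner_minus_right: "cinner x (- y) = - cinner x y" for x :: "'a::complex_inner"
  using cinner_scaleR_right[of x "-1" y] by simp

lemma cinner_diff_left: "cinner (x - y) z = cinner x z - cinner y z" for x :: "'a::complex_inner"
  using cinner_add_left[of x "- y" z] by (simp add: cinner_minus_left)

lemma cinner_diff_right: "cinner z (x - y) = cinner z x - cinner z y" for x :: "'a::complex_inner"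
  using cinner_add_right[of z x "- y"] by (simp add: cinner_minus_right)

lemmas cinner_simps = cinner_add_left cinner_add_right cinner_diff_left cinner_diff_right
  cinner_minus_left cinner_minus_right cinner_scaleC_left cinner_scaleC_right
  cinner_scaleR_left cinner_scaleR_right

lemma cinner_self: "cinner x x = complex_of_real ((norm x)\<^sup>2)" for x :: "'a::complex_inner"
  by (simp add: complex_eq_iff norm_eq_sqrt_cinner cinner_self_Im cinner_self_Re)

lemma norm_scaleC: "norm (c *\<^sub>C x) = cmod c * norm x" for x :: "'a::complex_inner"
proof -
  have "complex_of_real ((norm (c *\<^sub>C x))\<^sup>2) = complex_of_real ((cmod c * norm x)\<^sup>2)"
    unfolding cinner_self[symmetric] cinner_scaleC_left cinner_scaleC_right
    by (simp add: cinner_self power_mult_distrib complex_mult_cnj cmod_power2)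
  then show ?thesis
    by (metis norm_ge_zero of_real_eq_iff power2_eq_iff_nonneg mult_nonneg_nonneg)
qed

lemma scaleC_zero_left [simp]: "0 *\<^sub>C x = 0" for x :: "'a::complex_inner"
  using norm_scaleC[of 0 x] by simp

lemma scaleC_zero_right [simp]: "c *\<^sub>C (0::'a::complex_inner) = 0"
  using norm_scaleC[of c "0::'a"] by simp

lemma scaleC_minus1: "(-1) *\<^sub>C x = - x" for x :: "'a::complex_inner"
  using scaleR_scaleC[of "-1" x] by simp

lemma scaleC_minus_right: "c *\<^sub>C (- x) = - (c *\<^sub>C x)" for x :: "'a::complex_inner"
  using scaleC_add_right[of c x "-x"] by (simp add: eq_neg_iff_add_eq_0 add.commute)

lemma scaleC_diff_right: "c *\<^sub>C (x - y) = c *\<^sub>C x - c *\<^sub>C y" for x :: "'a::complex_inner"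
  using scaleC_add_right[of c x "-y"] by (simp add: scaleC_minus_right)

lemma norm_sq_add: "(norm (x + y))\<^sup>2 = (norm x)\<^sup>2 + (norm y)\<^sup>2 + 2 * Re (cinner x y)"
  for x :: "'a::complex_inner"
proof -
  have "complex_of_real ((norm (x + y))\<^sup>2) = cinner x x + cinner y y + (cinner x y + cinner y x)"
    unfolding cinner_self[symmetric] by (simp add: cinner_simps)
  also have "cinner x y + cinner y x = complex_of_real (2 * Re (cinner x y))"
    using cinner_commute[of y x] by (simp add: complex_eq_iff)
  finally show ?thesis
    unfolding cinner_self of_real_add[symmetric] of_real_eq_iff .
qed

lemma norm_sq_diff: "(norm (x - y))\<^sup>2 = (norm x)\<^sup>2 + (norm y)\<^sup>2 - 2 * Re (cinner x y)"
  for x :: "'a::complex_inner"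
  using norm_sq_add[of x "-y"] by (simp add: cinner_minus_right)

lemma parallelogram: "(norm (x + y))\<^sup>2 + (norm (x - y))\<^sup>2 = 2 * (norm x)\<^sup>2 + 2 * (norm y)\<^sup>2"
  for x :: "'a::complex_inner"
  by (simp add: norm_sq_add norm_sq_diff)

text \<open>For t = -s times the conjugate of B the hypothesis becomes a real quadratic in s,
  minimal at s = 1/C. It serves the Cauchy-Schwarz inequalities for vectors, positive operators and
  positive functionals; with A = 0 it forces B = 0, which is how \<open>riesz_representation\<close>
  uses it.\<close>

lemma discriminant_bound:
  fixes A C :: real and B :: complex
  assumes "\<And>t::complex. 0 \<le> A + 2 * Re (t * B) + (cmod t)\<^sup>2 * C" "0 \<le> C"
  shows "(cmod B)\<^sup>2 \<le> A * C"
proof -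
  have *: "0 \<le> A - 2 * s * (cmod B)\<^sup>2 + s\<^sup>2 * (cmod B)\<^sup>2 * C" for s :: real
  proof -
    have "cnj B * B = complex_of_real ((cmod B)\<^sup>2)"
      by (simp add: mult.commute[of "cnj B"] complex_mult_cnj cmod_power2)
    then have "Re (complex_of_real (-s) * cnj B * B) = - s * (cmod B)\<^sup>2"
      by (simp add: mult.assoc)
    then show ?thesis
      using assms(1)[of "complex_of_real (-s) * cnj B"]
      by (simp add: norm_mult power_mult_distrib algebra_simps)
  qed
  show ?thesis
  proof (cases "C = 0")
    case True
    show ?thesis
    proof (rule ccontr)
      assume "\<not> ?thesis"
      then have "(cmod B)\<^sup>2 > 0" using True by simp
      \<comment> \<open>For C = 0 the quadratic is affine in s, and this s gives it the value
        -1.\<close>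
      then show False
        using *[of "(A + 1) / (2 * (cmod B)\<^sup>2)"] True by (simp add: field_simps)
    qed
  next
    case False
    then have "C > 0" using assms(2) by simp
    then show ?thesis
      using *[of "1 / C"] by (simp add: field_simps power2_eq_square)
  qed
qed

lemma norm_cinner_le: "cmod (cinner x y) \<le> norm x * norm y" for x :: "'a::complex_inner"
proof -
  have "(cmod (cinner x y))\<^sup>2 \<le> (norm x)\<^sup>2 * (norm y)\<^sup>2"
  proof (rule discriminant_bound)
    fix t :: complex
    have "0 \<le> (norm (x + t *\<^sub>C y))\<^sup>2" by simp
    then show "0 \<le> (norm x)\<^sup>2 + 2 * Re (t * cinner x y) + (cmod t)\<^sup>2 * (norm y)\<^sup>2"
      unfolding norm_sq_add by (simp add: norm_scaleC power_mult_distrib cinner_scaleC_right)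
  qed simp
  then show ?thesis
    by (metis norm_ge_zero power2_le_imp_le power_mult_distrib mult_nonneg_nonneg)
qed

lemma bounded_bilinear_cinner:
  "bounded_bilinear (cinner :: 'a::complex_inner \<Rightarrow> 'a \<Rightarrow> complex)"
proof
  show "\<exists>K. \<forall>a b::'a. cmod (cinner a b) \<le> norm a * norm b * K"
    by (intro exI[of _ 1]) (simp add: norm_cinner_le)
qed (simp_all add: cinner_simps scaleR_conv_of_real)

lemmas tendsto_cinner = bounded_bilinear.tendsto[OF bounded_bilinear_cinner]

lemma bounded_linear_scaleC: "bounded_linear (\<lambda>x::'a::complex_inner. c *\<^sub>C x)"
proof (rule bounded_linear_intro[of _ "cmod c"])
  show "c *\<^sub>C r *\<^sub>R x = r *\<^sub>R c *\<^sub>C x" for r and x :: 'a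
    by (simp add: scaleR_scaleC scaleC_scaleC mult.commute)
qed (auto simp: scaleC_add_right norm_scaleC mult.commute)

lemmas tendsto_scaleC = bounded_linear.tendsto[OF bounded_linear_scaleC]

instance chilbert_space \<subseteq> banach ..

text \<open>\<open>Y\<close> need not be closed, so the vector is sought in its closure, as the
  limit of a minimising sequence for |y|^2 - 2 Re f(y). The bound on its norm is what later leaves a
  nonnegative residual in \<open>partial_gns_extend\<close>.\<close>

lemma riesz_representation:
  fixes Y :: "'a::chilbert_space set" and f :: "'a \<Rightarrow> complex"
  assumes Y0: "0 \<in> Y" and Yadd: "\<And>x y. x \<in> Y \<Longrightarrow> y \<in> Y \<Longrightarrow> x + y \<in> Y"
    and Ysc: "\<And>c x. x \<in> Y \<Longrightarrow> c *\<^sub>C x \<in> Y"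
    and fadd: "\<And>x y. x \<in> Y \<Longrightarrow> y \<in> Y \<Longrightarrow> f (x + y) = f x + f y"
    and fsc: "\<And>c x. x \<in> Y \<Longrightarrow> f (c *\<^sub>C x) = c * f x"
    and bnd: "\<And>x. x \<in> Y \<Longrightarrow> cmod (f x) \<le> C * norm x"
    and "0 \<le> C"
  shows "\<exists>p. p \<in> closure Y \<and> (\<forall>y\<in>Y. cinner p y = f y) \<and> norm p \<le> C"
proof -
  define Q where "Q = (\<lambda>y. (norm y)\<^sup>2 - 2 * Re (f y))"
  define m where "m = Inf (Q ` Y)"
  have Qlb: "- C\<^sup>2 \<le> Q y" if "y \<in> Y" for y
  proof -
    have "Re (f y) \<le> C * norm y" using bnd[OF that] complex_Re_le_cmod order_trans by blast
    moreover have "0 \<le> (norm y - C)\<^sup>2" by simp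
    ultimately show ?thesis unfolding Q_def power2_diff by (simp add: mult.commute)
  qed
  then have bdd: "bdd_below (Q ` Y)" by (auto simp: bdd_below_def)
  have mle: "m \<le> Q y" if "y \<in> Y" for y
    unfolding m_def using that bdd by (auto intro: cInf_lower)
  have "\<exists>y\<in>Y. Q y < m + 1 / Suc n" for n
  proof -
    have "Inf (Q ` Y) < m + 1 / Suc n" unfolding m_def by simp
    then show ?thesis using cInf_lessD[of "Q ` Y"] Y0 by fastforce
  qed
  then obtain y where yY: "\<And>n. y n \<in> Y" and yQ: "\<And>n. Q (y n) < m + 1 / Suc n" by metis
  have fR: "f (r *\<^sub>R x) = complex_of_real r * f x" if "x \<in> Y" for r x
    using fsc[OF that] by (simp add: scaleR_scaleC)
  have YR: "r *\<^sub>R x \<in> Y" if "x \<in> Y" for r x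
    using Ysc[OF that] by (simp add: scaleR_scaleC)
  \<comment> \<open>The midpoint of two members also has Q at least m, so the parallelogram law
    makes a minimising sequence Cauchy.\<close>
  have dist: "(norm (y n - y k))\<^sup>2 \<le> 2 / Suc n + 2 / Suc k" for n k
  proof -
    let ?z = "(1/2) *\<^sub>R (y n + y k)"
    have "m \<le> Q ?z" using YR Yadd yY by (intro mle) blast
    moreover have "4 * Q ?z = (norm (y n + y k))\<^sup>2 - 4 * Re (f (y n)) - 4 * Re (f (y k))"
    proof -
      have "f ?z = (1/2) * (f (y n) + f (y k))"
        using fR[OF Yadd[OF yY yY], of "1/2" n k] fadd[OF yY yY, of n k] by simp
      moreover have "4 * (norm ?z)\<^sup>2 = (norm (y n + y k))\<^sup>2"
        by (simp only: norm_scaleR power_mult_distrib) (simp add: power2_eq_square)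
      ultimately show ?thesis unfolding Q_def by (simp add: algebra_simps)
    qed
    ultimately have "4 * m \<le> 2 * Q (y n) + 2 * Q (y k) - (norm (y n - y k))\<^sup>2"
      using parallelogram[of "y n" "y k"] unfolding Q_def by simp
    then show ?thesis using yQ[of n] yQ[of k] by simp
  qed
  have "Cauchy y"
  proof (rule metric_CauchyI)
    fix e :: real assume "e > 0"
    obtain N where N: "real N > 4 / e\<^sup>2" using reals_Archimedean2 by blast
    have "N > 0" using N \<open>e > 0\<close> by (metis divide_pos_pos gr0I not_less_iff_gr_or_eq of_nat_0 order_less_trans zero_less_numeral zero_less_power)
    show "\<exists>M. \<forall>n\<ge>M. \<forall>k\<ge>M. dist (y n) (y k) < e"
    proof (intro exI[of _ N] allI impI)
      fix n k assume nk: "N \<le> n" "N \<le> k"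
      have "2 / Suc n \<le> 2 / N" "2 / Suc k \<le> 2 / N"
        using nk \<open>N > 0\<close> by (auto intro!: divide_left_mono)
      moreover have "4 / real N < e\<^sup>2"
        using N \<open>e > 0\<close> \<open>N > 0\<close> by (simp add: field_simps)
      ultimately have "(norm (y n - y k))\<^sup>2 < e\<^sup>2" using dist[of n k] by simp
      then show "dist (y n) (y k) < e"
        using \<open>e > 0\<close> by (simp add: dist_norm power2_less_imp_less)
    qed
  qed
  then obtain p where p: "y \<longlonglongrightarrow> p" using Cauchy_convergent convergent_def by blast
  have pcl: "p \<in> closure Y" using p yY closure_sequential by blast
  have eq: "cinner p v = f v" if v: "v \<in> Y" for v
  proof -
    have "(cmod (cinner p v - f v))\<^sup>2 \<le> 0 * (norm v)\<^sup>2"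
    proof (rule discriminant_bound)
      fix t :: complex
      \<comment> \<open>Moving \<open>y n\<close> along a multiple of v cannot take Q below m; in
        the limit this is the inequality of \<open>discriminant_bound\<close>.\<close>
      have ineq: "0 \<le> (2 * Re (t * (cinner (y n) v - f v)) + (cmod t)\<^sup>2 * (norm v)\<^sup>2) + 1 / Suc n" for n
      proof -
        have "m \<le> Q (y n + t *\<^sub>C v)" using yY Ysc v Yadd by (intro mle) blast
        also have "Q (y n + t *\<^sub>C v) = Q (y n) + 2 * Re (t * (cinner (y n) v - f v)) + (cmod t)\<^sup>2 * (norm v)\<^sup>2"
          unfolding Q_def norm_sq_add using yY v Ysc
          by (simp add: fadd fsc norm_scaleC cinner_scaleC_right power_mult_distrib algebra_simps)
        finally show ?thesis using yQ[of n] by linarith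
      qed
      have "(\<lambda>n. (2 * Re (t * (cinner (y n) v - f v)) + (cmod t)\<^sup>2 * (norm v)\<^sup>2) + 1 / Suc n)
         \<longlonglongrightarrow> (2 * Re (t * (cinner p v - f v)) + (cmod t)\<^sup>2 * (norm v)\<^sup>2) + 0"
        by (intro tendsto_intros tendsto_cinner p LIMSEQ_Suc[OF lim_const_over_n])
      from LIMSEQ_le_const[OF this, of 0] ineq
      show "0 \<le> 0 + 2 * Re (t * (cinner p v - f v)) + (cmod t)\<^sup>2 * (norm v)\<^sup>2"
        by (simp only: add_0 add_0_right) blast
    qed simp
    then show ?thesis by simp
  qed
  have "norm p \<le> C"
  proof -
    have "(\<lambda>n. cinner p (y n)) \<longlonglongrightarrow> cinner p p"
      by (intro tendsto_cinner p tendsto_const)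
    then have "(\<lambda>n. cmod (cinner p (y n))) \<longlonglongrightarrow> (norm p)\<^sup>2"
      using tendsto_norm by (fastforce simp: cinner_self norm_power)
    moreover have "(\<lambda>n. C * norm (y n)) \<longlonglongrightarrow> C * norm p"
      by (intro tendsto_intros p)
    moreover have "cmod (cinner p (y n)) \<le> C * norm (y n)" for n
      using eq yY bnd by simp
    ultimately have le: "(norm p)\<^sup>2 \<le> C * norm p"
      using LIMSEQ_le by blast
    show ?thesis
    proof (cases "norm p = 0")
      case True
      then show ?thesis using \<open>0 \<le> C\<close> by simp
    next
      case False
      then show ?thesis using le by (simp add: power2_eq_square)
    qed
  qed
  show ?thesis using pcl eq \<open>norm p \<le> C\<close> by auto
qed

section \<open>The algebra of bounded operators\<close>

lemma bounded_clinear_bounded_linear: "bounded_clinear T \<Longrightarrow> bounded_linear T"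
  unfolding bounded_clinear_def by (auto intro!: bounded_linear_intro simp: scaleR_scaleC)

lemma bounded_clinearI:
  assumes "\<And>x y. T (x + y) = T x + T y" "\<And>c x. T (c *\<^sub>C x) = c *\<^sub>C T x"
    "\<And>x. norm (T x) \<le> norm x * K"
  shows "bounded_clinear T"
  using assms unfolding bounded_clinear_def by blast

text \<open>A type of operators can be made a Banach algebra, so that the library's limits and
  series of algebraic laws apply; \<open>ap\<close> and \<open>lift_ops\<close> connect it with the
  sets of functions in the theorem.\<close>

typedef (overloaded) 'h bop = "{T :: 'h::chilbert_space \<Rightarrow> 'h. bounded_clinear T}"
  morphisms ap Bop
  by (rule exI[of _ "\<lambda>_. 0"]) (auto intro!: bounded_clinearI[where K = 0])

setup_lifting type_definition_bop

lemma bounded_clinear_ap [simp]: "bounded_clinear (ap x)"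
  using ap by blast

lemma bounded_linear_ap: "bounded_linear (ap x)"
  by (simp add: bounded_clinear_bounded_linear)

lemma ap_Bop: "bounded_clinear T \<Longrightarrow> ap (Bop T) = T"
  by (simp add: Bop_inverse)

lemma bop_eqI: "(\<And>v. ap x v = ap y v) \<Longrightarrow> x = y"
  by (metis ap_inject ext)

lemma ap_arg_add: "ap x (v + w) = ap x v + ap x w"
  using bounded_clinear_ap[of x] unfolding bounded_clinear_def by blast

lemma ap_arg_scaleC: "ap x (c *\<^sub>C v) = c *\<^sub>C ap x v"
  using bounded_clinear_ap[of x] unfolding bounded_clinear_def by blast

lemma ap_arg_scaleR: "ap x (c *\<^sub>R v) = c *\<^sub>R ap x v"
  by (simp add: ap_arg_scaleC scaleR_scaleC)

lemma ap_arg_0 [simp]: "ap x 0 = 0"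
  using ap_arg_scaleC[of x 0 0] by simp

lemma ap_arg_diff: "ap x (v - w) = ap x v - ap x w"
  using linear_diff[OF bounded_linear.linear[OF bounded_linear_ap]] .

lemma ap_arg_minus: "ap x (- v) = - ap x v"
  using linear_neg[OF bounded_linear.linear[OF bounded_linear_ap]] .

lift_definition cmul :: "complex \<Rightarrow> 'h::chilbert_space bop \<Rightarrow> 'h bop" is "\<lambda>c T v. c *\<^sub>C T v"
proof -
  fix c and T :: "'h \<Rightarrow> 'h" assume T: "bounded_clinear T"
  then obtain K where K: "\<And>x. norm (T x) \<le> norm x * K" unfolding bounded_clinear_def by blast
  then have "norm (c *\<^sub>C T x) \<le> norm x * (cmod c * K)" for x
    using mult_left_mono[OF K[of x], of "cmod c"] by (simp add: norm_scaleC mult_ac)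
  then show "bounded_clinear (\<lambda>v. c *\<^sub>C T v)"
    using T by (intro bounded_clinearI[where K = "cmod c * K"])
      (auto simp: bounded_clinear_def scaleC_add_right scaleC_scaleC mult.commute)
qed

instantiation bop :: (chilbert_space) real_normed_algebra
begin

lift_definition zero_bop :: "'a bop" is "\<lambda>_. 0"
  by (auto intro!: bounded_clinearI[where K = 0])

lift_definition plus_bop :: "'a bop \<Rightarrow> 'a bop \<Rightarrow> 'a bop" is "\<lambda>S T v. S v + T v"
proof -
  fix S T :: "'a \<Rightarrow> 'a" assume S: "bounded_clinear S" and T: "bounded_clinear T"
  then obtain K L where "\<And>x. norm (S x) \<le> norm x * K" "\<And>x. norm (T x) \<le> norm x * L"
    unfolding bounded_clinear_def by blast
  then show "bounded_clinear (\<lambda>v. S v + T v)"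
    using S T by (intro bounded_clinearI[where K = "K + L"])
      (auto simp: bounded_clinear_def scaleC_add_right distrib_left
        intro!: order_trans[OF norm_triangle_ineq] add_mono)
qed

definition scaleR_bop :: "real \<Rightarrow> 'a bop \<Rightarrow> 'a bop" where
  "scaleR_bop r x = cmul (complex_of_real r) x"

definition uminus_bop :: "'a bop \<Rightarrow> 'a bop" where "uminus_bop x = cmul (-1) x"

definition minus_bop :: "'a bop \<Rightarrow> 'a bop \<Rightarrow> 'a bop" where "minus_bop x y = x + - y"

lift_definition times_bop :: "'a bop \<Rightarrow> 'a bop \<Rightarrow> 'a bop" is "(\<circ>)"
proof -
  fix S T :: "'a \<Rightarrow> 'a" assume S: "bounded_clinear S" and T: "bounded_clinear T"
  then obtain K L where K: "\<And>x. norm (S x) \<le> norm x * K" and L: "\<And>x. norm (T x) \<le> norm x * L"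
    unfolding bounded_clinear_def by blast
  have "norm (S (T v)) \<le> norm v * (\<bar>L\<bar> * \<bar>K\<bar>)" for v
  proof -
    have "norm (S (T v)) \<le> norm (T v) * \<bar>K\<bar>"
      using K[of "T v"] by (smt (verit) mult_left_mono norm_ge_zero)
    also have "\<dots> \<le> (norm v * \<bar>L\<bar>) * \<bar>K\<bar>"
      using L[of v] by (smt (verit) mult_left_mono mult_right_mono norm_ge_zero)
    finally show ?thesis by (simp add: mult.assoc)
  qed
  then show "bounded_clinear (S \<circ> T)"
    using S T by (intro bounded_clinearI[where K = "\<bar>L\<bar> * \<bar>K\<bar>"]) (auto simp: bounded_clinear_def)
qed

lift_definition norm_bop :: "'a bop \<Rightarrow> real" is onorm .

definition dist_bop :: "'a bop \<Rightarrow> 'a bop \<Rightarrow> real" where "dist_bop x y = norm (x - y)"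

definition sgn_bop :: "'a bop \<Rightarrow> 'a bop" where "sgn_bop x = inverse (norm x) *\<^sub>R x"

definition uniformity_bop :: "('a bop \<times> 'a bop) filter" where
  "uniformity_bop = (INF e\<in>{0 <..}. principal {(x, y). dist x y < e})"

definition open_bop :: "'a bop set \<Rightarrow> bool" where
  "open_bop U = (\<forall>x\<in>U. eventually (\<lambda>(x', y). x' = x \<longrightarrow> y \<in> U) uniformity)"

instance
proof
  fix x y z :: "'a bop" and r s :: real
  have ap_simps: "\<And>v. ap 0 v = (0::'a)" "\<And>x y v. ap (x + y) v = ap x v + ap y (v::'a)"
    "\<And>x y v. ap (x * y) v = ap x (ap y (v::'a))" "\<And>c x v. ap (cmul c x) v = c *\<^sub>C ap x (v::'a)"
    by (transfer; simp)+
  show "x + y + z = x + (y + z)" "x + y = y + x" "0 + x = x"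
    "r *\<^sub>R (x + y) = r *\<^sub>R x + r *\<^sub>R y" "(r + s) *\<^sub>R x = r *\<^sub>R x + s *\<^sub>R x"
    "r *\<^sub>R s *\<^sub>R x = (r * s) *\<^sub>R x" "1 *\<^sub>R x = x"
    "x * y * z = x * (y * z)" "(x + y) * z = x * z + y * z" "x * (y + z) = x * y + x * z"
    "r *\<^sub>R x * y = r *\<^sub>R (x * y)" "x * r *\<^sub>R y = r *\<^sub>R (x * y)"
    by (rule bop_eqI; simp add: ap_simps ap_arg_add ap_arg_scaleC scaleR_bop_def scaleC_add_right
        scaleC_add_left scaleC_scaleC scaleC_one)+
  show "- x + x = 0"
    by (rule bop_eqI) (simp add: uminus_bop_def ap_simps scaleC_minus1)
  show "x - y = x + - y" by (simp add: minus_bop_def)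
  show "dist x y = norm (x - y)" by (simp add: dist_bop_def)
  show "sgn x = inverse (norm x) *\<^sub>R x" by (simp add: sgn_bop_def)
  show "(uniformity :: ('a bop \<times> 'a bop) filter) = (INF e\<in>{0 <..}. principal {(x, y). dist x y < e})"
    by (simp add: uniformity_bop_def)
  show "\<And>U::'a bop set. open U = (\<forall>x\<in>U. \<forall>\<^sub>F (x', y) in uniformity. x' = x \<longrightarrow> y \<in> U)"
    by (simp add: open_bop_def)
  show "norm x = 0 \<longleftrightarrow> x = 0"
    unfolding norm_bop.rep_eq using onorm_eq_0[OF bounded_linear_ap[of x]]
    by (metis ap_simps(1) bop_eqI)
  show "norm (x + y) \<le> norm x + norm y"
    unfolding norm_bop.rep_eq plus_bop.rep_eq
    by (intro onorm_triangle bounded_linear_ap)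
  show "norm (r *\<^sub>R x) = \<bar>r\<bar> * norm x"
    unfolding norm_bop.rep_eq scaleR_bop_def cmul.rep_eq scaleR_scaleC[symmetric]
    by (intro onorm_scaleR bounded_linear_ap)
  show "norm (x * y) \<le> norm x * norm y"
    unfolding norm_bop.rep_eq times_bop.rep_eq
    by (intro onorm_compose bounded_linear_ap)
qed

end

text \<open>There is no instance of \<open>ring_1\<close>, since \<open>0 = 1\<close> on the zero space.\<close>

instantiation bop :: (chilbert_space) monoid_mult
begin

lift_definition one_bop :: "'a bop" is "\<lambda>v. v"
  by (auto intro!: bounded_clinearI[where K = 1])

instance
  by standard (rule bop_eqI; simp add: times_bop.rep_eq one_bop.rep_eq)+

end

lemma ap_0 [simp]: "ap 0 v = 0" by transfer simp
lemma ap_1 [simp]: "ap 1 v = v" by transfer simp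
lemma ap_add: "ap (x + y) v = ap x v + ap y v" by transfer simp
lemma ap_times: "ap (x * y) v = ap x (ap y v)" by transfer simp
lemma ap_cmul: "ap (cmul c x) v = c *\<^sub>C ap x v" by transfer simp
lemma ap_scaleR: "ap (r *\<^sub>R x) v = r *\<^sub>R ap x v"
  by (simp add: scaleR_bop_def ap_cmul scaleR_scaleC)
lemma ap_minus: "ap (- x) v = - ap x v"
  by (simp add: uminus_bop_def ap_cmul scaleC_minus1)
lemma ap_diff: "ap (x - y) v = ap x v - ap y v"
  using ap_add[of x "-y" v] by (simp add: ap_minus)

lemmas ap_simps = ap_add ap_times ap_cmul ap_scaleR ap_minus ap_diff
  ap_arg_add ap_arg_scaleC ap_arg_scaleR ap_arg_diff ap_arg_minus

lemma cmul_simps: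
  "cmul c (x + y) = cmul c x + cmul c y" "cmul (c + d) x = cmul c x + cmul d x"
  "cmul c (cmul d x) = cmul (c * d) x" "cmul 1 x = x" "cmul 0 x = 0" "cmul c 0 = 0"
  "cmul c x * y = cmul c (x * y)" "x * cmul c y = cmul c (x * y)"
  "cmul c (x - y) = cmul c x - cmul c y" "cmul c (- x) = - cmul c x"
  by (rule bop_eqI; simp add: ap_simps scaleC_add_right scaleC_add_left scaleC_scaleC scaleC_one
      scaleC_diff_right scaleC_minus_right)+

lemma scaleR_cmul: "r *\<^sub>R x = cmul (complex_of_real r) x" for x :: "'h::chilbert_space bop"
  by (simp add: scaleR_bop_def)

lemma minus_cmul: "- x = cmul (-1) x" for x :: "'h::chilbert_space bop"
  by (simp add: uminus_bop_def)

lemma norm_ap: "norm (ap x v) \<le> norm x * norm v"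
  unfolding norm_bop.rep_eq by (rule onorm[OF bounded_linear_ap])

lemma norm_bop_le: "(\<And>v. norm (ap x v) \<le> C * norm v) \<Longrightarrow> 0 \<le> C \<Longrightarrow> norm x \<le> C"
  unfolding norm_bop.rep_eq by (rule onorm_bound)

lemma norm_ap_le: "norm x \<le> C \<Longrightarrow> norm (ap x v) \<le> C * norm v"
  using norm_ap[of x v] mult_right_mono[of "norm x" C "norm v"] by simp

lemma norm_cmul: "norm (cmul c x) = cmod c * norm x"
proof -
  have le: "norm (cmul c x) \<le> cmod c * norm x" for c and x :: "'a bop"
    by (rule norm_bop_le) (simp_all add: ap_cmul norm_scaleC mult.assoc mult_left_mono norm_ap)
  show ?thesis
  proof (cases "c = 0")
    case False
    have "norm x = norm (cmul (inverse c) (cmul c x))" using False by (simp add: cmul_simps)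
    also have "\<dots> \<le> cmod (inverse c) * norm (cmul c x)" by (rule le)
    finally have "cmod c * norm x \<le> norm (cmul c x)"
      using False by (simp add: norm_inverse norm_divide field_simps)
    then show ?thesis using le[of c x] by simp
  qed (simp add: cmul_simps)
qed

lemma bounded_linear_ap_op: "bounded_linear (\<lambda>x. ap x v)"
  by (rule bounded_linear_intro[of _ "norm v"]) (simp_all add: ap_simps norm_ap)

instance bop :: (chilbert_space) banach
proof
  fix X :: "nat \<Rightarrow> 'a bop" assume X: "Cauchy X"
  have ptw: "Cauchy (\<lambda>n. ap (X n) v)" for v
    by (rule bounded_linear.Cauchy[OF bounded_linear_ap_op X])
  define L where "L = (\<lambda>v. lim (\<lambda>n. ap (X n) v))"
  have L: "(\<lambda>n. ap (X n) v) \<longlonglongrightarrow> L v" for v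
    unfolding L_def using ptw Cauchy_convergent convergent_LIMSEQ_iff by blast
  obtain B where B: "\<And>n. norm (X n) \<le> B"
    using Cauchy_Bseq[OF X] unfolding Bseq_def by blast
  have "bounded_clinear L"
  proof (rule bounded_clinearI)
    show "L (v + w) = L v + L w" for v w
      using tendsto_add[OF L[of v] L[of w]] L[of "v + w"] LIMSEQ_unique
      by (simp add: ap_arg_add) blast
    show "L (c *\<^sub>C v) = c *\<^sub>C L v" for c v
      using tendsto_scaleC[OF L[of v], of c] L[of "c *\<^sub>C v"] LIMSEQ_unique
      by (simp add: ap_arg_scaleC) blast
    show "norm (L v) \<le> norm v * B" for v
      using norm_ap_le[OF B, of _ v]
      by (intro LIMSEQ_le_const2[OF tendsto_norm[OF L]]) (auto simp: mult.commute)
  qed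
  then obtain x where x: "ap x = L" using ap_Bop by blast
  have "X \<longlonglongrightarrow> x"
  proof (rule metric_LIMSEQ_I)
    fix e :: real assume "e > 0"
    then obtain M where M: "\<And>m n. m \<ge> M \<Longrightarrow> n \<ge> M \<Longrightarrow> norm (X m - X n) < e / 2"
      using X unfolding Cauchy_iff by (metis half_gt_zero)
    have "norm (X n - x) \<le> e / 2" if "n \<ge> M" for n
    proof (rule norm_bop_le)
      fix v
      have "(\<lambda>m. norm (ap (X n - X m) v)) \<longlonglongrightarrow> norm (ap (X n - x) v)"
        unfolding ap_diff x by (intro tendsto_intros L)
      moreover have "norm (ap (X n - X m) v) \<le> e / 2 * norm v" if "m \<ge> M" for m
        using M[OF \<open>n \<ge> M\<close> that] by (intro norm_ap_le) simp
      ultimately show "norm (ap (X n - x) v) \<le> e / 2 * norm v"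
        by (intro LIMSEQ_le_const2) auto
    qed (use \<open>e > 0\<close> in simp)
    then show "\<exists>no. \<forall>n\<ge>no. dist (X n) x < e"
      using \<open>e > 0\<close> by (intro exI[of _ M]) (fastforce simp: dist_norm)
  qed
  then show "convergent X" by (auto simp: convergent_def)
qed

section \<open>Adjoints and the C*-identity\<close>

lemma cinner_ext: "u = v" if "\<And>x. cinner x u = cinner x v" for u v :: "'a::complex_inner"
  using that[of "u - v"] by (metis cinner_diff_right cinner_eq_zero_iff eq_iff_diff_eq_0)

lemma adjoint_exists:
  fixes T :: "'a::chilbert_space \<Rightarrow> 'a"
  assumes "bounded_clinear T"
  shows "\<exists>S. bounded_clinear S \<and> (\<forall>x y. cinner (T x) y = cinner x (S y))"
proof -
  obtain t where t: "T = ap t" using assms ap_Bop by metis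
  have "\<exists>p. (\<forall>x. cinner p x = cinner y (ap t x)) \<and> norm p \<le> norm y * norm t" for y
  proof -
    have "cmod (cinner y (ap t x)) \<le> norm y * norm t * norm x" for x
      using norm_cinner_le[of y "ap t x"] mult_left_mono[OF norm_ap[of t x], of "norm y"]
      by (simp add: mult.assoc)
    then have "\<exists>p. p \<in> closure UNIV \<and> (\<forall>x\<in>UNIV. cinner p x = cinner y (ap t x)) \<and> norm p \<le> norm y * norm t"
      by (intro riesz_representation) (simp_all add: cinner_simps ap_simps)
    then show ?thesis by auto
  qed
  then obtain S where S: "\<And>y x. cinner (S y) x = cinner y (ap t x)"
      "\<And>y. norm (S y) \<le> norm y * norm t" by metis
  have S': "cinner (ap t x) y = cinner x (S y)" for x y
    by (metis S(1) cinner_commute)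
  have "bounded_clinear S"
  proof (rule bounded_clinearI)
    show "S (v + w) = S v + S w" for v w
      by (rule cinner_ext) (simp add: cinner_simps flip: S')
    show "S (c *\<^sub>C v) = c *\<^sub>C S v" for c v
      by (rule cinner_ext) (simp add: cinner_simps flip: S')
  qed (rule S(2))
  then show ?thesis using S' t by blast
qed

lemma cadj_eqI:
  assumes "\<And>x y. cinner (T x) y = cinner x (S y)"
  shows "cadj T = S"
proof -
  have "\<forall>x y. cinner (T x) y = cinner x (cadj T y)"
    unfolding cadj_def by (rule someI[of _ S]) (simp add: assms)
  then show ?thesis using assms by (intro ext cinner_ext) metis
qed

lift_definition adj :: "'h::chilbert_space bop \<Rightarrow> 'h bop" is cadj
  using adjoint_exists cadj_eqI by metis

lemma cinner_ap_left: "cinner (ap x v) w = cinner v (ap (adj x) w)"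
  unfolding adj.rep_eq using adjoint_exists[OF bounded_clinear_ap[of x]] cadj_eqI[of "ap x"]
  by metis

lemma cinner_ap_right: "cinner v (ap x w) = cinner (ap (adj x) v) w"
  by (metis cinner_ap_left cinner_commute)

lemma adj_eqI: "(\<And>v w. cinner (ap x v) w = cinner v (ap y w)) \<Longrightarrow> adj x = y"
  by (rule bop_eqI, rule cinner_ext) (simp flip: cinner_ap_left)

lemma adj_adj [simp]: "adj (adj x) = x"
  by (rule adj_eqI) (simp add: cinner_ap_right)

lemma adj_add: "adj (x + y) = adj x + adj y"
  by (rule adj_eqI) (simp add: ap_simps cinner_simps cinner_ap_left)

lemma adj_diff: "adj (x - y) = adj x - adj y"
  by (rule adj_eqI) (simp add: ap_simps cinner_simps cinner_ap_left)

lemma adj_minus: "adj (- x) = - adj x"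
  by (rule adj_eqI) (simp add: ap_simps cinner_simps cinner_ap_left)

lemma adj_times: "adj (x * y) = adj y * adj x"
  by (rule adj_eqI) (simp add: ap_simps cinner_simps cinner_ap_left)

lemma adj_cmul: "adj (cmul c x) = cmul (cnj c) (adj x)"
  by (rule adj_eqI) (simp add: ap_simps cinner_simps cinner_ap_left)

lemma adj_scaleR: "adj (r *\<^sub>R x) = r *\<^sub>R adj x"
  by (simp add: scaleR_cmul adj_cmul)

lemma adj_0 [simp]: "adj 0 = 0" and adj_1 [simp]: "adj 1 = 1"
  by (rule adj_eqI; simp)+

lemmas adj_simps = adj_add adj_diff adj_minus adj_times adj_cmul adj_scaleR

lemma norm_sq_ap: "(norm (ap x v))\<^sup>2 = Re (cinner v (ap (adj x * x) v))"
proof -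
  have "complex_of_real ((norm (ap x v))\<^sup>2) = cinner v (ap (adj x * x) v)"
    unfolding cinner_self[symmetric] by (simp add: cinner_ap_left ap_times)
  then show ?thesis by (metis Re_complex_of_real)
qed

lemma norm_adj: "norm (adj x) = norm x"
proof -
  have le: "norm (adj x) \<le> norm x" for x :: "'a bop"
  proof (rule norm_bop_le)
    fix v
    have "(norm (ap (adj x) v))\<^sup>2 = Re (cinner v (ap x (ap (adj x) v)))"
      by (simp add: norm_sq_ap ap_times)
    also have "\<dots> \<le> norm v * (norm x * norm (ap (adj x) v))"
      by (meson complex_Re_le_cmod norm_cinner_le norm_ap mult_left_mono norm_ge_zero order_trans)
    finally show "norm (ap (adj x) v) \<le> norm x * norm v"
      by (cases "norm (ap (adj x) v) = 0") (simp_all add: power2_eq_square mult_ac)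
  qed simp
  show ?thesis using le[of x] le[of "adj x"] by simp
qed

lemma bounded_linear_adj: "bounded_linear (adj :: 'a::chilbert_space bop \<Rightarrow> 'a bop)"
  by (rule bounded_linear_intro[of _ 1]) (simp_all add: adj_add adj_scaleR norm_adj)

lemmas tendsto_adj = bounded_linear.tendsto[OF bounded_linear_adj]

lemma norm_adj_mult: "norm (adj x * x) = (norm x)\<^sup>2"
proof (rule antisym)
  show "norm (adj x * x) \<le> (norm x)\<^sup>2"
    using norm_mult_ineq[of "adj x" x] by (simp add: norm_adj power2_eq_square)
  have "norm x \<le> sqrt (norm (adj x * x))"
  proof (rule norm_bop_le)
    fix v
    have "(norm (ap x v))\<^sup>2 \<le> norm v * (norm (adj x * x) * norm v)"
      unfolding norm_sq_ap
      by (meson complex_Re_le_cmod norm_cinner_le norm_ap mult_left_mono norm_ge_zero order_trans)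
    also have "\<dots> = (sqrt (norm (adj x * x)) * norm v)\<^sup>2"
      by (simp add: power2_eq_square mult_ac)
    finally show "norm (ap x v) \<le> sqrt (norm (adj x * x)) * norm v"
      by (rule power2_le_imp_le) simp
  qed simp
  then show "(norm x)\<^sup>2 \<le> norm (adj x * x)"
    using power_mono[of "norm x" "sqrt (norm (adj x * x))" 2] by simp
qed

lemma adj_mult_eq_0: "adj x * x = 0 \<longleftrightarrow> x = 0"
  using norm_adj_mult[of x] by auto

lemma mult_adj_eq_0: "x * adj x = 0 \<longleftrightarrow> x = 0"
  using adj_mult_eq_0[of "adj x"] norm_adj[of x] by auto

section \<open>Square roots\<close>

text \<open>Neither a unit nor adjoints are asked for, so that commutants,
  \<open>{x. x * u = 0}\<close> and sets of multipliers qualify. That a constructed element lies in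
  every closed algebra containing its input replaces functional calculus: testing against such a set
  yields the required commutation or annihilation.\<close>

definition closed_alg :: "'h::chilbert_space bop set \<Rightarrow> bool" where
  "closed_alg C \<longleftrightarrow> 0 \<in> C \<and> (\<forall>x\<in>C. \<forall>y\<in>C. x + y \<in> C) \<and> (\<forall>c. \<forall>x\<in>C. cmul c x \<in> C) \<and>
     (\<forall>x\<in>C. \<forall>y\<in>C. x * y \<in> C) \<and> closed C"

lemma closed_algI:
  assumes "0 \<in> C" "\<And>x y. x \<in> C \<Longrightarrow> y \<in> C \<Longrightarrow> x + y \<in> C" "\<And>c x. x \<in> C \<Longrightarrow> cmul c x \<in> C"
    "\<And>x y. x \<in> C \<Longrightarrow> y \<in> C \<Longrightarrow> x * y \<in> C"
    "\<And>f x. (\<And>n. f n \<in> C) \<Longrightarrow> f \<longlonglongrightarrow> x \<Longrightarrow> x \<in> C"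
  shows "closed_alg C"
proof -
  have "closed C" unfolding closed_sequential_limits using assms(5) by blast
  then show ?thesis using assms(1-4) by (simp add: closed_alg_def)
qed

context
  fixes C :: "'h::chilbert_space bop set"
  assumes C: "closed_alg C"
begin

lemma closed_alg_0: "0 \<in> C"
  and closed_alg_add: "x \<in> C \<Longrightarrow> y \<in> C \<Longrightarrow> x + y \<in> C"
  and closed_alg_cmul: "x \<in> C \<Longrightarrow> cmul c x \<in> C"
  and closed_alg_times: "x \<in> C \<Longrightarrow> y \<in> C \<Longrightarrow> x * y \<in> C"
  and closed_alg_closed: "closed C"
  using C by (simp_all add: closed_alg_def)

lemma closed_alg_scaleR: "x \<in> C \<Longrightarrow> r *\<^sub>R x \<in> C"
  by (simp add: scaleR_cmul closed_alg_cmul)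

lemma closed_alg_minus: "x \<in> C \<Longrightarrow> - x \<in> C"
  by (simp add: minus_cmul closed_alg_cmul)

lemma closed_alg_diff: "x \<in> C \<Longrightarrow> y \<in> C \<Longrightarrow> x - y \<in> C"
  using closed_alg_add[of x "- y"] closed_alg_minus by simp

lemma closed_alg_lim: "(\<And>n. f n \<in> C) \<Longrightarrow> f \<longlonglongrightarrow> x \<Longrightarrow> x \<in> C"
  using closed_alg_closed unfolding closed_sequential_limits by blast

end

lemmas closed_alg_intros = closed_alg_0 closed_alg_add closed_alg_cmul closed_alg_times
  closed_alg_scaleR closed_alg_minus closed_alg_diff

lemma closed_alg_commutant: "closed_alg {x. \<forall>z\<in>Z. x * z = z * x}"
proof (rule closed_algI)
  fix f :: "nat \<Rightarrow> 'a bop" and x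
  assume f: "\<And>n. f n \<in> {x. \<forall>z\<in>Z. x * z = z * x}" and lim: "f \<longlonglongrightarrow> x"
  have "x * z = z * x" if "z \<in> Z" for z
  proof (rule LIMSEQ_unique)
    show "(\<lambda>n. f n * z) \<longlonglongrightarrow> x * z" "(\<lambda>n. f n * z) \<longlonglongrightarrow> z * x"
      using f that tendsto_mult[OF lim tendsto_const[of z]] tendsto_mult[OF tendsto_const[of z] lim]
      by auto
  qed
  then show "x \<in> {x. \<forall>z\<in>Z. x * z = z * x}" by blast
next
  fix x y assume "x \<in> {x. \<forall>z\<in>Z. x * z = z * x}" "y \<in> {x. \<forall>z\<in>Z. x * z = z * x}"
  then have "x * y * z = z * (x * y)" if "z \<in> Z" for z
    using that by (simp add: mult.assoc) (simp flip: mult.assoc)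
  then show "x * y \<in> {x. \<forall>z\<in>Z. x * z = z * x}" by blast
qed (auto simp: distrib_left distrib_right cmul_simps)

lemma closed_alg_annihilated: "closed_alg {x. x * u = 0}"
proof (rule closed_algI)
  fix f :: "nat \<Rightarrow> 'a bop" and x
  assume f: "\<And>n. f n \<in> {x. x * u = 0}" and lim: "f \<longlonglongrightarrow> x"
  then have "(\<lambda>n. 0) \<longlonglongrightarrow> x * u"
    using tendsto_mult[OF lim tendsto_const[of u]] by simp
  then show "x \<in> {x. x * u = 0}" using LIMSEQ_unique tendsto_const by blast
qed (auto simp: algebra_simps cmul_simps)

lemma closed_alg_fixed: "closed_alg {x. e * x = x \<and> x * e = x}"
proof (rule closed_algI)
  fix f :: "nat \<Rightarrow> 'a bop" and x
  assume f: "\<And>n. f n \<in> {x. e * x = x \<and> x * e = x}" and lim: "f \<longlonglongrightarrow> x"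
  then have "f \<longlonglongrightarrow> x * e" "f \<longlonglongrightarrow> e * x"
    using tendsto_mult[OF lim tendsto_const[of e]] tendsto_mult[OF tendsto_const[of e] lim] by auto
  then show "x \<in> {x. e * x = x \<and> x * e = x}" using LIMSEQ_unique lim by blast
qed (simp_all add: distrib_left distrib_right cmul_simps mult.assoc, simp_all flip: mult.assoc)

text \<open>This algebra contains 1 even if \<open>B\<close> does not, so functions of an element of
  \<open>B\<close> that are nonzero at 0 can act on \<open>B\<close> from the left.\<close>

lemma closed_alg_left_multipliers:
  assumes B: "closed_alg B"
  shows "closed_alg {x. \<forall>b\<in>B. x * b \<in> B}"
proof (rule closed_algI)
  fix f :: "nat \<Rightarrow> 'a bop" and x
  assume f: "\<And>n. f n \<in> {x. \<forall>b\<in>B. x * b \<in> B}" and lim: "f \<longlonglongrightarrow> x"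
  have "x * b \<in> B" if "b \<in> B" for b
    using closed_alg_lim[OF B _ tendsto_mult[OF lim tendsto_const[of b]]] f that by blast
  then show "x \<in> {x. \<forall>b\<in>B. x * b \<in> B}" by blast
qed (auto simp: distrib_right cmul_simps mult.assoc closed_alg_intros[OF B])

lemma closed_alg_Int: "closed_alg C \<Longrightarrow> closed_alg D \<Longrightarrow> closed_alg (C \<inter> D)"
  unfolding closed_alg_def by auto

text \<open>A fixed point satisfies 2Y = T + Y^2, which is (1 - Y)^2 = 1 - T.\<close>

primrec sqrt_iter :: "'h::chilbert_space bop \<Rightarrow> nat \<Rightarrow> 'h bop" where
  "sqrt_iter T 0 = 0"
| "sqrt_iter T (Suc n) = (1/2) *\<^sub>R (T + sqrt_iter T n * sqrt_iter T n)"

primrec sqrt_iter_bound :: "nat \<Rightarrow> real" where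
  "sqrt_iter_bound 0 = 0"
| "sqrt_iter_bound (Suc n) = (1/2) * (1 + sqrt_iter_bound n * sqrt_iter_bound n)"

lemma sqrt_iter_bound_range: "0 \<le> sqrt_iter_bound n \<and> sqrt_iter_bound n \<le> 1"
  by (induction n) (auto intro: mult_le_one)

lemma sqrt_iter_bound_mono: "incseq sqrt_iter_bound"
proof (rule incseq_SucI)
  fix n
  have "0 \<le> (1 - sqrt_iter_bound n)\<^sup>2" by simp
  then show "sqrt_iter_bound n \<le> sqrt_iter_bound (Suc n)"
    by (simp add: power2_eq_square algebra_simps)
qed

lemma sqrt_iter_in: "closed_alg C \<Longrightarrow> T \<in> C \<Longrightarrow> sqrt_iter T n \<in> C"
  by (induction n) (auto intro: closed_alg_intros)

lemma sqrt_iter_commute: "sqrt_iter T m * sqrt_iter T n = sqrt_iter T n * sqrt_iter T m"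
proof -
  have T: "sqrt_iter T n * T = T * sqrt_iter T n" for n
    using sqrt_iter_in[OF closed_alg_commutant[of "{T}"], of T n] by simp
  show ?thesis
    using sqrt_iter_in[OF closed_alg_commutant[of "{sqrt_iter T n}"], of T m] T by simp
qed

lemma norm_sqrt_iter: "norm T \<le> 1 \<Longrightarrow> norm (sqrt_iter T n) \<le> sqrt_iter_bound n"
proof (induction n)
  case (Suc n)
  have "norm (sqrt_iter T n * sqrt_iter T n) \<le> sqrt_iter_bound n * sqrt_iter_bound n"
    using Suc sqrt_iter_bound_range[of n]
    by (intro order_trans[OF norm_mult_ineq] mult_mono) auto
  then show ?case
    using Suc.prems norm_triangle_ineq[of T "sqrt_iter T n * sqrt_iter T n"] by simp
qed simp

text \<open>Increments factor as difference times sum, for operators because the iterates commute;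
  the induction then compares each factor with its scalar counterpart.\<close>

lemma norm_sqrt_iter_step:
  "norm T \<le> 1 \<Longrightarrow> norm (sqrt_iter T (Suc n) - sqrt_iter T n) \<le> sqrt_iter_bound (Suc n) - sqrt_iter_bound n"
proof (induction n)
  case (Suc n)
  let ?Y = "sqrt_iter T" and ?y = sqrt_iter_bound
  have "?Y (Suc (Suc n)) - ?Y (Suc n) = (1/2) *\<^sub>R (?Y (Suc n) * ?Y (Suc n) - ?Y n * ?Y n)"
    by (simp only: sqrt_iter.simps(2)[of T "Suc n"] sqrt_iter.simps(2)[of T n]
        scaleR_diff_right[symmetric]) simp
  also have "?Y (Suc n) * ?Y (Suc n) - ?Y n * ?Y n = (?Y (Suc n) - ?Y n) * (?Y (Suc n) + ?Y n)"
    using sqrt_iter_commute[of T n "Suc n"] by (simp only: algebra_simps)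
  also have "norm ((1/2) *\<^sub>R \<dots>) \<le> (1/2) * ((?y (Suc n) - ?y n) * (?y (Suc n) + ?y n))"
  proof -
    have "norm (?Y (Suc n) + ?Y n) \<le> ?y (Suc n) + ?y n"
      using norm_sqrt_iter[OF Suc.prems] norm_triangle_mono by blast
    then have "norm ((?Y (Suc n) - ?Y n) * (?Y (Suc n) + ?Y n)) \<le> (?y (Suc n) - ?y n) * (?y (Suc n) + ?y n)"
      using Suc.IH[OF Suc.prems] incseq_SucD[OF sqrt_iter_bound_mono, of n]
      by (intro order_trans[OF norm_mult_ineq] mult_mono) (auto simp del: sqrt_iter.simps sqrt_iter_bound.simps)
    then show ?thesis by (simp del: sqrt_iter.simps sqrt_iter_bound.simps)
  qed
  also have "\<dots> = ?y (Suc (Suc n)) - ?y (Suc n)"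
    by (simp only: sqrt_iter_bound.simps(2)[of "Suc n"] sqrt_iter_bound.simps(2)[of n])
       (simp add: algebra_simps)
  finally show ?case .
qed simp

lemma sqrt_iter_Cauchy: assumes "norm T \<le> 1" shows "Cauchy (sqrt_iter T)"
proof -
  let ?Y = "sqrt_iter T" and ?y = sqrt_iter_bound
  have le: "norm (?Y n - ?Y m) \<le> ?y n - ?y m" if "m \<le> n" for m n
    using that
  proof (induction n rule: dec_induct)
    case (step n)
    then show ?case
      using norm_sqrt_iter_step[OF assms, of n]
        norm_triangle_ineq[of "?Y (Suc n) - ?Y n" "?Y n - ?Y m"] by simp
  qed simp
  have "convergent ?y"
    using incseq_convergent[OF sqrt_iter_bound_mono, of 1] sqrt_iter_bound_range
    by (metis convergent_def)
  then have yC: "Cauchy ?y" by (rule convergent_Cauchy)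
  show ?thesis
  proof (rule CauchyI)
    fix e :: real assume "e > 0"
    then obtain M where M: "\<And>m n. m \<ge> M \<Longrightarrow> n \<ge> M \<Longrightarrow> norm (?y m - ?y n) < e"
      using yC unfolding Cauchy_iff by blast
    have "norm (?Y m - ?Y n) < e" if "m \<ge> M" "n \<ge> M" for m n
      using that
    proof (induction m n rule: linorder_wlog)
      case (le m n)
      then show ?case using M[of n m] \<open>\<And>m n. m \<le> n \<Longrightarrow> norm (?Y n - ?Y m) \<le> ?y n - ?y m\<close>[of m n]
        by (simp add: norm_minus_commute)
    next
      case (sym m n)
      then show ?case by (simp add: norm_minus_commute)
    qed
    then show "\<exists>M. \<forall>m\<ge>M. \<forall>n\<ge>M. norm (?Y m - ?Y n) < e" by blast
  qed
qed

text \<open>The iteration is dominated by its scalar instance at 1, so it converges in norm even when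
  \<open>norm T = 1\<close>; the limit never involves the identity operator.\<close>

lemma sqrt_one_minus:
  assumes T: "adj T = T" "norm T \<le> 1"
  obtains Y where "adj Y = Y" "norm Y \<le> 1" "(1 - Y) * (1 - Y) = 1 - T"
    "\<And>C. closed_alg C \<Longrightarrow> T \<in> C \<Longrightarrow> Y \<in> C"
proof -
  obtain Y where Y: "sqrt_iter T \<longlonglongrightarrow> Y"
    using sqrt_iter_Cauchy[OF T(2)] Cauchy_convergent convergent_def by blast
  have "adj (sqrt_iter T n) = sqrt_iter T n" for n
    by (induction n) (auto simp: adj_simps T)
  then have "adj Y = Y"
    using tendsto_adj[OF Y] Y LIMSEQ_unique by fastforce
  moreover have "norm Y \<le> 1"
  proof (rule LIMSEQ_le_const2[OF tendsto_norm[OF Y]])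
    show "\<exists>N. \<forall>n\<ge>N. norm (sqrt_iter T n) \<le> 1"
      using norm_sqrt_iter[OF T(2)] sqrt_iter_bound_range order_trans by blast
  qed
  moreover have "(1 - Y) * (1 - Y) = 1 - T"
  proof -
    have "(\<lambda>n. (1/2) *\<^sub>R (T + sqrt_iter T n * sqrt_iter T n)) \<longlonglongrightarrow> (1/2) *\<^sub>R (T + Y * Y)"
      by (intro tendsto_intros Y)
    moreover have "(\<lambda>n. (1/2) *\<^sub>R (T + sqrt_iter T n * sqrt_iter T n)) \<longlonglongrightarrow> Y"
      using LIMSEQ_Suc[OF Y] by simp
    ultimately have "Y = (1/2) *\<^sub>R (T + Y * Y)" by (rule LIMSEQ_unique[symmetric])
    from arg_cong[OF this, of "\<lambda>x. 2 *\<^sub>R x"] have "2 *\<^sub>R Y = T + Y * Y" by simp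
    then have "Y + Y = T + Y * Y" by (simp add: scaleR_2)
    then show ?thesis by (simp add: algebra_simps)
  qed
  moreover have "Y \<in> C" if "closed_alg C" "T \<in> C" for C
    using closed_alg_lim[OF that(1) _ Y] sqrt_iter_in[OF that] by blast
  ultimately show ?thesis using that by blast
qed

section \<open>Positive operators\<close>

definition posop :: "'h::chilbert_space bop \<Rightarrow> bool" where
  "posop x \<longleftrightarrow> adj x = x \<and> (\<forall>v. 0 \<le> Re (cinner v (ap x v)))"

lemma posop_adj_mult: "posop (adj b * b)"
  unfolding posop_def by (simp add: adj_simps flip: norm_sq_ap)

lemma posop_cauchy_schwarz:
  assumes x: "posop x"
  shows "(cmod (cinner v (ap x w)))\<^sup>2 \<le> Re (cinner v (ap x v)) * Re (cinner w (ap x w))"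
proof (rule discriminant_bound)
  have sym: "cinner w (ap x v) = cnj (cinner v (ap x w))"
    using x unfolding posop_def by (metis cinner_ap_right cinner_commute)
  fix t :: complex
  have "0 \<le> Re (cinner (v + t *\<^sub>C w) (ap x (v + t *\<^sub>C w)))"
    using x unfolding posop_def by blast
  also have "cinner (v + t *\<^sub>C w) (ap x (v + t *\<^sub>C w)) = cinner v (ap x v)
      + (t * cinner v (ap x w) + cnj (t * cinner v (ap x w))) + (cnj t * t) * cinner w (ap x w)"
    by (simp add: ap_simps cinner_simps sym algebra_simps)
  also have "Re \<dots> = Re (cinner v (ap x v)) + 2 * Re (t * cinner v (ap x w))
      + (cmod t)\<^sup>2 * Re (cinner w (ap x w))"
    by (simp add: cmod_power2 power2_eq_square[of "Re t"] power2_eq_square[of "Im t"])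
  finally show "0 \<le> \<dots>" .
qed (use x in \<open>simp add: posop_def\<close>)

lemma posop_ap_eq_0: "posop x \<Longrightarrow> Re (cinner v (ap x v)) = 0 \<Longrightarrow> ap x v = 0"
  using posop_cauchy_schwarz[of x "ap x v" v] cinner_self[of "ap x v"] by simp

text \<open>Cauchy-Schwarz for the form of x at the pair \<open>ap x v\<close>, v bounds the fourth
  power of \<open>norm (ap x v)\<close> by its square times the square of
  \<open>norm v\<close>.\<close>

lemma posop_norm_le_1:
  assumes x: "posop x" "posop (1 - x)"
  shows "norm x \<le> 1"
proof (rule norm_bop_le)
  fix v
  have le: "Re (cinner w (ap x w)) \<le> (norm w)\<^sup>2" for w
    using x(2) unfolding posop_def by (simp add: ap_simps cinner_simps cinner_self del: of_real_power)
  have ge: "0 \<le> Re (cinner w (ap x w))" for w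
    using x(1) unfolding posop_def by blast
  have "((norm (ap x v))\<^sup>2)\<^sup>2 \<le> Re (cinner (ap x v) (ap x (ap x v))) * Re (cinner v (ap x v))"
    using posop_cauchy_schwarz[OF x(1), of "ap x v" v]
    by (simp add: cinner_self norm_power del: of_real_power)
  also have "\<dots> \<le> (norm (ap x v))\<^sup>2 * (norm v)\<^sup>2"
    by (intro mult_mono le ge) simp
  finally have "(norm (ap x v))\<^sup>2 * (norm (ap x v))\<^sup>2 \<le> (norm (ap x v))\<^sup>2 * (norm v)\<^sup>2"
    by (simp only: power2_eq_square[of "(norm (ap x v))\<^sup>2"])
  then have "(norm (ap x v))\<^sup>2 \<le> (norm v)\<^sup>2"
    using mult_left_le_imp_le[of "(norm (ap x v))\<^sup>2" "(norm (ap x v))\<^sup>2" "(norm v)\<^sup>2"]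
    by (cases "ap x v = 0") (simp_all only: zero_less_power2 norm_eq_zero, simp_all)
  then show "norm (ap x v) \<le> 1 * norm v"
    using power2_le_imp_le by fastforce
qed simp

lemma posop_one_minus: "posop (1 - x)" if "adj x = x" "norm x \<le> 1"
proof -
  have "Re (cinner v (ap x v)) \<le> (norm v)\<^sup>2" for v
  proof -
    have "Re (cinner v (ap x v)) \<le> norm v * norm (ap x v)"
      using norm_cinner_le complex_Re_le_cmod order_trans by blast
    also have "\<dots> \<le> norm v * norm v"
      using norm_ap_le[OF that(2), of v] by (intro mult_left_mono) auto
    finally show ?thesis by (simp add: power2_eq_square)
  qed
  then show ?thesis
    using that unfolding posop_def
    by (simp add: adj_simps ap_simps cinner_simps cinner_self del: of_real_power)
qed

lemma posop_scaleR: "posop x \<Longrightarrow> 0 \<le> r \<Longrightarrow> posop (r *\<^sub>R x)"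
  unfolding posop_def by (simp add: adj_simps ap_simps cinner_simps)

text \<open>This is \<open>sqrt_one_minus\<close> at 1 - a / norm a. That operator involves 1, hence
  the test algebras have to contain 1 here.\<close>

lemma posop_sqrt:
  assumes a: "posop a"
  obtains s where "adj s = s" "s * s = a" "posop s"
    "\<And>C. closed_alg C \<Longrightarrow> 1 \<in> C \<Longrightarrow> a \<in> C \<Longrightarrow> s \<in> C"
proof (cases "a = 0")
  case True
  then show ?thesis using that[of 0] a closed_alg_0 by simp
next
  case False
  define r where "r = norm a"
  have r: "r > 0" using False unfolding r_def by simp
  define a' where "a' = (1 / r) *\<^sub>R a"
  have a': "posop a'" "norm a' \<le> 1"
    unfolding a'_def using posop_scaleR[OF a, of "1 / r"] r by (simp_all add: r_def)
  have adja: "adj a' = a'" using a'(1) by (simp add: posop_def)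
  then have "adj (1 - a') = 1 - a'" by (simp add: adj_simps)
  moreover have "norm (1 - a') \<le> 1"
    using posop_one_minus[OF adja a'(2)] a'(1) by (intro posop_norm_le_1) simp_all
  ultimately obtain Y where Y: "adj Y = Y" "norm Y \<le> 1" "(1 - Y) * (1 - Y) = 1 - (1 - a')"
    "\<And>C. closed_alg C \<Longrightarrow> 1 - a' \<in> C \<Longrightarrow> Y \<in> C"
    using sqrt_one_minus by blast
  define s where "s = sqrt r *\<^sub>R (1 - Y)"
  have "adj s = s" unfolding s_def by (simp add: adj_simps Y)
  moreover have "s * s = a" unfolding s_def using Y(3) r by (simp add: a'_def)
  moreover have "posop s" unfolding s_def using r posop_one_minus[OF Y(1,2)] by (intro posop_scaleR) auto
  moreover have "s \<in> C" if "closed_alg C" "1 \<in> C" "a \<in> C" for C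
    unfolding s_def using that Y(4)[of C] by (auto simp: a'_def intro!: closed_alg_intros)
  ultimately show ?thesis using that by blast
qed

text \<open>The root s of a commutes with b as well, so \<open>a * b = s * b * s\<close>.\<close>

lemma posop_commuting_mult:
  assumes a: "posop a" and b: "posop b" and ab: "a * b = b * a"
  shows "posop (a * b)"
proof -
  obtain s where s: "adj s = s" "s * s = a" "\<And>C. closed_alg C \<Longrightarrow> 1 \<in> C \<Longrightarrow> a \<in> C \<Longrightarrow> s \<in> C"
    using posop_sqrt[OF a] by blast
  have sb: "s * b = b * s"
    using s(3)[OF closed_alg_commutant[of "{b}"]] ab by simp
  have "a * b = s * b * s" by (metis s(2) sb mult.assoc)
  then show ?thesis
    using b s(1) unfolding posop_def
    by (simp add: adj_simps ap_times mult.assoc) (simp add: cinner_ap_right[of _ s])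
qed

text \<open>The operator \<open>adj a * s * a\<close> is positive, but it is also minus the product of the commuting
  positive operators \<open>adj a * a\<close> and \<open>s\<close>.\<close>

lemma jordan_eq_0:
  assumes s: "posop s" and as: "a * s + s * a = 0"
  shows "a * s = 0" "s * a = 0"
proof -
  have sa: "s * a = - (a * s)" using as by (simp add: eq_neg_iff_add_eq_0 add.commute)
  have "adj (a * s + s * a) = 0" using as by simp
  then have sa': "s * adj a = - (adj a * s)"
    using s by (simp add: adj_simps posop_def eq_neg_iff_add_eq_0)
  \<comment> \<open>s anticommutes with a and with \<open>adj a\<close>, hence commutes with their
    product.\<close>
  have "s * (adj a * a) = (adj a * a) * s"
    by (metis (no_types, lifting) minus_mult_left minus_mult_right mult.assoc sa sa' minus_minus)
  then have "posop (adj a * a * s)"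
    using posop_commuting_mult[OF posop_adj_mult s, of a] by simp
  moreover have "adj a * (s * a) = - (adj a * a * s)"
    by (simp add: sa mult.assoc)
  ultimately have "ap s (ap a v) = 0" for v
  proof -
    have "Re (cinner (ap a v) (ap s (ap a v))) = Re (cinner v (ap (adj a * (s * a)) v))"
      by (simp add: ap_times cinner_ap_left)
    also have "\<dots> \<le> 0"
      using \<open>posop (adj a * a * s)\<close> \<open>adj a * (s * a) = _\<close> unfolding posop_def
      by (simp add: ap_minus cinner_simps)
    finally show ?thesis
      using s posop_ap_eq_0[OF s, of "ap a v"] unfolding posop_def by (metis order_antisym)
  qed
  then show "s * a = 0" by (intro bop_eqI) (simp add: ap_times)
  then show "a * s = 0" using as by simp
qed

text \<open>The absolute value: \<open>absop k + k\<close> and \<open>absop k - k\<close> are twice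
  the positive and negative parts of k. Applied to an operator minus a scalar they serve as spectral
  cut-offs.\<close>

definition absop :: "'h::chilbert_space bop \<Rightarrow> 'h bop" where
  "absop k = (SOME m. posop m \<and> m * m = k * k \<and> (\<forall>C. closed_alg C \<longrightarrow> 1 \<in> C \<longrightarrow> k \<in> C \<longrightarrow> m \<in> C))"

lemma absop:
  assumes k: "adj k = k"
  shows "posop (absop k)" "absop k * absop k = k * k"
    "\<And>C. closed_alg C \<Longrightarrow> 1 \<in> C \<Longrightarrow> k \<in> C \<Longrightarrow> absop k \<in> C"
proof -
  have "posop (k * k)" using posop_adj_mult[of k] k by simp
  then obtain s where "s * s = k * k" "posop s"
    "\<And>C. closed_alg C \<Longrightarrow> 1 \<in> C \<Longrightarrow> k * k \<in> C \<Longrightarrow> s \<in> C"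
    using posop_sqrt by blast
  then have "\<exists>m. posop m \<and> m * m = k * k \<and> (\<forall>C. closed_alg C \<longrightarrow> 1 \<in> C \<longrightarrow> k \<in> C \<longrightarrow> m \<in> C)"
    using closed_alg_times by blast
  from someI_ex[OF this, folded absop_def]
  show "posop (absop k)" "absop k * absop k = k * k"
    "\<And>C. closed_alg C \<Longrightarrow> 1 \<in> C \<Longrightarrow> k \<in> C \<Longrightarrow> absop k \<in> C" by blast+
qed

lemma absop_commute:
  assumes k: "adj k = k" and z: "k * z = z * k"
  shows "absop k * z = z * absop k"
  using absop(3)[OF k closed_alg_commutant[of "{z}"]] z by simp

lemma absop_parts_mult:
  assumes k: "adj k = k"
  shows "(absop k + k) * (absop k - k) = 0" "(absop k - k) * (absop k + k) = 0"
  using absop_commute[OF k, of k] absop(2)[OF k] by (simp_all add: algebra_simps)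

text \<open>Uniqueness of the positive root: \<open>absop k + k\<close> vanishes on the range of
  \<open>absop k - k\<close>, and two nonnegative forms with sum zero are both zero.\<close>

lemma absop_eq_self:
  assumes k: "posop k"
  shows "absop k = k"
proof -
  have ka: "adj k = k" and ma: "adj (absop k) = absop k"
    using k absop(1)[of k] unfolding posop_def by auto
  have "ap (absop k - k) (ap (absop k - k) v) = 0" for v
  proof -
    define y where "y = ap (absop k - k) v"
    have "ap ((absop k + k) * (absop k - k)) v = 0"
      using absop_parts_mult(1)[OF ka] by simp
    then have "ap (absop k) y + ap k y = 0" by (simp add: ap_times y_def ap_add)
    then have "Re (cinner y (ap (absop k) y)) + Re (cinner y (ap k y)) = 0"
      by (metis cinner_add_right cinner_zero_right plus_complex.simps(1) zero_complex.simps(1))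
    moreover have "0 \<le> Re (cinner y (ap (absop k) y))" "0 \<le> Re (cinner y (ap k y))"
      using k absop(1)[OF ka] unfolding posop_def by blast+
    ultimately have "Re (cinner y (ap (absop k) y)) = 0" "Re (cinner y (ap k y)) = 0" by auto
    then have "ap (absop k) y = 0" "ap k y = 0"
      using posop_ap_eq_0[OF k] posop_ap_eq_0[OF absop(1)[OF ka]] by blast+
    then have "ap (absop k - k) y = 0" by (simp add: ap_diff)
    then show ?thesis by (simp only: y_def)
  qed
  then have "adj (absop k - k) * (absop k - k) = 0"
    by (intro bop_eqI) (simp add: adj_simps ka ma ap_times)
  then show ?thesis by (simp add: adj_mult_eq_0)
qed

section \<open>Spikes and nilpotents\<close>

text \<open>With x = \<open>adj z * z\<close> the operators are e = min(2x, 1) and g = max(2x - 1,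
  0), so e is 1 wherever g lives. If g were 0, then 2x = Y would have norm at most 1. The form x +
  Y/2 of e is exported for estimates of states.\<close>

lemma spike:
  fixes z :: "'h::chilbert_space bop"
  assumes z: "norm z = 1" and M: "closed_alg M" "adj z * z \<in> M"
  obtains e g Y where "e = adj z * z + (1/2) *\<^sub>R Y" "adj e = e" "adj g = g" "norm Y \<le> 1"
    "e \<in> M" "g \<in> M" "Y \<in> M" "e * g = g" "g * e = g" "g \<noteq> 0"
    "\<And>C. closed_alg C \<Longrightarrow> adj z * z \<in> C \<Longrightarrow> e \<in> C"
proof -
  define x where "x = adj z * z"
  have x: "adj x = x" "norm x = 1" unfolding x_def using z by (simp_all add: adj_simps norm_adj_mult)
  \<comment> \<open>1 - T is the square of 2x - 1, so 1 - Y becomes the absolute value of 2x -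
    1.\<close>
  define T where "T = 4 *\<^sub>R (x - x * x)"
  define k where "k = 2 *\<^sub>R x - 1"
  have k: "adj k = k" unfolding k_def by (simp add: adj_simps x)
  have kk: "k * k = 1 - T"
  proof -
    have "4 *\<^sub>R y = 2 *\<^sub>R y + 2 *\<^sub>R y" for y :: "'h bop" by (simp flip: scaleR_left_distrib)
    moreover have "2 *\<^sub>R y + 2 *\<^sub>R (y + w) = 4 *\<^sub>R y + 2 *\<^sub>R w" for y w :: "'h bop"
      by (simp add: scaleR_right_distrib flip: scaleR_left_distrib)
    ultimately show ?thesis
      unfolding k_def T_def by (simp add: algebra_simps)
  qed
  have "posop (1 - T)" using posop_adj_mult[of k] by (simp add: k kk)
  moreover have "posop T"
  proof -
    have "posop (1 - x)" using posop_one_minus[OF x(1)] x(2) by simp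
    moreover have "posop x" unfolding x_def by (rule posop_adj_mult)
    ultimately have "posop (x * (1 - x))"
      by (intro posop_commuting_mult) (simp_all add: algebra_simps)
    then have "posop (4 *\<^sub>R (x * (1 - x)))" by (rule posop_scaleR) simp
    then show ?thesis by (simp add: T_def algebra_simps)
  qed
  ultimately have "norm T \<le> 1" "adj T = T"
    using posop_norm_le_1 by (auto simp: posop_def)
  then obtain Y where Y: "adj Y = Y" "norm Y \<le> 1" "(1 - Y) * (1 - Y) = 1 - T"
    "\<And>C. closed_alg C \<Longrightarrow> T \<in> C \<Longrightarrow> Y \<in> C"
    using sqrt_one_minus by blast
  have TC: "T \<in> C" if "closed_alg C" "x \<in> C" for C
    unfolding T_def using that by (intro closed_alg_intros)
  have YC: "Y \<in> C" if "closed_alg C" "x \<in> C" for C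
    using Y(4) TC that by blast
  have xY: "Y * x = x * Y"
    using YC[OF closed_alg_commutant[of "{x}"]] by simp
  define e where "e = x + (1/2) *\<^sub>R Y"
  define g where "g = x - (1/2) *\<^sub>R Y"
  have eC: "e \<in> C" and gC: "g \<in> C" if "closed_alg C" "x \<in> C" for C
    unfolding e_def g_def using that YC[OF that] by (auto intro!: closed_alg_intros)
  have YY: "Y * Y = Y + Y - T" using Y(3) by (simp add: algebra_simps)
  have "e * g = x * x - (1/4) *\<^sub>R (Y * Y)"
    unfolding e_def g_def by (simp add: algebra_simps xY)
  also have "\<dots> = g"
    unfolding YY T_def g_def by (simp add: algebra_simps flip: scaleR_2)
  finally have eg: "e * g = g" .
  have ae: "adj e = e" and ag: "adj g = g"
    unfolding e_def g_def by (simp_all add: adj_simps x Y)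
  have ge: "g * e = g" using arg_cong[OF eg, of adj] by (simp add: adj_simps ae ag)
  have "g \<noteq> 0"
  proof
    assume "g = 0"
    then have "2 *\<^sub>R x = Y" unfolding g_def by simp
    then have "2 * norm x \<le> 1" using Y(2) by (metis norm_scaleR abs_numeral)
    then show False using x by simp
  qed
  then show ?thesis
    using that[of e Y g] ae ag Y(2) eC gC YC eg ge M unfolding x_def e_def by blast
qed

section \<open>Nilpotents in noncommutative operator algebras\<close>

lemma nonzero_form:
  assumes c: "adj c = c" "c \<noteq> 0"
  obtains v where "Re (cinner v (ap c v)) \<noteq> 0"
proof (rule ccontr)
  assume "\<not> thesis"
  then have z: "Re (cinner v (ap c v)) = 0" for v using that by blast
  then have "posop c" using c(1) by (simp add: posop_def)
  then have "c = 0" using posop_ap_eq_0[OF _ z] by (intro bop_eqI) simp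
  then show False using c(2) by simp
qed

lemma cmul_minus_left: "cmul (- c) x = - cmul c x"
  using cmul_simps(3)[of "-1" c x] by (simp add: minus_cmul)

lemma cartesian_parts:
  obtains p q where "x = p + cmul \<i> q" "adj p = p" "adj q = q"
    "\<And>C. closed_alg C \<Longrightarrow> x \<in> C \<Longrightarrow> adj x \<in> C \<Longrightarrow> p \<in> C \<and> q \<in> C"
proof
  show "x = cmul (1/2) (x + adj x) + cmul \<i> (cmul (- \<i> / 2) (x - adj x))"
    by (rule bop_eqI) (simp add: ap_simps scaleC_scaleC scaleC_add_right scaleC_diff_right
        scaleC_add_left[symmetric] scaleC_one)
  show "adj (cmul (1/2) (x + adj x)) = cmul (1/2) (x + adj x)"
    by (simp add: adj_simps add.commute)
  show "adj (cmul (- \<i> / 2) (x - adj x)) = cmul (- \<i> / 2) (x - adj x)"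
    by (simp add: adj_simps cmul_simps cmul_minus_left)
qed (auto intro!: closed_alg_intros)

lemma selfadjoint_noncommuting:
  assumes C: "closed_alg C" "\<And>x. x \<in> C \<Longrightarrow> adj x \<in> C"
    and ab: "a \<in> C" "b \<in> C" "a * b \<noteq> b * a"
  obtains h k where "h \<in> C" "k \<in> C" "adj h = h" "adj k = k" "h * k \<noteq> k * h"
proof (rule ccontr)
  assume "\<not> thesis"
  with that have contra: "\<not> (h \<in> C \<and> k \<in> C \<and> adj h = h \<and> adj k = k \<and> h * k \<noteq> k * h)" for h k by blast
  have comm: "h * k = k * h" if "h \<in> C" "k \<in> C" "adj h = h" "adj k = k" for h k
    using that contra by blast
  obtain p q where a: "a = p + cmul \<i> q" "adj p = p" "adj q = q" "p \<in> C" "q \<in> C"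
    using cartesian_parts[of a] C ab by metis
  obtain r s where b: "b = r + cmul \<i> s" "adj r = r" "adj s = s" "r \<in> C" "s \<in> C"
    using cartesian_parts[of b] C ab by metis
  have "a * b = b * a"
    unfolding a(1) b(1) using comm[of p r] comm[of p s] comm[of q r] comm[of q s] a b
    by (simp add: algebra_simps cmul_simps)
  then show False using ab by blast
qed

text \<open>The last two equations confine the range of \<open>g * w0\<close> to the spectral
  subspace of h for an interval of length 2 norm h / 2^n with left end \<alpha>. Starting from the
  interval between -norm h and norm h, each step keeps a half on which something survives.\<close>

lemma bisection:
  fixes h :: "'h::chilbert_space bop"
  assumes h: "adj h = h" and w0: "w0 \<noteq> 0" and L: "closed_alg L" "1 \<in> L" "h \<in> L"
  shows "\<exists>\<alpha> g. g \<in> L \<and> g * w0 \<noteq> 0 \<and>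
    (absop (h - \<alpha> *\<^sub>R 1) - (h - \<alpha> *\<^sub>R 1)) * (g * w0) = 0 \<and>
    (absop (h - (\<alpha> + 2 * norm h / 2 ^ n) *\<^sub>R 1) + (h - (\<alpha> + 2 * norm h / 2 ^ n) *\<^sub>R 1)) * (g * w0) = 0"
proof -
  define N where "N = (\<lambda>\<alpha>. absop (h - \<alpha> *\<^sub>R 1) - (h - \<alpha> *\<^sub>R 1))"
  define P where "P = (\<lambda>\<alpha>. absop (h - \<alpha> *\<^sub>R 1) + (h - \<alpha> *\<^sub>R 1))"
  have sa: "adj (h - \<alpha> *\<^sub>R 1) = h - \<alpha> *\<^sub>R 1" for \<alpha> by (simp add: adj_simps h)
  have Pin: "P \<alpha> \<in> C" if "closed_alg C" "1 \<in> C" "h \<in> C" for \<alpha> C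
  proof -
    have "h - \<alpha> *\<^sub>R 1 \<in> C" using that by (intro closed_alg_intros)
    then show ?thesis unfolding P_def using that absop(3)[OF sa] by (intro closed_alg_add) auto
  qed
  have hP: "P \<alpha> * h = h * P \<alpha>" for \<alpha>
    using Pin[OF closed_alg_commutant[of "{h}"]] by simp
  have PP: "P \<alpha> * P \<beta> = P \<beta> * P \<alpha>" for \<alpha> \<beta>
    using Pin[OF closed_alg_commutant[of "{P \<beta>}"], of \<alpha>] hP[of \<beta>] by simp
  have NP: "N \<alpha> * P \<alpha> = 0" for \<alpha>
    unfolding N_def P_def by (rule absop_parts_mult[OF sa])
  have "\<exists>\<alpha> g. g \<in> L \<and> g * w0 \<noteq> 0 \<and> N \<alpha> * (g * w0) = 0 \<and> P (\<alpha> + 2 * norm h / 2 ^ n) * (g * w0) = 0"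
  proof (induction n)
    case 0
    have pos: "posop (norm h *\<^sub>R 1 + s *\<^sub>R h)" if "\<bar>s\<bar> = 1" for s
    proof (cases "h = 0")
      case False
      have "posop (1 - (- s / norm h) *\<^sub>R h)"
        using False that h by (intro posop_one_minus) (simp_all add: adj_simps)
      then have "posop (norm h *\<^sub>R (1 - (- s / norm h) *\<^sub>R h))" by (rule posop_scaleR) simp
      then show ?thesis using False by (simp add: algebra_simps)
    qed (simp add: posop_def)
    have "N (- norm h) = 0"
      using absop_eq_self[OF pos[of 1]] by (simp add: N_def add.commute)
    moreover have "P (norm h) = 0"
    proof -
      have k: "posop (norm h *\<^sub>R 1 - h)" using pos[of "-1"] by simp
      have "absop (h - norm h *\<^sub>R 1) = absop (norm h *\<^sub>R 1 - h)"
      proof -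
        have "h - norm h *\<^sub>R 1 = - (norm h *\<^sub>R 1 - h)" by simp
        \<comment> \<open>The two predicates behind the choice are equal, since k enters only
          through k * k and the closed algebras containing it; so the same operator is
          chosen.\<close>
        moreover have "absop (- k) = absop k" for k :: "'h bop"
        proof -
          have "- k \<in> C \<longleftrightarrow> k \<in> C" if "closed_alg C" for C
            using closed_alg_minus[OF that, of k] closed_alg_minus[OF that, of "-k"] by auto
          then have "(\<lambda>m. posop m \<and> m * m = - k * - k \<and> (\<forall>C. closed_alg C \<longrightarrow> 1 \<in> C \<longrightarrow> - k \<in> C \<longrightarrow> m \<in> C))
              = (\<lambda>m. posop m \<and> m * m = k * k \<and> (\<forall>C. closed_alg C \<longrightarrow> 1 \<in> C \<longrightarrow> k \<in> C \<longrightarrow> m \<in> C))"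
            by (intro ext) simp
          then show ?thesis unfolding absop_def by (rule arg_cong[where f = Eps])
        qed
        ultimately show ?thesis by (simp only:)
      qed
      then show ?thesis using absop_eq_self[OF k] by (simp add: P_def)
    qed
    ultimately show ?case
      using L(2) w0 by (intro exI[of _ "- norm h"] exI[of _ 1]) simp
  next
    case (Suc n)
    then obtain \<alpha> g where g: "g \<in> L" "g * w0 \<noteq> 0" "N \<alpha> * (g * w0) = 0"
      "P (\<alpha> + 2 * norm h / 2 ^ n) * (g * w0) = 0" by blast
    define \<mu> where "\<mu> = \<alpha> + 2 * norm h / 2 ^ Suc n"
    have \<beta>: "\<alpha> + 2 * norm h / 2 ^ n = \<mu> + 2 * norm h / 2 ^ Suc n"
      unfolding \<mu>_def by (simp add: field_simps)
    show ?case
    proof (cases "P \<mu> * (g * w0) = 0")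
      case True
      then show ?thesis using g unfolding \<mu>_def by blast
    next
      case False
      \<comment> \<open>The part above the midpoint survives: the factor \<open>P \<mu>\<close>
        moves the range above \<mu>, and since the operators P commute the old upper bound is
        kept.\<close>
      have "N \<mu> * (P \<mu> * g * w0) = 0" using NP[of \<mu>] by (simp flip: mult.assoc)
      moreover have "P (\<mu> + 2 * norm h / 2 ^ Suc n) * (P \<mu> * g * w0) = 0"
      proof -
        have "P (\<mu> + 2 * norm h / 2 ^ Suc n) * (P \<mu> * g * w0)
            = P \<mu> * (P (\<mu> + 2 * norm h / 2 ^ Suc n) * (g * w0))"
          by (simp only: mult.assoc[symmetric] PP[of _ \<mu>])
        then show ?thesis using g(4) unfolding \<beta> by simp
      qed
      moreover have "P \<mu> * g \<in> L" by (rule closed_alg_times[OF L(1) Pin[OF L] g(1)])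
      ultimately show ?thesis using False
        by (intro exI[of _ \<mu>] exI[of _ "P \<mu> * g"]) (simp add: mult.assoc)
    qed
  qed
  then show ?thesis unfolding N_def P_def by blast
qed

text \<open>The commutator \<open>c = i[h,b]\<close> is compressed by spectral cut-offs of \<open>c\<close> and \<open>h\<close>. Were there no
  nilpotents, a vector could be found on which \<open>c\<close> is bounded below while \<open>h\<close> is nearly a scalar,
  and there the commutator would be small.\<close>

lemma exists_nilpotent:
  fixes B :: "'h::chilbert_space bop set"
  assumes B: "closed_alg B" "\<And>x. x \<in> B \<Longrightarrow> adj x \<in> B"
    and ab: "a \<in> B" "b \<in> B" "a * b \<noteq> b * a"
  obtains z where "z \<in> B" "z \<noteq> 0" "z * z = 0"
proof (rule ccontr)
  assume "\<not> thesis"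
  with that have contra: "\<not> (z \<in> B \<and> z \<noteq> 0 \<and> z * z = 0)" for z by blast
  have nil: "z = 0" if "z \<in> B" "z * z = 0" for z using that contra by blast
  obtain h0 b where hb: "h0 \<in> B" "b \<in> B" "adj h0 = h0" "adj b = b" "h0 * b \<noteq> b * h0"
    using selfadjoint_noncommuting[OF B ab] by blast
  define c0 where "c0 = cmul \<i> (h0 * b - b * h0)"
  have "adj c0 = c0"
    unfolding c0_def by (simp add: adj_simps hb cmul_simps cmul_minus_left)
  moreover have "c0 \<noteq> 0"
    using hb(5) norm_cmul[of \<i> "h0 * b - b * h0"] unfolding c0_def by auto
  ultimately obtain v where v: "Re (cinner v (ap c0 v)) \<noteq> 0" using nonzero_form by blast
  \<comment> \<open>The sign makes the form of the commutator positive at v.\<close>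
  define h where "h = (if Re (cinner v (ap c0 v)) > 0 then h0 else - h0)"
  have h: "h \<in> B" "adj h = h" using hb B(1) by (auto simp: h_def adj_simps closed_alg_minus)
  define c where "c = cmul \<i> (h * b - b * h)"
  have c: "c = (if Re (cinner v (ap c0 v)) > 0 then c0 else - c0)"
    unfolding c_def c0_def h_def by (simp add: cmul_simps)
  have cv: "Re (cinner v (ap c v)) > 0"
    using v unfolding c by (simp add: ap_minus cinner_minus_right)
  have ca: "adj c = c" unfolding c using \<open>adj c0 = c0\<close> by (auto simp: adj_simps)
  have cB: "c \<in> B" unfolding c_def
    using h hb B(1) by (intro closed_alg_cmul closed_alg_diff closed_alg_times)
  have v0: "v \<noteq> 0" using cv by auto
  \<comment> \<open>Half the Rayleigh quotient of c at v, so that the part of c above \<gamma>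
    cannot vanish.\<close>
  define \<gamma> where "\<gamma> = Re (cinner v (ap c v)) / (2 * (norm v)\<^sup>2)"
  have \<gamma>: "\<gamma> > 0" "Re (cinner v (ap c v)) > \<gamma> * (norm v)\<^sup>2"
    unfolding \<gamma>_def using cv v0 by (simp_all add: field_simps)
  define k where "k = c - \<gamma> *\<^sub>R 1"
  have k: "adj k = k" unfolding k_def by (simp add: adj_simps ca)
  define m where "m = absop k"
  have m: "posop m" "m * m = k * k" "\<And>z. k * z = z * k \<Longrightarrow> m * z = z * m"
    unfolding m_def by (rule absop(1)[OF k], rule absop(2)[OF k], rule absop_commute[OF k])
  have ma: "adj m = m" using m(1) by (simp add: posop_def)
  define P where "P = m + k"
  define N where "N = m - k"
  have PN: "P * N = 0" unfolding P_def N_def m_def by (rule absop_parts_mult[OF k])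
  have kc: "k * c = c * k" unfolding k_def by (simp add: algebra_simps)
  have cN: "c * N = N * c" and cP: "c * P = P * c" unfolding N_def P_def using m(3)[OF kc] kc by (simp_all add: algebra_simps)
  define L where "L = {x. \<forall>b\<in>B. x * b \<in> B}"
  have L: "closed_alg L" "1 \<in> L" unfolding L_def using closed_alg_left_multipliers[OF B(1)] by auto
  have BL: "x \<in> L" if "x \<in> B" for x unfolding L_def using closed_alg_times[OF B(1) that] by blast
  have kL: "k \<in> L" unfolding k_def using L BL[OF cB] by (intro closed_alg_diff closed_alg_scaleR)
  have mL: "m \<in> L" unfolding m_def using absop(3)[OF k L kL] .
  \<comment> \<open>P is only a left multiplier of \<open>B\<close>; the factor c brings the product
    into \<open>B\<close>.\<close>
  define w0 where "w0 = P * c"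
  have w0B: "w0 \<in> B"
    using closed_alg_add[OF L(1) mL kL] cB unfolding w0_def P_def L_def by simp
  \<comment> \<open>If P * c were 0, then P * k = P * m would give m * P + \<gamma> P = 0, so P = 0
    by positivity, and c would be at most \<gamma>, against the choice of v.\<close>
  have "w0 \<noteq> 0"
  proof
    assume w: "w0 = 0"
    have "2 *\<^sub>R (P * k) = P * P - P * N" unfolding N_def P_def by (simp add: algebra_simps scaleR_2)
    moreover have "2 *\<^sub>R (P * m) = P * P + P * N" unfolding N_def P_def by (simp add: algebra_simps scaleR_2)
    ultimately have "2 *\<^sub>R (P * k) = 2 *\<^sub>R (P * m)" using PN by simp
    then have Pk: "P * k = P * m" by simp
    have "P * m + \<gamma> *\<^sub>R P = 0"
      using w unfolding Pk[symmetric] w0_def by (simp add: k_def algebra_simps)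
    moreover have "adj (P * m + \<gamma> *\<^sub>R P) = m * P + \<gamma> *\<^sub>R P"
      by (simp add: adj_simps P_def ma k)
    ultimately have *: "m * P + \<gamma> *\<^sub>R P = 0" by simp
    have "ap P u = 0" for u
    proof -
      have "Re (cinner (ap P u) (ap (m * P + \<gamma> *\<^sub>R P) u)) = 0" using * by simp
      then have "Re (cinner (ap P u) (ap m (ap P u))) + \<gamma> * (norm (ap P u))\<^sup>2 = 0"
        by (simp add: ap_simps cinner_simps cinner_self del: of_real_power)
      moreover have "0 \<le> Re (cinner (ap P u) (ap m (ap P u)))" using m(1) by (simp add: posop_def)
      moreover have "0 \<le> \<gamma> * (norm (ap P u))\<^sup>2" using \<gamma> by simp
      ultimately have "\<gamma> * (norm (ap P u))\<^sup>2 = 0" by linarith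
      then show ?thesis using \<gamma> by simp
    qed
    then have "P = 0" by (intro bop_eqI) simp
    then have "c = \<gamma> *\<^sub>R 1 - m" unfolding P_def k_def by (simp add: algebra_simps)
    then have "Re (cinner v (ap c v)) = \<gamma> * (norm v)\<^sup>2 - Re (cinner v (ap m v))"
      by (simp add: ap_simps cinner_simps cinner_self del: of_real_power)
    moreover have "0 \<le> Re (cinner v (ap m v))" using m(1) by (simp add: posop_def)
    ultimately show False using \<gamma>(2) by linarith
  qed
  \<comment> \<open>The square is 0 because w0 * N = P * N * c = 0. Without nilpotents the range of
    g * w0 therefore lies where c is at least \<gamma>, whatever left multiplier g is.\<close>
  have Nw: "N * (g * w0) = 0" if "g \<in> L" for g
  proof (rule nil)
    have "N \<in> L" unfolding N_def using L(1) mL kL by (rule closed_alg_diff)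
    then show "N * (g * w0) \<in> B" using w0B that unfolding L_def by simp
    have "w0 * N = P * N * c" unfolding w0_def by (simp add: mult.assoc cN)
    then have "N * g * (w0 * N) * (g * w0) = 0" using PN by simp
    then show "N * (g * w0) * (N * (g * w0)) = 0" by (simp only: mult.assoc)
  qed
  \<comment> \<open>On the selected vectors the form of the commutator is at most 2 \<delta> norm b;
    this n pushes that below \<gamma>.\<close>
  obtain n :: nat where n: "8 * norm h * norm b / \<gamma> < 2 ^ n"
    using real_arch_pow[of 2 "8 * norm h * norm b / \<gamma>"] by auto
  define \<delta> where "\<delta> = 2 * norm h / 2 ^ n"
  have "2 * \<delta> * norm b < \<gamma>"
  proof -
    have "4 * norm h * norm b \<le> 8 * norm h * norm b" by simp
    also have "\<dots> < \<gamma> * 2 ^ n" using n \<gamma>(1) by (simp add: field_simps)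
    finally show ?thesis unfolding \<delta>_def by (simp add: field_simps)
  qed
  obtain \<alpha> g where g: "g \<in> L" "g * w0 \<noteq> 0"
    and N\<alpha>: "(absop (h - \<alpha> *\<^sub>R 1) - (h - \<alpha> *\<^sub>R 1)) * (g * w0) = 0"
    and P\<beta>: "(absop (h - (\<alpha> + \<delta>) *\<^sub>R 1) + (h - (\<alpha> + \<delta>) *\<^sub>R 1)) * (g * w0) = 0"
    using bisection[OF h(2) \<open>w0 \<noteq> 0\<close> L BL[OF h(1)], of n] unfolding \<delta>_def by blast
  obtain u where u: "ap (g * w0) u \<noteq> 0" using g(2) by (metis ap_0 bop_eqI)
  define y where "y = ap (g * w0) u"
  have y0: "y \<noteq> 0" using u y_def by simp
  have ap0: "ap x y = 0" if "x * (g * w0) = 0" for x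
    using that ap_times[of x "g * w0" u] unfolding y_def by simp
  have "ap m y = ap k y" using ap0[OF Nw[OF g(1)]] by (simp add: N_def ap_diff)
  moreover have "0 \<le> Re (cinner y (ap m y))" using m(1) unfolding posop_def by blast
  ultimately have "0 \<le> Re (cinner y (ap k y))" by simp
  then have low: "\<gamma> * (norm y)\<^sup>2 \<le> Re (cinner y (ap c y))"
    unfolding k_def by (simp add: ap_simps cinner_simps cinner_self del: of_real_power)
  define K where "K = h - \<alpha> *\<^sub>R 1"
  have Ka: "adj K = K" unfolding K_def by (simp add: adj_simps h)
  have K': "h - (\<alpha> + \<delta>) *\<^sub>R 1 = K - \<delta> *\<^sub>R 1" unfolding K_def by (simp add: algebra_simps)
  have K'a: "adj (K - \<delta> *\<^sub>R 1) = K - \<delta> *\<^sub>R 1" by (simp add: adj_simps Ka)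
  have m1: "ap (absop K) y = ap K y" using ap0[OF N\<alpha>] unfolding K_def by (simp add: ap_diff)
  have m2: "ap (absop (K - \<delta> *\<^sub>R 1)) y = \<delta> *\<^sub>R y - ap K y"
    using ap0[OF P\<beta>] unfolding K' by (simp add: ap_simps algebra_simps)
  \<comment> \<open>On y the two absolute values act as K and \<delta> - K, so positivity of their
    product bounds the square of \<open>norm (ap K y)\<close> by \<delta> times the form of K at
    y.\<close>
  have "posop (absop K * absop (K - \<delta> *\<^sub>R 1))"
  proof (rule posop_commuting_mult)
    show "posop (absop K)" "posop (absop (K - \<delta> *\<^sub>R 1))" by (rule absop(1)[OF Ka], rule absop(1)[OF K'a])
    have "(K - \<delta> *\<^sub>R 1) * K = K * (K - \<delta> *\<^sub>R 1)" by (simp add: algebra_simps)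
    then have "K * absop (K - \<delta> *\<^sub>R 1) = absop (K - \<delta> *\<^sub>R 1) * K"
      using absop_commute[OF K'a, of K] by simp
    then show "absop K * absop (K - \<delta> *\<^sub>R 1) = absop (K - \<delta> *\<^sub>R 1) * absop K"
      using absop_commute[OF Ka] by simp
  qed
  then have "0 \<le> Re (cinner y (ap (absop K * absop (K - \<delta> *\<^sub>R 1)) y))" by (simp add: posop_def)
  also have "cinner y (ap (absop K * absop (K - \<delta> *\<^sub>R 1)) y) = cinner (ap K y) (\<delta> *\<^sub>R y - ap K y)"
    using absop(1)[OF Ka] by (simp add: ap_times cinner_ap_right[of y "absop K"] posop_def m1 m2)
  finally have "(norm (ap K y))\<^sup>2 \<le> \<delta> * Re (cinner (ap K y) y)"
    by (simp add: cinner_simps cinner_self del: of_real_power)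
  also have "\<dots> \<le> \<delta> * (norm (ap K y) * norm y)"
    using norm_cinner_le[of "ap K y" y] complex_Re_le_cmod[of "cinner (ap K y) y"]
    by (intro mult_left_mono) (auto simp: \<delta>_def)
  finally have "norm (ap K y) * norm (ap K y) \<le> norm (ap K y) * (\<delta> * norm y)"
    by (simp add: power2_eq_square mult_ac)
  note le = this
  have Ky: "norm (ap K y) \<le> \<delta> * norm y"
  proof (cases "ap K y = 0")
    case False
    then show ?thesis by (intro mult_left_le_imp_le[OF le]) simp
  qed (simp add: \<delta>_def)
  \<comment> \<open>The scalar shift from h to K does not change the commutator.\<close>
  have "h * b - b * h = K * b - b * K" unfolding K_def by (simp add: algebra_simps)
  then have "ap c y = \<i> *\<^sub>C (ap K (ap b y) - ap b (ap K y))"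
    unfolding c_def by (simp add: ap_simps)
  then have "cinner y (ap c y) = \<i> * (cinner (ap K y) (ap b y) - cinner (ap b y) (ap K y))"
    by (simp add: cinner_simps cinner_ap_right[of y] Ka hb)
  then have "cmod (cinner y (ap c y)) \<le> cmod (cinner (ap K y) (ap b y)) + cmod (cinner (ap b y) (ap K y))"
    by (simp add: norm_mult norm_triangle_ineq4)
  also have "\<dots> \<le> norm (ap K y) * norm (ap b y) + norm (ap b y) * norm (ap K y)"
    by (intro add_mono norm_cinner_le)
  also have "\<dots> = 2 * (norm (ap K y) * norm (ap b y))" by simp
  also have "\<dots> \<le> 2 * ((\<delta> * norm y) * (norm b * norm y))"
    using Ky norm_ap[of b y] by (intro mult_left_mono mult_mono) (auto simp: \<delta>_def)
  also have "\<dots> = (2 * \<delta> * norm b) * (norm y)\<^sup>2" by (simp add: power2_eq_square)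
  also have "\<dots> < \<gamma> * (norm y)\<^sup>2"
    using \<open>2 * \<delta> * norm b < \<gamma>\<close> y0 by (intro mult_strict_right_mono) auto
  finally show False using low complex_Re_le_cmod[of "cinner y (ap c y)"] by linarith
qed

section \<open>The GNS construction\<close>

locale cstar =
  fixes A :: "'h::chilbert_space bop set"
  assumes alg: "closed_alg A" and star: "x \<in> A \<Longrightarrow> adj x \<in> A"
begin

lemmas A_intros = closed_alg_0[OF alg] closed_alg_add[OF alg] closed_alg_cmul[OF alg]
  closed_alg_times[OF alg] closed_alg_scaleR[OF alg] closed_alg_minus[OF alg]
  closed_alg_diff[OF alg] star

end

locale pos_functional = cstar A for A :: "'h::chilbert_space bop set" +
  fixes \<phi> :: "'h bop \<Rightarrow> complex"
  assumes phi_add: "a \<in> A \<Longrightarrow> b \<in> A \<Longrightarrow> \<phi> (a + b) = \<phi> a + \<phi> b"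
    and phi_cmul: "a \<in> A \<Longrightarrow> \<phi> (cmul c a) = c * \<phi> a"
    and phi_adj: "a \<in> A \<Longrightarrow> \<phi> (adj a) = cnj (\<phi> a)"
    and phi_pos: "a \<in> A \<Longrightarrow> 0 \<le> Re (\<phi> (adj a * a))"
begin

lemma phi_0: "\<phi> 0 = 0"
  using phi_cmul[of 0 0] by (simp add: A_intros cmul_simps)

lemma phi_minus: "a \<in> A \<Longrightarrow> \<phi> (- a) = - \<phi> a"
  by (simp add: minus_cmul phi_cmul)

lemma phi_diff: "a \<in> A \<Longrightarrow> b \<in> A \<Longrightarrow> \<phi> (a - b) = \<phi> a - \<phi> b"
  using phi_add[of a "- b"] by (simp add: phi_minus A_intros)

lemma phi_scaleR: "a \<in> A \<Longrightarrow> \<phi> (r *\<^sub>R a) = complex_of_real r * \<phi> a"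
  by (simp add: scaleR_cmul phi_cmul)

lemmas phi_simps = phi_0 phi_add phi_cmul phi_minus phi_diff phi_scaleR

lemma phi_swap: "a \<in> A \<Longrightarrow> b \<in> A \<Longrightarrow> \<phi> (adj b * a) = cnj (\<phi> (adj a * b))"
  using phi_adj[of "adj a * b"] by (simp add: A_intros adj_simps)

lemma phi_self: "a \<in> A \<Longrightarrow> \<phi> (adj a * a) = complex_of_real (Re (\<phi> (adj a * a)))"
  using phi_swap[of a a] by (metis Reals_cnj_iff of_real_Re)

lemma phi_cauchy_schwarz:
  assumes ab: "a \<in> A" "b \<in> A"
  shows "(cmod (\<phi> (adj a * b)))\<^sup>2 \<le> Re (\<phi> (adj a * a)) * Re (\<phi> (adj b * b))"
proof (rule discriminant_bound)
  fix t :: complex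
  have "0 \<le> Re (\<phi> (adj (a + cmul t b) * (a + cmul t b)))"
    using ab by (intro phi_pos A_intros)
  also have "\<phi> (adj (a + cmul t b) * (a + cmul t b)) = \<phi> (adj a * a)
     + (t * \<phi> (adj a * b) + cnj (t * \<phi> (adj a * b))) + (cnj t * t) * \<phi> (adj b * b)"
    using ab by (simp add: adj_simps distrib_left distrib_right cmul_simps phi_simps A_intros phi_swap[of b a] algebra_simps)
  also have "Re \<dots> = Re (\<phi> (adj a * a)) + 2 * Re (t * \<phi> (adj a * b)) + (cmod t)\<^sup>2 * Re (\<phi> (adj b * b))"
    by (subst phi_self[OF ab(2)]) (simp add: cmod_power2 power2_eq_square[of "Re t"] power2_eq_square[of "Im t"])
  finally show "0 \<le> \<dots>" .
qed (simp add: phi_pos ab)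

text \<open>For a' = a / norm a, the difference \<open>adj b * b - adj (a' * b) * (a' * b)\<close>
  equals \<open>adj u * u\<close> with u = b - Y * b, which lies in \<open>A\<close> even without a
  unit. This makes left multiplication bounded on the GNS vectors.\<close>

lemma phi_contract:
  assumes ab: "a \<in> A" "b \<in> A"
  shows "Re (\<phi> (adj (a * b) * (a * b))) \<le> (norm a)\<^sup>2 * Re (\<phi> (adj b * b))"
proof (cases "a = 0")
  case False
  define r where "r = norm a"
  have r: "r > 0" using False by (simp add: r_def)
  define a' where "a' = (1 / r) *\<^sub>R a"
  have a': "a' \<in> A" "norm a' = 1" "a = r *\<^sub>R a'"
    using ab r by (simp_all add: a'_def r_def A_intros)
  have "adj (adj a' * a') = adj a' * a'" "norm (adj a' * a') \<le> 1"
    using a' by (simp_all add: adj_simps norm_adj_mult)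
  then obtain Y where Y: "adj Y = Y" "(1 - Y) * (1 - Y) = 1 - adj a' * a'"
    "\<And>C. closed_alg C \<Longrightarrow> adj a' * a' \<in> C \<Longrightarrow> Y \<in> C"
    using sqrt_one_minus by blast
  have YA: "Y \<in> A" using Y(3)[OF alg] a'(1) by (simp add: A_intros)
  define u where "u = b - Y * b"
  have uA: "u \<in> A" unfolding u_def using ab YA by (intro A_intros)
  have "adj u * u = adj b * ((1 - Y) * (1 - Y)) * b"
    unfolding u_def by (simp add: adj_simps Y algebra_simps)
  also have "\<dots> = adj b * b - adj (a' * b) * (a' * b)"
    unfolding Y by (simp add: adj_simps algebra_simps)
  finally have "0 \<le> Re (\<phi> (adj b * b - adj (a' * b) * (a' * b)))" using phi_pos[OF uA] by simp
  then have le: "Re (\<phi> (adj (a' * b) * (a' * b))) \<le> Re (\<phi> (adj b * b))"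
    using ab a' by (simp add: phi_simps A_intros)
  have "adj (a * b) * (a * b) = (r * r) *\<^sub>R (adj (a' * b) * (a' * b))"
    unfolding a'(3) by (simp add: adj_simps)
  then have "Re (\<phi> (adj (a * b) * (a * b))) = r\<^sup>2 * Re (\<phi> (adj (a' * b) * (a' * b)))"
    using ab a' by (simp add: phi_simps A_intros power2_eq_square)
  also have "\<dots> \<le> r\<^sup>2 * Re (\<phi> (adj b * b))" using le by (intro mult_left_mono) auto
  finally show ?thesis by (simp add: r_def)
qed (use phi_pos[OF ab(2)] in \<open>simp add: phi_0\<close>)

text \<open>The GNS space is realised inside a given Hilbert space with an orthonormal family indexed by
  operators: each new vector is its projection to the vectors chosen so far plus a multiple of the
  basis vector with its own index. Graphs of partial isometries are used instead of partial
  functions.\<close>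

definition partial_gns :: "('h bop \<Rightarrow> 'k::chilbert_space) \<Rightarrow> ('h bop \<times> 'k) set \<Rightarrow> bool" where
  "partial_gns e G \<longleftrightarrow> (0, 0) \<in> G \<and> fst ` G \<subseteq> A \<and>
     (\<forall>x y x' y'. (x, y) \<in> G \<longrightarrow> (x', y') \<in> G \<longrightarrow> (x + x', y + y') \<in> G) \<and>
     (\<forall>c x y. (x, y) \<in> G \<longrightarrow> (cmul c x, c *\<^sub>C y) \<in> G) \<and>
     (\<forall>x y x' y'. (x, y) \<in> G \<longrightarrow> (x', y') \<in> G \<longrightarrow> cinner y y' = \<phi> (adj x * x')) \<and>
     (\<forall>x y b. (x, y) \<in> G \<longrightarrow> b \<notin> fst ` G \<longrightarrow> cinner (e b) y = 0)"

lemma partial_gnsD: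
  assumes "partial_gns e G"
  shows "(0, 0) \<in> G" "\<And>x y. (x, y) \<in> G \<Longrightarrow> x \<in> A"
    "\<And>x y x' y'. (x, y) \<in> G \<Longrightarrow> (x', y') \<in> G \<Longrightarrow> (x + x', y + y') \<in> G"
    "\<And>c x y. (x, y) \<in> G \<Longrightarrow> (cmul c x, c *\<^sub>C y) \<in> G"
    "\<And>x y x' y'. (x, y) \<in> G \<Longrightarrow> (x', y') \<in> G \<Longrightarrow> cinner y y' = \<phi> (adj x * x')"
    "\<And>x y b. (x, y) \<in> G \<Longrightarrow> b \<notin> fst ` G \<Longrightarrow> cinner (e b) y = 0"
  using assms unfolding partial_gns_def by (simp_all add: image_subset_iff) auto

text \<open>The inner products of the new vector with the old ones are prescribed, which fixes its
  projection p by Riesz. The length still missing is spent along \<open>e a\<close>, which is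
  orthogonal to everything used so far because a is not yet in the domain.\<close>

lemma partial_gns_extend:
  fixes e :: "'h bop \<Rightarrow> 'k::chilbert_space"
  assumes e: "orthonormal_family e" and G: "partial_gns e G" and a: "a \<in> A" "a \<notin> fst ` G"
  shows "\<exists>G'. partial_gns e G' \<and> G \<subset> G'"
proof -
  note G0 = partial_gnsD(1)[OF G] and GA = partial_gnsD(2)[OF G] and Gadd = partial_gnsD(3)[OF G]
    and Gsc = partial_gnsD(4)[OF G] and Gin = partial_gnsD(5)[OF G] and Gorth = partial_gnsD(6)[OF G]
  define C where "C = sqrt (Re (\<phi> (adj a * a)))"
  have C: "0 \<le> C" "C\<^sup>2 = Re (\<phi> (adj a * a))" using phi_pos[OF a(1)] by (simp_all add: C_def)
  have bnd: "cmod (\<phi> (adj a * x)) \<le> C * norm y" if "(x, y) \<in> G" for x y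
  proof -
    have "Re (\<phi> (adj x * x)) = (norm y)\<^sup>2"
      unfolding Gin[OF that that, symmetric] cinner_self by simp
    then have "(cmod (\<phi> (adj a * x)))\<^sup>2 \<le> (C * norm y)\<^sup>2"
      using phi_cauchy_schwarz[OF a(1) GA[OF that]] by (simp add: C(2) power_mult_distrib)
    then show ?thesis by (rule power2_le_imp_le) (simp add: C(1))
  qed
  \<comment> \<open>Several operators may share one vector y; \<open>bnd\<close> for the zero
    vector, applied to their difference, shows that the choice does not matter.\<close>
  define f where "f = (\<lambda>y. \<phi> (adj a * (SOME x. (x, y) \<in> G)))"
  have f: "f y = \<phi> (adj a * x)" if xy: "(x, y) \<in> G" for x y
  proof -
    define x' where "x' = (SOME x. (x, y) \<in> G)"
    have x': "(x', y) \<in> G" unfolding x'_def using xy by (rule someI)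
    have "(x' + cmul (-1) x, y + (-1) *\<^sub>C y) \<in> G" using x' xy Gadd Gsc by blast
    then have "\<phi> (adj a * (x' - x)) = 0"
      using bnd[of "x' - x" 0] by (simp add: scaleC_minus1 minus_cmul minus_bop_def)
    then show ?thesis using a(1) GA[OF x'] GA[OF xy]
      unfolding f_def x'_def[symmetric] by (simp add: right_diff_distrib phi_simps A_intros)
  qed
  have Yin: "y \<in> snd ` G \<Longrightarrow> \<exists>x. (x, y) \<in> G" for y by force
  have "\<exists>p. p \<in> closure (snd ` G) \<and> (\<forall>y\<in>snd ` G. cinner p y = f y) \<and> norm p \<le> C"
  proof (rule riesz_representation)
    show "0 \<in> snd ` G" using G0 by (rule image_eqI[rotated]) simp
    show "x + y \<in> snd ` G" if xy: "x \<in> snd ` G" "y \<in> snd ` G" for x y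
    proof -
      obtain u v where "(u, x) \<in> G" "(v, y) \<in> G" using Yin[OF xy(1)] Yin[OF xy(2)] by metis
      from Gadd[OF this] show ?thesis by (rule image_eqI[rotated]) simp
    qed
    show "c *\<^sub>C x \<in> snd ` G" if x: "x \<in> snd ` G" for c x
    proof -
      obtain u where "(u, x) \<in> G" using Yin[OF x] by metis
      from Gsc[OF this] show ?thesis by (rule image_eqI[rotated]) simp
    qed
    show "f (x + y) = f x + f y" if xy: "x \<in> snd ` G" "y \<in> snd ` G" for x y
    proof -
      obtain u v where uv: "(u, x) \<in> G" "(v, y) \<in> G" using Yin[OF xy(1)] Yin[OF xy(2)] by metis
      show ?thesis using f[OF Gadd[OF uv]] f[OF uv(1)] f[OF uv(2)] a(1) GA[OF uv(1)] GA[OF uv(2)]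
        by (simp add: distrib_left phi_simps A_intros)
    qed
    show "f (c *\<^sub>C x) = c * f x" if x: "x \<in> snd ` G" for c x
    proof -
      obtain u where u: "(u, x) \<in> G" using Yin[OF x] by metis
      show ?thesis using f[OF Gsc[OF u]] f[OF u] a(1) GA[OF u]
        by (simp add: cmul_simps phi_simps A_intros)
    qed
    show "cmod (f x) \<le> C * norm x" if x: "x \<in> snd ` G" for x
    proof -
      obtain u where "(u, x) \<in> G" using Yin[OF x] by metis
      then show ?thesis using f bnd by simp
    qed
  qed (rule C(1))
  then obtain p where p: "p \<in> closure (snd ` G)" "\<And>y. y \<in> snd ` G \<Longrightarrow> cinner p y = f y" "norm p \<le> C"
    by auto
  have orth: "cinner (e b) p = 0" if "b \<notin> fst ` G" for b
  proof -
    obtain s where s: "\<And>n. s n \<in> snd ` G" "s \<longlonglongrightarrow> p" using p(1) unfolding closure_sequential by auto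
    have "cinner (e b) (s n) = 0" for n using Yin[OF s(1), of n] Gorth[OF _ that] by auto
    then have "(\<lambda>n. 0) \<longlonglongrightarrow> cinner (e b) p"
      using tendsto_cinner[OF tendsto_const s(2), of "e b"] by simp
    then show ?thesis using LIMSEQ_unique tendsto_const by blast
  qed
  have ee: "cinner (e b) (e c) = (if b = c then 1 else 0)" for b c
    using e unfolding orthonormal_family_def by blast
  \<comment> \<open>The residual length that gives p + r \<open>e a\<close> the squared norm \<phi>
    (adj a * a); it is real because p is no longer than C.\<close>
  define r where "r = sqrt (C\<^sup>2 - (norm p)\<^sup>2)"
  have r: "r\<^sup>2 = C\<^sup>2 - (norm p)\<^sup>2"
    unfolding r_def using power_mono[OF p(3), of 2] by simp
  define v where "v = p + r *\<^sub>R e a"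
  have vy: "cinner v y = \<phi> (adj a * x)" if "(x, y) \<in> G" for x y
  proof -
    have "y \<in> snd ` G" using that by force
    then show ?thesis using p(2)[of y] f[OF that] Gorth[OF that a(2)] by (simp add: v_def cinner_simps)
  qed
  have yv: "cinner y v = \<phi> (adj x * a)" if "(x, y) \<in> G" for x y
    by (subst cinner_commute) (simp add: vy[OF that] phi_swap[OF GA[OF that] a(1)])
  have "cinner p (e a) = 0" by (subst cinner_commute) (simp add: orth[OF a(2)])
  then have "cinner v v = complex_of_real ((norm p)\<^sup>2 + r\<^sup>2)"
    by (simp add: v_def cinner_simps orth[OF a(2)] ee cinner_self[of p] power2_eq_square)
  also have "(norm p)\<^sup>2 + r\<^sup>2 = Re (\<phi> (adj a * a))" unfolding r C(2) by simp
  finally have vv: "cinner v v = \<phi> (adj a * a)"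
    using phi_self[OF a(1)] by simp
  define G' where "G' = {(x + cmul t a, y + t *\<^sub>C v) | x y t. (x, y) \<in> G}"
  have G'I: "(x + cmul t a, y + t *\<^sub>C v) \<in> G'" if "(x, y) \<in> G" for x y t
    using that unfolding G'_def by blast
  have sub: "G \<subseteq> G'"
  proof
    fix q assume "q \<in> G"
    then show "q \<in> G'" using G'I[of "fst q" "snd q" 0] by (simp add: cmul_simps)
  qed
  have aG': "a \<in> fst ` G'" using G'I[OF G0, of 1] by (force simp: cmul_simps)
  have "partial_gns e G'"
    unfolding partial_gns_def
  proof (intro conjI allI impI)
    show "(0, 0) \<in> G'" using sub G0 by blast
    show "fst ` G' \<subseteq> A" unfolding G'_def using GA a(1) by (auto simp: A_intros)
  next
    fix x y x' y' assume "(x, y) \<in> G'" "(x', y') \<in> G'"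
    then obtain x1 y1 t x2 y2 s where *: "(x1, y1) \<in> G" "(x2, y2) \<in> G"
      "x = x1 + cmul t a" "y = y1 + t *\<^sub>C v" "x' = x2 + cmul s a" "y' = y2 + s *\<^sub>C v"
      unfolding G'_def by blast
    show "(x + x', y + y') \<in> G'"
      using G'I[OF Gadd[OF *(1,2)], of "t + s"] unfolding *(3-6)
      by (simp add: cmul_simps scaleC_add_left algebra_simps)
    show "cinner y y' = \<phi> (adj x * x')"
      using *(1,2) a(1) GA[OF *(1)] GA[OF *(2)] unfolding *(3-6)
      by (simp add: cinner_simps adj_simps distrib_left distrib_right cmul_simps phi_simps A_intros
          vv vy[OF *(2)] yv[OF *(1)] Gin[OF *(1,2)])
  next
    fix c x y assume "(x, y) \<in> G'"
    then obtain x1 y1 t where *: "(x1, y1) \<in> G" "x = x1 + cmul t a" "y = y1 + t *\<^sub>C v"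
      unfolding G'_def by blast
    show "(cmul c x, c *\<^sub>C y) \<in> G'"
      using G'I[OF Gsc[OF *(1)], of c "c * t"] unfolding *(2,3)
      by (simp add: cmul_simps scaleC_add_right scaleC_scaleC)
  next
    fix x y b assume xy: "(x, y) \<in> G'" and b: "b \<notin> fst ` G'"
    then obtain x1 y1 t where *: "(x1, y1) \<in> G" "y = y1 + t *\<^sub>C v"
      unfolding G'_def by blast
    have "b \<notin> fst ` G" using b image_mono[OF sub, of fst] by auto
    moreover have "b \<noteq> a" using b aG' by auto
    ultimately show "cinner (e b) y = 0"
      unfolding *(2) v_def using Gorth[OF *(1)] orth by (simp add: cinner_simps ee)
  qed
  moreover have "G \<noteq> G'" using aG' a(2) by auto
  ultimately show ?thesis using sub by auto
qed

lemma gns_vectors: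
  fixes e :: "'h bop \<Rightarrow> 'k::chilbert_space"
  assumes e: "orthonormal_family e"
  obtains \<Lambda> :: "'h bop \<Rightarrow> 'k" where "\<And>a b. a \<in> A \<Longrightarrow> b \<in> A \<Longrightarrow> cinner (\<Lambda> a) (\<Lambda> b) = \<phi> (adj a * b)"
proof -
  have "\<exists>M\<in>Collect (partial_gns e). \<forall>X\<in>Collect (partial_gns e). M \<subseteq> X \<longrightarrow> X = M"
  proof (rule subset_Zorn_nonempty)
    have "partial_gns e {(0, 0)}"
      unfolding partial_gns_def by (auto simp: phi_0 A_intros cmul_simps)
    then show "Collect (partial_gns e) \<noteq> {}" by blast
  next
    fix \<C> assume ne: "\<C> \<noteq> {}" and ch: "subset.chain (Collect (partial_gns e)) \<C>"
    have G: "partial_gns e G" if "G \<in> \<C>" for G using ch that unfolding subset.chain_def by blast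
    have two: "\<exists>G\<in>\<C>. p \<in> G \<and> q \<in> G" if "p \<in> \<Union>\<C>" "q \<in> \<Union>\<C>" for p q
      using that ch unfolding subset.chain_def by blast
    have "partial_gns e (\<Union>\<C>)"
      unfolding partial_gns_def
    proof (intro conjI allI impI)
      show "(0, 0) \<in> \<Union>\<C>" using ne partial_gnsD(1)[OF G] by blast
      show "fst ` \<Union>\<C> \<subseteq> A" using partial_gnsD(2)[OF G] by auto
    next
      fix x y x' y' assume "(x, y) \<in> \<Union>\<C>" "(x', y') \<in> \<Union>\<C>"
      then obtain H where H: "H \<in> \<C>" "(x, y) \<in> H" "(x', y') \<in> H" using two by blast
      show "(x + x', y + y') \<in> \<Union>\<C>" using partial_gnsD(3)[OF G H(2,3)] H(1) by blast
      show "cinner y y' = \<phi> (adj x * x')" by (rule partial_gnsD(5)[OF G H(2,3)]) (rule H)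
    next
      fix c x y assume "(x, y) \<in> \<Union>\<C>"
      then obtain H where H: "H \<in> \<C>" "(x, y) \<in> H" by blast
      show "(cmul c x, c *\<^sub>C y) \<in> \<Union>\<C>" using partial_gnsD(4)[OF G[OF H(1)] H(2)] H(1) by blast
    next
      fix x y b assume "(x, y) \<in> \<Union>\<C>" and b: "b \<notin> fst ` \<Union>\<C>"
      then obtain H where H: "H \<in> \<C>" "(x, y) \<in> H" by blast
      have "b \<notin> fst ` H" using b H(1) by blast
      then show "cinner (e b) y = 0" by (rule partial_gnsD(6)[OF G[OF H(1)] H(2)])
    qed
    then show "\<Union>\<C> \<in> Collect (partial_gns e)" by blast
  qed
  then obtain G where G: "partial_gns e G" and max: "\<And>X. partial_gns e X \<Longrightarrow> G \<subseteq> X \<Longrightarrow> X = G"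
    by blast
  have dom: "\<exists>y. (a, y) \<in> G" if "a \<in> A" for a
  proof (rule ccontr)
    assume "\<not> ?thesis"
    then have "a \<notin> fst ` G" by force
    then show False using partial_gns_extend[OF e G that] max by blast
  qed
  define \<Lambda> where "\<Lambda> = (\<lambda>a. SOME y. (a, y) \<in> G)"
  have in_G: "(a, \<Lambda> a) \<in> G" if "a \<in> A" for a
    unfolding \<Lambda>_def using dom[OF that] by (rule someI_ex)
  have "cinner (\<Lambda> a) (\<Lambda> b) = \<phi> (adj a * b)" if "a \<in> A" "b \<in> A" for a b
    by (rule partial_gnsD(5)[OF G in_G[OF that(1)] in_G[OF that(2)]])
  then show ?thesis by (rule that)
qed

end

section \<open>The GNS representation\<close>

locale gns = pos_functional A \<phi> for A :: "'h::chilbert_space bop set" and \<phi> +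
  fixes \<Lambda> :: "'h bop \<Rightarrow> 'k::chilbert_space"
  assumes Lam: "a \<in> A \<Longrightarrow> b \<in> A \<Longrightarrow> cinner (\<Lambda> a) (\<Lambda> b) = \<phi> (adj a * b)"
begin

definition K :: "'k set" where "K = closure (\<Lambda> ` A)"

text \<open>Left multiplication by a, given by duality instead of by extension from a dense set.
  \<open>K_ext\<close> makes the vector unique, so most laws are verified against the vectors
  \<open>\<Lambda> b\<close> without a limit argument.\<close>

definition \<pi> :: "'h bop \<Rightarrow> 'k \<Rightarrow> 'k" where
  "\<pi> a y = (SOME p. p \<in> K \<and> (\<forall>b\<in>A. cinner p (\<Lambda> b) = cinner y (\<Lambda> (adj a * b))))"

lemma Lam_add: assumes "a \<in> A" "b \<in> A" shows "\<Lambda> (a + b) = \<Lambda> a + \<Lambda> b"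
proof -
  have "cinner (\<Lambda> (a + b) - (\<Lambda> a + \<Lambda> b)) (\<Lambda> (a + b) - (\<Lambda> a + \<Lambda> b)) = 0"
    using assms by (simp add: cinner_simps Lam A_intros adj_simps distrib_left distrib_right phi_simps)
  then show ?thesis by (simp add: cinner_eq_zero_iff)
qed

lemma Lam_cmul: assumes "a \<in> A" shows "\<Lambda> (cmul c a) = c *\<^sub>C \<Lambda> a"
proof -
  have "cinner (\<Lambda> (cmul c a) - c *\<^sub>C \<Lambda> a) (\<Lambda> (cmul c a) - c *\<^sub>C \<Lambda> a) = 0"
    using assms by (simp add: cinner_simps Lam A_intros adj_simps cmul_simps phi_simps)
  then show ?thesis by (simp add: cinner_eq_zero_iff)
qed

lemma Lam_0: "\<Lambda> 0 = 0"
  using Lam_cmul[of 0 0] by (simp add: A_intros cmul_simps)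

lemma Lam_diff: assumes "a \<in> A" "b \<in> A" shows "\<Lambda> (a - b) = \<Lambda> a - \<Lambda> b"
  using Lam_add[of a "cmul (-1) b"] Lam_cmul[of b "-1"] assms
  by (simp add: A_intros scaleC_minus1 minus_bop_def uminus_bop_def)

lemma norm_Lam: "a \<in> A \<Longrightarrow> (norm (\<Lambda> a))\<^sup>2 = Re (\<phi> (adj a * a))"
  using Lam[of a a] by (metis Re_complex_of_real cinner_self)

lemma norm_Lam_mult: assumes "a \<in> A" "b \<in> A" shows "norm (\<Lambda> (a * b)) \<le> norm a * norm (\<Lambda> b)"
proof (rule power2_le_imp_le)
  show "(norm (\<Lambda> (a * b)))\<^sup>2 \<le> (norm a * norm (\<Lambda> b))\<^sup>2"
    using phi_contract[OF assms] assms by (simp add: norm_Lam A_intros power_mult_distrib)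
qed simp

lemma Lam_K: "a \<in> A \<Longrightarrow> \<Lambda> a \<in> K"
  unfolding K_def by (rule subsetD[OF closure_subset imageI])

lemma K_seq:
  assumes "x \<in> K"
  shows "\<exists>s. (\<forall>n. s n \<in> A) \<and> (\<lambda>n. \<Lambda> (s n)) \<longlonglongrightarrow> x"
proof -
  obtain t where t: "\<And>n. t n \<in> \<Lambda> ` A" "t \<longlonglongrightarrow> x"
    using assms unfolding K_def closure_sequential by auto
  have "\<exists>b. b \<in> A \<and> t n = \<Lambda> b" for n using t(1)[of n] by auto
  then obtain s where s: "\<And>n. s n \<in> A" "\<And>n. t n = \<Lambda> (s n)" by metis
  have "t = (\<lambda>n. \<Lambda> (s n))" using s(2) by auto
  then show ?thesis using s(1) t(2) by auto
qed

lemma K_lim: "(\<And>n. s n \<in> K) \<Longrightarrow> s \<longlonglongrightarrow> x \<Longrightarrow> x \<in> K"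
  using closed_closure[of "\<Lambda> ` A"] unfolding K_def closed_sequential_limits by metis

lemma K_add: assumes "x \<in> K" "y \<in> K" shows "x + y \<in> K"
proof -
  obtain s where s: "\<And>n. s n \<in> A" "(\<lambda>n. \<Lambda> (s n)) \<longlonglongrightarrow> x" using K_seq[OF assms(1)] by auto
  obtain t where t: "\<And>n. t n \<in> A" "(\<lambda>n. \<Lambda> (t n)) \<longlonglongrightarrow> y" using K_seq[OF assms(2)] by auto
  have mem: "\<Lambda> (s n) + \<Lambda> (t n) \<in> K" for n using s(1)[of n] t(1)[of n] by (simp add: Lam_K A_intros flip: Lam_add)
  show ?thesis by (rule K_lim[OF mem tendsto_add[OF s(2) t(2)]])
qed

lemma K_scaleC: assumes "x \<in> K" shows "c *\<^sub>C x \<in> K"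
proof -
  obtain s where s: "\<And>n. s n \<in> A" "(\<lambda>n. \<Lambda> (s n)) \<longlonglongrightarrow> x" using K_seq[OF assms] by auto
  have mem: "c *\<^sub>C \<Lambda> (s n) \<in> K" for n using s(1)[of n] by (simp add: Lam_K A_intros flip: Lam_cmul)
  show ?thesis by (rule K_lim[OF mem tendsto_scaleC[OF s(2)]])
qed

lemma K_subspace: "closed_csubspace K"
  unfolding closed_csubspace_def
  using K_add K_scaleC Lam_K[of 0] A_intros(1) by (simp add: Lam_0) (simp add: K_def)

lemma K_ext:
  assumes "p \<in> K" "q \<in> K" "\<And>b. b \<in> A \<Longrightarrow> cinner p (\<Lambda> b) = cinner q (\<Lambda> b)"
  shows "p = q"
proof -
  have "p + (-1) *\<^sub>C q \<in> K" by (intro K_add K_scaleC assms)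
  then have "p - q \<in> K" by (simp add: scaleC_minus1)
  then obtain s where s: "\<And>n. s n \<in> A" "(\<lambda>n. \<Lambda> (s n)) \<longlonglongrightarrow> p - q" using K_seq by auto
  have "(\<lambda>n. cinner (p - q) (\<Lambda> (s n))) \<longlonglongrightarrow> cinner (p - q) (p - q)"
    by (intro tendsto_cinner s tendsto_const)
  moreover have "cinner (p - q) (\<Lambda> (s n)) = 0" for n using assms(3) s by (simp add: cinner_simps)
  ultimately have "cinner (p - q) (p - q) = 0" using LIMSEQ_unique[OF _ tendsto_const[of 0]] by simp
  then show ?thesis by (simp add: cinner_eq_zero_iff)
qed

lemma pi_exists:
  assumes a: "a \<in> A"
  shows "\<exists>p. p \<in> K \<and> (\<forall>b\<in>A. cinner p (\<Lambda> b) = cinner y (\<Lambda> (adj a * b))) \<and> norm p \<le> norm a * norm y"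
proof -
  define f where "f = (\<lambda>u. cinner y (\<Lambda> (adj a * (SOME b. b \<in> A \<and> \<Lambda> b = u))))"
  \<comment> \<open>The choice of b does not matter: if b' and b have the same vector,
    \<open>norm_Lam_mult\<close> for b' - b shows that so have their products with
    \<open>adj a\<close>.\<close>
  have f: "f (\<Lambda> b) = cinner y (\<Lambda> (adj a * b))" if b: "b \<in> A" for b
  proof -
    define b' where "b' = (SOME c. c \<in> A \<and> \<Lambda> c = \<Lambda> b)"
    have b': "b' \<in> A" "\<Lambda> b' = \<Lambda> b"
      using someI[of "\<lambda>c. c \<in> A \<and> \<Lambda> c = \<Lambda> b" b] b unfolding b'_def by auto
    have "norm (\<Lambda> (adj a * (b' - b))) \<le> norm (adj a) * norm (\<Lambda> (b' - b))"
      using a b b' by (intro norm_Lam_mult A_intros)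
    then have "\<Lambda> (adj a * b') = \<Lambda> (adj a * b)"
      using a b b' by (simp add: right_diff_distrib Lam_diff A_intros)
    then show ?thesis unfolding f_def b'_def[symmetric] by simp
  qed
  have "\<exists>p. p \<in> closure (\<Lambda> ` A) \<and> (\<forall>u\<in>\<Lambda> ` A. cinner p u = f u) \<and> norm p \<le> norm a * norm y"
  proof (rule riesz_representation)
    show "0 \<in> \<Lambda> ` A" by (rule image_eqI[of _ _ 0]) (simp_all add: Lam_0 A_intros)
    show "u + v \<in> \<Lambda> ` A" if "u \<in> \<Lambda> ` A" "v \<in> \<Lambda> ` A" for u v
      using that by (auto simp: A_intros simp flip: Lam_add)
    show "c *\<^sub>C u \<in> \<Lambda> ` A" if u: "u \<in> \<Lambda> ` A" for c u
      using u by (auto simp: A_intros simp flip: Lam_cmul)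
    show "f (u + v) = f u + f v" if uv: "u \<in> \<Lambda> ` A" "v \<in> \<Lambda> ` A" for u v
    proof -
      obtain b c where b: "b \<in> A" "u = \<Lambda> b" and c: "c \<in> A" "v = \<Lambda> c" using uv by blast
      then have "u + v = \<Lambda> (b + c)" by (simp add: Lam_add)
      then show ?thesis using a b c f[of "b + c"]
        by (simp add: f A_intros distrib_left Lam_add cinner_simps)
    qed
    show "f (c *\<^sub>C u) = c * f u" if u: "u \<in> \<Lambda> ` A" for c u
    proof -
      obtain b where b: "b \<in> A" "u = \<Lambda> b" using u by blast
      then have "c *\<^sub>C u = \<Lambda> (cmul c b)" by (simp add: Lam_cmul)
      then show ?thesis using a b f[of "cmul c b"]
        by (simp add: f A_intros cmul_simps Lam_cmul cinner_simps)
    qed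
    show "cmod (f u) \<le> norm a * norm y * norm u" if u: "u \<in> \<Lambda> ` A" for u
    proof -
      obtain b where b: "b \<in> A" "u = \<Lambda> b" using u by blast
      have "cmod (f u) \<le> norm y * norm (\<Lambda> (adj a * b))" unfolding b(2) f[OF b(1)] by (rule norm_cinner_le)
      also have "\<dots> \<le> norm y * (norm (adj a) * norm (\<Lambda> b))"
        using a b by (intro mult_left_mono norm_Lam_mult A_intros) auto
      finally show ?thesis using b by (simp add: norm_adj mult_ac)
    qed
  qed simp
  then show ?thesis using f unfolding K_def by auto
qed

lemma pi_props:
  assumes a: "a \<in> A"
  shows pi_K: "\<pi> a y \<in> K"
    and cinner_pi_Lam: "b \<in> A \<Longrightarrow> cinner (\<pi> a y) (\<Lambda> b) = cinner y (\<Lambda> (adj a * b))"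
proof -
  have "\<pi> a y \<in> K \<and> (\<forall>b\<in>A. cinner (\<pi> a y) (\<Lambda> b) = cinner y (\<Lambda> (adj a * b)))"
    unfolding \<pi>_def by (rule someI_ex) (use pi_exists[OF a, of y] in blast)
  then show "\<pi> a y \<in> K" "b \<in> A \<Longrightarrow> cinner (\<pi> a y) (\<Lambda> b) = cinner y (\<Lambda> (adj a * b))" by blast+
qed

lemma pi_eqI:
  assumes "a \<in> A" "p \<in> K" "\<And>b. b \<in> A \<Longrightarrow> cinner p (\<Lambda> b) = cinner y (\<Lambda> (adj a * b))"
  shows "\<pi> a y = p"
  using assms by (intro K_ext) (simp_all add: pi_K cinner_pi_Lam)

lemma norm_pi: "a \<in> A \<Longrightarrow> norm (\<pi> a y) \<le> norm a * norm y"
  using pi_exists[of a y] pi_eqI[of a _ y] by auto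

lemma pi_Lam: "a \<in> A \<Longrightarrow> b \<in> A \<Longrightarrow> \<pi> a (\<Lambda> b) = \<Lambda> (a * b)"
  by (rule pi_eqI) (simp_all add: Lam_K Lam A_intros adj_simps mult.assoc)

lemma pi_arg_add: "a \<in> A \<Longrightarrow> \<pi> a (x + y) = \<pi> a x + \<pi> a y"
  by (rule pi_eqI) (simp_all add: K_add pi_K cinner_simps cinner_pi_Lam)

lemma pi_arg_scaleC: "a \<in> A \<Longrightarrow> \<pi> a (c *\<^sub>C y) = c *\<^sub>C \<pi> a y"
  by (rule pi_eqI) (simp_all add: K_scaleC pi_K cinner_simps cinner_pi_Lam)

lemma pi_add: "a \<in> A \<Longrightarrow> b \<in> A \<Longrightarrow> \<pi> (a + b) y = \<pi> a y + \<pi> b y"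
  by (rule pi_eqI) (simp_all add: K_add pi_K cinner_simps cinner_pi_Lam A_intros adj_simps
      distrib_right Lam_add)

lemma pi_cmul: "a \<in> A \<Longrightarrow> \<pi> (cmul c a) y = c *\<^sub>C \<pi> a y"
  by (rule pi_eqI) (simp_all add: K_scaleC pi_K cinner_simps cinner_pi_Lam A_intros adj_simps
      cmul_simps Lam_cmul)

lemma pi_times: "a \<in> A \<Longrightarrow> b \<in> A \<Longrightarrow> \<pi> (a * b) y = \<pi> a (\<pi> b y)"
  by (rule pi_eqI) (simp_all add: pi_K cinner_pi_Lam A_intros adj_simps mult.assoc)

lemma bounded_op_pi: "a \<in> A \<Longrightarrow> bounded_op_on K (\<pi> a)"
  unfolding bounded_op_on_def using norm_pi
  by (auto simp: pi_K pi_arg_add pi_arg_scaleC mult.commute intro!: exI[of _ "norm a"])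

lemma pi_adj:
  assumes a: "a \<in> A" and y: "y \<in> K"
  shows "cinner (\<pi> a x) y = cinner x (\<pi> (adj a) y)"
proof -
  obtain s where s: "\<And>n. s n \<in> A" "(\<lambda>n. \<Lambda> (s n)) \<longlonglongrightarrow> y" using K_seq[OF y] by auto
  have aA: "adj a \<in> A" using a by (rule star)
  have "bounded_linear (\<pi> (adj a))"
    using norm_pi[OF aA] by (intro bounded_linear_intro[of _ "norm (adj a)"])
      (simp_all add: pi_arg_add[OF aA] pi_arg_scaleC[OF aA] scaleR_scaleC mult.commute)
  then have "(\<lambda>n. cinner x (\<pi> (adj a) (\<Lambda> (s n)))) \<longlonglongrightarrow> cinner x (\<pi> (adj a) y)"
    by (intro tendsto_cinner tendsto_const bounded_linear.tendsto[OF _ s(2)])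
  moreover have "(\<lambda>n. cinner (\<pi> a x) (\<Lambda> (s n))) \<longlonglongrightarrow> cinner (\<pi> a x) y"
    by (intro tendsto_cinner tendsto_const s(2))
  moreover have "cinner (\<pi> a x) (\<Lambda> (s n)) = cinner x (\<pi> (adj a) (\<Lambda> (s n)))" for n
    using a aA s(1) by (simp add: cinner_pi_Lam pi_Lam)
  ultimately show ?thesis using LIMSEQ_unique by simp
qed

lemma pi_eq_0:
  assumes j: "j \<in> A" and 0: "\<And>a. a \<in> A \<Longrightarrow> \<phi> (adj (adj j * a) * (adj j * a)) = 0"
  shows "\<pi> j y = 0"
proof (rule pi_eqI[OF j])
  show "0 \<in> K" using Lam_K[of 0] by (simp add: Lam_0 A_intros)
  fix b assume b: "b \<in> A"
  then have "(norm (\<Lambda> (adj j * b)))\<^sup>2 = 0" using 0[OF b] j by (simp add: norm_Lam A_intros)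
  then show "cinner 0 (\<Lambda> b) = cinner y (\<Lambda> (adj j * b))" by simp
qed

end

section \<open>Pure states\<close>

text \<open>States of \<open>A\<close> modulo \<open>J\<close> with units \<open>E\<close>. The
  value 1 at e0 stands in for normalisation at a unit and bounds the functional by the norm
  (\<open>states_norm_le\<close>). The value 0 off \<open>A\<close> makes a state determined by its
  restriction to \<open>A\<close>, as compactness among functions on the whole type
  requires.\<close>

definition states :: "'h::chilbert_space bop set \<Rightarrow> 'h bop set \<Rightarrow> 'h bop \<Rightarrow> 'h bop set \<Rightarrow> ('h bop \<Rightarrow> complex) set" where
  "states A J e0 E = {\<phi>.
     (\<forall>a\<in>- A. \<phi> a = 0) \<and>
     (\<forall>a\<in>A. \<forall>b\<in>A. \<phi> (a + b) = \<phi> a + \<phi> b) \<and>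
     (\<forall>c. \<forall>a\<in>A. \<phi> (cmul c a) = c * \<phi> a) \<and>
     (\<forall>a\<in>A. \<phi> (adj a) = cnj (\<phi> a)) \<and>
     (\<forall>a\<in>A. 0 \<le> Re (\<phi> (adj a * a))) \<and>
     (\<forall>j\<in>J. \<phi> j = 0) \<and>
     (\<forall>e\<in>E. \<forall>a\<in>A. \<phi> (e * a) = \<phi> a \<and> \<phi> (a * e) = \<phi> a) \<and>
     \<phi> e0 = 1}"

definition extreme_in :: "('a \<Rightarrow> complex) set \<Rightarrow> ('a \<Rightarrow> complex) \<Rightarrow> bool" where
  "extreme_in F \<phi> \<longleftrightarrow> \<phi> \<in> F \<and>
     (\<forall>\<phi>1\<in>F. \<forall>\<phi>2\<in>F. (\<forall>a. \<phi> a = (\<phi>1 a + \<phi>2 a) / 2) \<longrightarrow> \<phi>1 = \<phi>)"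

lemma (in cstar) states_pos_functional:
  assumes "\<phi> \<in> states A J e0 E"
  shows "pos_functional A \<phi>"
  using assms unfolding states_def by unfold_locales simp_all

lemma statesD:
  assumes "\<phi> \<in> states A J e0 E"
  shows "a \<notin> A \<Longrightarrow> \<phi> a = 0" "j \<in> J \<Longrightarrow> \<phi> j = 0" "e \<in> E \<Longrightarrow> a \<in> A \<Longrightarrow> \<phi> (e * a) = \<phi> a"
    "e \<in> E \<Longrightarrow> a \<in> A \<Longrightarrow> \<phi> (a * e) = \<phi> a" "\<phi> e0 = 1"
  using assms unfolding states_def by simp_all

text \<open>Extremality is relative to the states that kill \<open>J\<close> and have
  \<open>E\<close> as units; \<open>dominated_functional\<close> shows that the perturbations of
  \<phi> coming from the commutant stay among them.\<close>

locale irrep = gns A \<phi> \<Lambda>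
  for A :: "'h::chilbert_space bop set" and \<phi> and \<Lambda> :: "'h bop \<Rightarrow> 'k::chilbert_space" +
  fixes I J :: "'h bop set" and e0 :: "'h bop" and E :: "'h bop set"
  assumes extreme: "extreme_in (states A J e0 E) \<phi>"
    and I: "I \<subseteq> A" "\<And>a i. a \<in> A \<Longrightarrow> i \<in> I \<Longrightarrow> a * i \<in> I"
    and J: "J \<subseteq> A" "\<And>a j. a \<in> A \<Longrightarrow> j \<in> J \<Longrightarrow> a * j \<in> J" "\<And>a j. a \<in> A \<Longrightarrow> j \<in> J \<Longrightarrow> j * a \<in> J"
    and E: "E \<subseteq> I" "\<And>e. e \<in> E \<Longrightarrow> adj e = e" and e0: "e0 \<in> E"
begin

lemma phi_state: "\<phi> \<in> states A J e0 E"
  using extreme unfolding extreme_in_def by blast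

lemma EA: "e \<in> E \<Longrightarrow> e \<in> A" and JA: "j \<in> J \<Longrightarrow> j \<in> A" and IA: "i \<in> I \<Longrightarrow> i \<in> A"
  using E I J by blast+

lemmas phi_J = statesD(2)[OF phi_state] and phi_e = statesD(3,4)[OF phi_state]
  and phi_e0 = statesD(5)[OF phi_state]

lemma Lam_e_right: "e \<in> E \<Longrightarrow> a \<in> A \<Longrightarrow> \<Lambda> (a * e) = \<Lambda> a"
  by (rule K_ext) (simp_all add: Lam_K Lam A_intros EA adj_simps E mult.assoc phi_e)

lemma Lam_e: "e \<in> E \<Longrightarrow> \<Lambda> e = \<Lambda> e0"
  by (rule K_ext) (simp_all add: Lam_K Lam A_intros EA E phi_e e0)

lemma norm_Lam_e0: "norm (\<Lambda> e0) = 1"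
proof -
  have "(norm (\<Lambda> e0))\<^sup>2 = 1"
    using norm_Lam[OF EA[OF e0]] phi_e(1)[OF e0 EA[OF e0]] phi_e0 by (simp only: E(2)[OF e0]) simp
  then show ?thesis by (intro power2_eq_imp_eq[of _ 1]) simp_all
qed

lemma norm_Lam_le: "a \<in> A \<Longrightarrow> norm (\<Lambda> a) \<le> norm a"
  using norm_Lam_mult[OF _ EA[OF e0], of a] by (simp add: Lam_e_right e0 norm_Lam_e0)

lemma pi_cyclic: "a \<in> A \<Longrightarrow> \<pi> a (\<Lambda> e0) = \<Lambda> a"
  by (simp add: pi_Lam EA e0 Lam_e_right)

lemma pi_e_cyclic: "e \<in> E \<Longrightarrow> \<pi> e (\<Lambda> e0) = \<Lambda> e0"
  by (simp add: pi_cyclic EA Lam_e)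

lemma pi_J: assumes j: "j \<in> J" shows "\<pi> j y = 0"
proof (rule pi_eq_0[OF JA[OF j]])
  fix a assume a: "a \<in> A"
  have "adj a * (j * (adj j * a)) \<in> J" using a j by (intro J(2,3)) (simp_all add: A_intros JA)
  then show "\<phi> (adj (adj j * a) * (adj j * a)) = 0" by (simp add: adj_simps mult.assoc phi_J)
qed

text \<open>The hermitian functional on the left, made 0 at e0 by subtracting a multiple of \<phi>,
  can be scaled so that adding it to \<phi> and subtracting it both give states. Their midpoint is
  \<phi>, so it is 0 on \<open>A\<close>.\<close>

lemma dominated_functional:
  assumes add: "\<And>a b. a \<in> A \<Longrightarrow> b \<in> A \<Longrightarrow> f (a + b) = f a + f b"
    and cml: "\<And>c a. a \<in> A \<Longrightarrow> f (cmul c a) = c * f a"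
    and fe: "\<And>e a. e \<in> E \<Longrightarrow> a \<in> A \<Longrightarrow> f (e * a) = f a" "\<And>e a. e \<in> E \<Longrightarrow> a \<in> A \<Longrightarrow> f (a * e) = f a"
    and fJ: "\<And>j. j \<in> J \<Longrightarrow> f j = 0" "\<And>j. j \<in> J \<Longrightarrow> f (adj j) = 0"
    and dom: "\<And>a. a \<in> A \<Longrightarrow> cmod (f (adj a * a)) \<le> M * Re (\<phi> (adj a * a))"
  shows "\<exists>r::complex. \<forall>a\<in>A. f a + cnj (f (adj a)) = r * \<phi> a"
proof -
  define \<psi> where "\<psi> = (\<lambda>a. f a + cnj (f (adj a)))"
  define r where "r = Re (\<psi> e0)"
  have \<psi>0: "\<psi> e0 = complex_of_real r"
  proof -
    have "Im (\<psi> e0) = 0" unfolding \<psi>_def E(2)[OF e0] by simp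
    then show ?thesis by (intro complex_eqI) (simp_all add: r_def)
  qed
  define \<theta> where "\<theta> = (\<lambda>a. \<psi> a - complex_of_real r * \<phi> a)"
  have \<theta>_add: "\<theta> (a + b) = \<theta> a + \<theta> b" if "a \<in> A" "b \<in> A" for a b
    using that by (simp add: \<theta>_def \<psi>_def add adj_simps A_intros phi_simps algebra_simps)
  have \<theta>_cml: "\<theta> (cmul c a) = c * \<theta> a" if "a \<in> A" for a c
    using that by (simp add: \<theta>_def \<psi>_def cml adj_simps A_intros phi_simps algebra_simps)
  have \<theta>_adj: "\<theta> (adj a) = cnj (\<theta> a)" if "a \<in> A" for a
    using that by (simp add: \<theta>_def \<psi>_def phi_adj)
  have \<theta>_J: "\<theta> j = 0" if "j \<in> J" for j using that by (simp add: \<theta>_def \<psi>_def fJ phi_J)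
  have \<theta>_e: "\<theta> (e * a) = \<theta> a" "\<theta> (a * e) = \<theta> a" if "e \<in> E" "a \<in> A" for e a
    using that by (simp_all add: \<theta>_def \<psi>_def fe phi_e adj_simps E A_intros)
  have \<theta>_e0: "\<theta> e0 = 0" by (simp add: \<theta>_def \<psi>0 phi_e0)
  \<comment> \<open>2 |M| bounds the two summands of \<psi>, |r| the multiple of \<phi>, and 1 keeps
    B positive.\<close>
  define B where "B = 2 * \<bar>M\<bar> + \<bar>r\<bar> + 1"
  have B: "B > 0" by (simp add: B_def)
  have bnd: "\<bar>Re (\<theta> (adj a * a))\<bar> \<le> B * Re (\<phi> (adj a * a))" if a: "a \<in> A" for a
  proof -
    let ?p = "Re (\<phi> (adj a * a))"
    have p: "0 \<le> ?p" using a by (rule phi_pos)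
    have "\<bar>Re (\<psi> (adj a * a))\<bar> \<le> 2 * cmod (f (adj a * a))"
      unfolding \<psi>_def using abs_Re_le_cmod[of "f (adj a * a)"] by (simp add: adj_simps)
    also have "\<dots> \<le> 2 * (\<bar>M\<bar> * ?p)" using dom[OF a] mult_right_mono[OF abs_ge_self p, of M] by linarith
    finally have "\<bar>Re (\<psi> (adj a * a))\<bar> \<le> 2 * (\<bar>M\<bar> * ?p)" .
    moreover have "\<bar>Re (complex_of_real r * \<phi> (adj a * a))\<bar> = \<bar>r\<bar> * ?p" using p by (simp add: abs_mult)
    ultimately have "\<bar>Re (\<theta> (adj a * a))\<bar> \<le> 2 * (\<bar>M\<bar> * ?p) + \<bar>r\<bar> * ?p"
      unfolding \<theta>_def minus_complex.sel by linarith
    also have "\<dots> \<le> B * ?p" using p by (simp add: B_def algebra_simps)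
    finally show ?thesis .
  qed
  define \<phi>' where "\<phi>' = (\<lambda>s a. if a \<in> A then \<phi> a + complex_of_real (s / B) * \<theta> a else 0)"
  have st: "\<phi>' s \<in> states A J e0 E" if s: "\<bar>s\<bar> = 1" for s
  proof -
    have abs_add: "0 \<le> y + t" if "\<bar>t\<bar> \<le> y" for t y :: real using that by linarith
    have pos: "0 \<le> Re (\<phi> (adj a * a)) + s / B * Re (\<theta> (adj a * a))" if a: "a \<in> A" for a
    proof -
      have "\<bar>s / B * Re (\<theta> (adj a * a))\<bar> = \<bar>Re (\<theta> (adj a * a))\<bar> / B"
        using B s by (simp add: abs_mult)
      also have "\<dots> \<le> Re (\<phi> (adj a * a))" using bnd[OF a] B by (simp add: field_simps)
      finally show ?thesis by (rule abs_add)
    qed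
    show ?thesis
      unfolding states_def mem_Collect_eq
    proof (intro conjI ballI allI)
      fix a b c e j
      show "a \<in> - A \<Longrightarrow> \<phi>' s a = 0" by (simp add: \<phi>'_def)
      show "a \<in> A \<Longrightarrow> b \<in> A \<Longrightarrow> \<phi>' s (a + b) = \<phi>' s a + \<phi>' s b"
        by (simp add: \<phi>'_def A_intros phi_simps \<theta>_add algebra_simps add_divide_distrib)
      show "a \<in> A \<Longrightarrow> \<phi>' s (cmul c a) = c * \<phi>' s a"
        by (simp add: \<phi>'_def A_intros phi_simps \<theta>_cml algebra_simps)
      show "a \<in> A \<Longrightarrow> \<phi>' s (adj a) = cnj (\<phi>' s a)"
        by (simp add: \<phi>'_def A_intros phi_adj \<theta>_adj)
      show "a \<in> A \<Longrightarrow> 0 \<le> Re (\<phi>' s (adj a * a))"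
        using pos[of a] by (simp add: \<phi>'_def A_intros)
      show "j \<in> J \<Longrightarrow> \<phi>' s j = 0" by (simp add: \<phi>'_def phi_J \<theta>_J)
      show "e \<in> E \<Longrightarrow> a \<in> A \<Longrightarrow> \<phi>' s (e * a) = \<phi>' s a" "e \<in> E \<Longrightarrow> a \<in> A \<Longrightarrow> \<phi>' s (a * e) = \<phi>' s a"
        by (simp_all add: \<phi>'_def A_intros EA phi_e \<theta>_e)
      show "\<phi>' s e0 = 1" by (simp add: \<phi>'_def EA e0 phi_e0 \<theta>_e0)
    qed
  qed
  have "\<phi> a = (\<phi>' 1 a + \<phi>' (-1) a) / 2" for a
    using statesD(1)[OF phi_state, of a] by (simp add: \<phi>'_def)
  then have eq: "\<phi>' 1 = \<phi>"
    using extreme st[of 1] st[of "-1"] unfolding extreme_in_def by auto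
  have "\<theta> a = 0" if "a \<in> A" for a
  proof -
    have "\<phi>' 1 a = \<phi> a + complex_of_real (1 / B) * \<theta> a" using that by (simp add: \<phi>'_def)
    then show ?thesis unfolding eq using B by simp
  qed
  then show ?thesis unfolding \<theta>_def \<psi>_def by (intro exI[of _ "complex_of_real r"]) auto
qed

text \<open>The functional f sending a to the inner product of \<xi> with \<pi> a (T \<xi>) is
  dominated by \<phi>. \<open>dominated_functional\<close> for f and for i f exhibits f as a
  multiple of \<phi>, so T is a scalar on the dense set of vectors
  \<open>\<Lambda> a\<close>.\<close>

lemma commutant:
  assumes T: "bounded_op_on K T" and comm: "\<And>a x. a \<in> I \<Longrightarrow> x \<in> K \<Longrightarrow> T (\<pi> a x) = \<pi> a (T x)"
  shows "\<exists>c. \<forall>x\<in>K. T x = c *\<^sub>C x"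
proof -
  have TK: "T x \<in> K" and Tadd: "y \<in> K \<Longrightarrow> T (x + y) = T x + T y" and Tsc: "T (c *\<^sub>C x) = c *\<^sub>C T x"
    if "x \<in> K" for x y c
    using T that unfolding bounded_op_on_def by simp_all
  have "\<exists>M. \<forall>x\<in>K. norm (T x) \<le> norm x * M" using T unfolding bounded_op_on_def by simp
  then obtain M0 where M0: "\<And>x. x \<in> K \<Longrightarrow> norm (T x) \<le> norm x * M0" by metis
  define \<xi> where "\<xi> = \<Lambda> e0"
  define \<eta> where "\<eta> = T \<xi>"
  have \<xi>K: "\<xi> \<in> K" unfolding \<xi>_def by (intro Lam_K EA e0)
  have \<eta>K: "\<eta> \<in> K" unfolding \<eta>_def by (rule TK[OF \<xi>K])
  have e\<eta>: "\<pi> e \<eta> = \<eta>" if "e \<in> E" for e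
  proof -
    have "e \<in> I" using that E by auto
    then show ?thesis using comm[of e \<xi>] \<xi>K that by (simp add: \<eta>_def \<xi>_def pi_e_cyclic)
  qed
  have TL: "T (\<Lambda> a) = \<pi> a \<eta>" if a: "a \<in> A" for a
  proof -
    \<comment> \<open>T commutes with the image of \<open>I\<close> only; a * e0 belongs to
      \<open>I\<close> and has the same vector as a.\<close>
    have "a * e0 \<in> I" using a E e0 I by auto
    then have "T (\<pi> (a * e0) \<xi>) = \<pi> (a * e0) \<eta>" using comm \<xi>K by (simp add: \<eta>_def)
    then show ?thesis
      using a by (simp add: \<xi>_def pi_cyclic A_intros EA e0 Lam_e_right pi_times e\<eta>)
  qed
  define f where "f = (\<lambda>a. cinner \<xi> (\<pi> a \<eta>))"
  have fba: "f (adj b * a) = cinner (\<Lambda> b) (T (\<Lambda> a))" if "a \<in> A" "b \<in> A" for a b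
  proof -
    have "f (adj b * a) = cinner \<xi> (\<pi> (adj b) (\<pi> a \<eta>))"
      using that by (simp add: f_def pi_times A_intros)
    also have "\<dots> = cinner (\<pi> b \<xi>) (\<pi> a \<eta>)"
      using pi_adj[OF that(2) pi_K[OF that(1)]] by simp
    finally show ?thesis using that by (simp add: \<xi>_def pi_cyclic TL)
  qed
  have add: "f (a + b) = f a + f b" if "a \<in> A" "b \<in> A" for a b
    using that by (simp add: f_def pi_add cinner_simps)
  have cml: "f (cmul c a) = c * f a" if "a \<in> A" for c a
    using that by (simp add: f_def pi_cmul cinner_simps)
  have fe: "f (e * a) = f a" "f (a * e) = f a" if "e \<in> E" "a \<in> A" for e a
  proof -
    have "f (e * a) = cinner (\<pi> e \<xi>) (\<pi> a \<eta>)"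
      using that pi_adj[OF EA[OF that(1)] pi_K[OF that(2)]] by (simp add: f_def pi_times EA E)
    then show "f (e * a) = f a" using that by (simp add: \<xi>_def pi_e_cyclic f_def)
    show "f (a * e) = f a" using that by (simp add: f_def pi_times EA e\<eta>)
  qed
  have fJ: "f j = 0" "f (adj j) = 0" if "j \<in> J" for j
    using pi_adj[OF JA[OF that] \<eta>K, of \<xi>] that by (simp_all add: f_def pi_J)
  have dom: "cmod (f (adj a * a)) \<le> M0 * Re (\<phi> (adj a * a))" if a: "a \<in> A" for a
  proof -
    have "cmod (f (adj a * a)) \<le> norm (\<Lambda> a) * norm (T (\<Lambda> a))"
      unfolding fba[OF a a] by (rule norm_cinner_le)
    also have "\<dots> \<le> norm (\<Lambda> a) * (norm (\<Lambda> a) * M0)"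
      by (intro mult_left_mono M0 Lam_K a) simp
    also have "\<dots> = M0 * Re (\<phi> (adj a * a))"
      by (simp add: norm_Lam[OF a, symmetric] power2_eq_square)
    finally show ?thesis .
  qed
  obtain r where r: "\<And>a. a \<in> A \<Longrightarrow> f a + cnj (f (adj a)) = r * \<phi> a"
    using dominated_functional[of f M0, OF add cml fe fJ dom] by auto
  have "\<exists>s::complex. \<forall>a\<in>A. \<i> * f a + cnj (\<i> * f (adj a)) = s * \<phi> a"
    by (rule dominated_functional[of "\<lambda>a. \<i> * f a" M0])
       (simp_all add: add cml fe fJ dom norm_mult algebra_simps)
  then obtain s where s: "\<And>a. a \<in> A \<Longrightarrow> \<i> * f a + cnj (\<i> * f (adj a)) = s * \<phi> a" by auto
  define c where "c = (r - \<i> * s) / 2"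
  have fc: "f a = c * \<phi> a" if "a \<in> A" for a
  proof -
    have "f a - cnj (f (adj a)) = - \<i> * (s * \<phi> a)"
      unfolding s[OF that, symmetric] by (simp add: algebra_simps)
    moreover have "2 * f a = (f a + cnj (f (adj a))) + (f a - cnj (f (adj a)))" by simp
    ultimately have "2 * f a = r * \<phi> a - \<i> * (s * \<phi> a)"
      unfolding r[OF that] by simp
    then show ?thesis unfolding c_def by (simp add: algebra_simps)
  qed
  have TLc: "T (\<Lambda> a) = c *\<^sub>C \<Lambda> a" if a: "a \<in> A" for a
  proof (rule K_ext)
    show "T (\<Lambda> a) \<in> K" "c *\<^sub>C \<Lambda> a \<in> K" using a by (auto intro: TK Lam_K K_scaleC)
    fix b assume b: "b \<in> A"
    have "cinner (\<Lambda> b) (T (\<Lambda> a)) = cinner (\<Lambda> b) (c *\<^sub>C \<Lambda> a)"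
      using fba[OF a b] fc[of "adj b * a"] a b by (simp add: A_intros cinner_simps Lam)
    then show "cinner (T (\<Lambda> a)) (\<Lambda> b) = cinner (c *\<^sub>C \<Lambda> a) (\<Lambda> b)"
      by (subst (1 2) cinner_commute) simp
  qed
  have "T x = c *\<^sub>C x" if x: "x \<in> K" for x
  proof -
    obtain s where s: "\<And>n. s n \<in> A" "(\<lambda>n. \<Lambda> (s n)) \<longlonglongrightarrow> x" using K_seq[OF x] by auto
    have le: "norm (T (\<Lambda> (s n)) - T x) \<le> norm (\<Lambda> (s n) - x) * M0" for n
    proof -
      have mx: "(-1) *\<^sub>C x \<in> K" using x by (rule K_scaleC)
      have "T (\<Lambda> (s n) + (-1) *\<^sub>C x) = T (\<Lambda> (s n)) + (-1) *\<^sub>C T x"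
        using Tadd[OF Lam_K[OF s(1)] mx] Tsc[OF x] by simp
      then show ?thesis
        using M0[OF K_add[OF Lam_K[OF s(1)[of n]] mx]] by (simp add: scaleC_minus1)
    qed
    have "(\<lambda>n. norm (\<Lambda> (s n) - x) * M0) \<longlonglongrightarrow> 0"
      using tendsto_mult_left_zero[OF tendsto_norm_zero[OF LIM_zero[OF s(2)]]] by simp
    then have "(\<lambda>n. T (\<Lambda> (s n)) - T x) \<longlonglongrightarrow> 0"
      by (rule Lim_null_comparison[rotated]) (simp add: le)
    then have "(\<lambda>n. T (\<Lambda> (s n))) \<longlonglongrightarrow> T x" by (rule LIM_zero_cancel)
    moreover have "(\<lambda>n. T (\<Lambda> (s n))) \<longlonglongrightarrow> c *\<^sub>C x"
      using tendsto_scaleC[OF s(2), of c] by (simp add: TLc s(1))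
    ultimately show ?thesis by (rule LIMSEQ_unique)
  qed
  then show ?thesis by blast
qed

text \<open>Orthogonal vectors of squared norm at least 1/2 have distance at least 1, so no
  subsequence of them converges.\<close>

lemma pi_e0_not_compact:
  fixes z :: "nat \<Rightarrow> 'h bop"
  assumes zA: "\<And>n. z n \<in> A" and z1: "\<And>n. norm (z n) \<le> 1" and ez: "\<And>n. e0 * z n = z n"
    and big: "\<And>n. 1 / 2 \<le> Re (\<phi> (adj (z n) * z n))"
    and orth: "\<And>m n. m < n \<Longrightarrow> adj (z m) * z n = 0"
  shows "\<not> compact (closure (\<pi> e0 ` {x \<in> K. norm x \<le> 1}))"
proof
  let ?C = "closure (\<pi> e0 ` {x \<in> K. norm x \<le> 1})"
  assume cpt: "compact ?C"
  have "\<Lambda> (z n) \<in> ?C" for n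
  proof (rule subsetD[OF closure_subset], rule image_eqI)
    show "\<Lambda> (z n) = \<pi> e0 (\<Lambda> (z n))" by (simp add: pi_Lam EA e0 zA ez)
    show "\<Lambda> (z n) \<in> {x \<in> K. norm x \<le> 1}"
      using norm_Lam_le[OF zA, of n] z1[of n] Lam_K[OF zA, of n] by auto
  qed
  then obtain l r where r: "strict_mono (r :: nat \<Rightarrow> nat)" "((\<lambda>n. \<Lambda> (z n)) \<circ> r) \<longlonglongrightarrow> l"
    using cpt unfolding compact_def by (metis (no_types, lifting))
  have dist: "1 \<le> (norm (\<Lambda> (z n) - \<Lambda> (z m)))\<^sup>2" if "m < n" for m n
  proof -
    have "cinner (\<Lambda> (z n)) (\<Lambda> (z m)) = cnj (cinner (\<Lambda> (z m)) (\<Lambda> (z n)))" by (rule cinner_commute)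
    then have "cinner (\<Lambda> (z n)) (\<Lambda> (z m)) = 0"
      by (simp add: Lam zA orth[OF that] phi_0)
    then show ?thesis
      using big[of n] big[of m] unfolding norm_sq_diff by (simp add: norm_Lam[OF zA])
  qed
  have "Cauchy ((\<lambda>n. \<Lambda> (z n)) \<circ> r)" using r(2) by (rule LIMSEQ_imp_Cauchy)
  then obtain N where N: "\<And>m n. m \<ge> N \<Longrightarrow> n \<ge> N \<Longrightarrow> norm (\<Lambda> (z (r m)) - \<Lambda> (z (r n))) < 1"
    unfolding Cauchy_iff by (metis comp_apply zero_less_one)
  have "r N < r (Suc N)" using r(1) by (simp add: strict_mono_Suc_iff)
  then have "1 \<le> (norm (\<Lambda> (z (r (Suc N))) - \<Lambda> (z (r N))))\<^sup>2" by (rule dist)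
  moreover have "(norm (\<Lambda> (z (r (Suc N))) - \<Lambda> (z (r N))))\<^sup>2 < 1"
    using N[of "Suc N" N] by (simp add: power_less_one_iff)
  ultimately show False by simp
qed

end

section \<open>Existence of pure states\<close>

text \<open>The Krein-Milman argument: a minimal closed face is a single point, because the points
  at which a coordinate is maximal over a face form a closed face again.\<close>

lemma extreme_exists:
  fixes F :: "('x \<Rightarrow> complex) set"
  assumes F: "compact F" "F \<noteq> {}" and clF: "closed F"
  shows "\<exists>\<phi>. extreme_in F \<phi>"
proof -
  have cont: "continuous_on S (\<lambda>\<phi>::'x \<Rightarrow> complex. \<phi> a)" for S a
    by (rule continuous_on_subset[OF continuous_on_product_coordinates]) simp
  define face where "face = (\<lambda>G. G \<subseteq> F \<and> closed G \<and> G \<noteq> {} \<and>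
    (\<forall>\<phi>1\<in>F. \<forall>\<phi>2\<in>F. (\<lambda>a. (\<phi>1 a + \<phi>2 a) / 2) \<in> G \<longrightarrow> \<phi>1 \<in> G \<and> \<phi>2 \<in> G))"
  have faceD: "G \<subseteq> F" "closed G" "G \<noteq> {}"
    "\<And>\<phi>1 \<phi>2. \<phi>1 \<in> F \<Longrightarrow> \<phi>2 \<in> F \<Longrightarrow> (\<lambda>a. (\<phi>1 a + \<phi>2 a) / 2) \<in> G \<Longrightarrow> \<phi>1 \<in> G \<and> \<phi>2 \<in> G"
    if "face G" for G using that unfolding face_def by simp_all
  have Fface: "face F" using F(2) clF unfolding face_def by simp
  \<comment> \<open>Faces enter through their complements, so that a maximal set from Zorn's lemma
    yields a minimal face.\<close>
  have "\<exists>M\<in>{U. face (- U)}. \<forall>X\<in>{U. face (- U)}. M \<subseteq> X \<longrightarrow> X = M"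
  proof (rule subset_Zorn_nonempty)
    show "{U. face (- U)} \<noteq> {}" using Fface by (auto intro: exI[of _ "- F"])
  next
    fix \<C> assume ne: "\<C> \<noteq> {}" and ch: "subset.chain {U. face (- U)} \<C>"
    have fc: "face (- U)" if "U \<in> \<C>" for U using ch that unfolding subset.chain_def by auto
    have lin: "U \<subseteq> V \<or> V \<subseteq> U" if "U \<in> \<C>" "V \<in> \<C>" for U V
      using ch that unfolding subset.chain_def by auto
    have "F \<inter> \<Inter> (uminus ` \<C>) \<noteq> {}"
    proof (rule compact_imp_fip[OF F(1)])
      show "closed T" if "T \<in> uminus ` \<C>" for T using that faceD(2)[OF fc] by auto
      fix \<F> assume fin: "finite \<F>" "\<F> \<subseteq> uminus ` \<C>"
      show "F \<inter> \<Inter> \<F> \<noteq> {}"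
      proof (cases "\<F> = {}")
        case False
        have "\<exists>G\<in>\<F>. \<forall>H\<in>\<F>. G \<subseteq> H"
          using fin(1) False fin(2)
        proof (induction rule: finite_ne_induct)
          case (insert X \<G>)
          then obtain G where G: "G \<in> \<G>" "\<forall>H\<in>\<G>. G \<subseteq> H" by auto
          obtain U V where UV: "U \<in> \<C>" "X = - U" "V \<in> \<C>" "G = - V"
            using insert.prems G(1) by auto
          have "X \<subseteq> G \<or> G \<subseteq> X" using lin[OF UV(1,3)] UV(2,4) by auto
          then show ?case
          proof
            assume "X \<subseteq> G"
            then have "\<forall>H\<in>insert X \<G>. X \<subseteq> H" using G(2) by auto
            then show ?thesis by (rule bexI) simp
          next
            assume "G \<subseteq> X"
            then have "\<forall>H\<in>insert X \<G>. G \<subseteq> H" using G(2) by auto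
            then show ?thesis by (rule bexI) (simp add: G(1))
          qed
        qed simp
        then obtain G where G: "G \<in> \<F>" "\<And>H. H \<in> \<F> \<Longrightarrow> G \<subseteq> H" by blast
        have "face G" using G(1) fin(2) fc by auto
        then have "G \<noteq> {}" "G \<subseteq> F" using faceD(1,3) by auto
        then show ?thesis using G(2) by blast
      qed (use F in simp)
    qed
    then have nonempty: "- \<Union>\<C> \<noteq> {}" by auto
    obtain U0 where U0: "U0 \<in> \<C>" using ne by auto
    have "face (- \<Union>\<C>)"
      unfolding face_def
    proof (intro conjI ballI impI nonempty)
      show "- \<Union>\<C> \<subseteq> F" using faceD(1)[OF fc[OF U0]] U0 by auto
      have "closed (\<Inter> (uminus ` \<C>))" using faceD(2)[OF fc] by (intro closed_Inter) auto
      moreover have "\<Inter> (uminus ` \<C>) = - \<Union>\<C>" by auto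
      ultimately show "closed (- \<Union>\<C>)" by simp
      fix \<phi>1 \<phi>2 assume *: "\<phi>1 \<in> F" "\<phi>2 \<in> F" "(\<lambda>a. (\<phi>1 a + \<phi>2 a) / 2) \<in> - \<Union>\<C>"
      have "\<phi>1 \<in> - U \<and> \<phi>2 \<in> - U" if "U \<in> \<C>" for U
        using *(3) that by (intro faceD(4)[OF fc[OF that] *(1,2)]) auto
      then show "\<phi>1 \<in> - \<Union>\<C>" "\<phi>2 \<in> - \<Union>\<C>" by auto
    qed
    then show "\<Union>\<C> \<in> {U. face (- U)}" by simp
  qed
  then obtain U where U: "face (- U)" and max: "\<And>X. face (- X) \<Longrightarrow> U \<subseteq> X \<Longrightarrow> X = U" by auto
  define G where "G = - U"
  have G: "face G" using U by (simp add: G_def)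
  have min: "H = G" if "face H" "H \<subseteq> G" for H
    using max[of "- H"] that by (auto simp: G_def)
  \<comment> \<open>The factor c covers both parts of a complex coordinate: 1 gives the real part
    and -\<i> the imaginary part.\<close>
  have const: "Re (c * \<phi>1 a) = Re (c * \<phi>2 a)" if \<phi>12: "\<phi>1 \<in> G" "\<phi>2 \<in> G" for \<phi>1 \<phi>2 c a
  proof -
    define g where "g = (\<lambda>\<phi>::'x \<Rightarrow> complex. Re (c * \<phi> a))"
    have gcont: "continuous_on G g" unfolding g_def by (intro continuous_intros cont)
    have "compact (F \<inter> G)" using F(1) faceD(2)[OF G] by (rule compact_Int_closed)
    then have "compact G" using faceD(1)[OF G] by (simp add: inf.absorb2)
    then obtain \<psi> where \<psi>: "\<psi> \<in> G" "\<And>\<phi>. \<phi> \<in> G \<Longrightarrow> g \<phi> \<le> g \<psi>"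
      using continuous_attains_sup[OF _ faceD(3)[OF G] gcont] by auto
    define H where "H = {\<phi> \<in> G. g \<phi> = g \<psi>}"
    have "face H"
      unfolding face_def
    proof (intro conjI ballI impI)
      show "H \<subseteq> F" using faceD(1)[OF G] by (auto simp: H_def)
      show "H \<noteq> {}" using \<psi>(1) by (auto simp: H_def)
      have "closed (G \<inter> g -` {g \<psi>})"
        by (rule continuous_closed_preimage[OF gcont faceD(2)[OF G]]) simp
      moreover have "G \<inter> g -` {g \<psi>} = H" by (auto simp: H_def)
      ultimately show "closed H" by simp
      fix \<phi>1 \<phi>2 assume *: "\<phi>1 \<in> F" "\<phi>2 \<in> F" "(\<lambda>a. (\<phi>1 a + \<phi>2 a) / 2) \<in> H"
      have in_G: "\<phi>1 \<in> G" "\<phi>2 \<in> G" using faceD(4)[OF G *(1,2)] *(3) by (auto simp: H_def)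
      have "g (\<lambda>a. (\<phi>1 a + \<phi>2 a) / 2) = (g \<phi>1 + g \<phi>2) / 2"
        unfolding g_def by (simp add: algebra_simps)
      then have "g \<psi> = (g \<phi>1 + g \<phi>2) / 2" using *(3) by (simp add: H_def)
      then have "g \<phi>1 = g \<psi>" "g \<phi>2 = g \<psi>" using \<psi>(2)[OF in_G(1)] \<psi>(2)[OF in_G(2)] by auto
      then show "\<phi>1 \<in> H" "\<phi>2 \<in> H" using in_G by (auto simp: H_def)
    qed
    then have "H = G" by (rule min) (auto simp: H_def)
    then have "g \<phi>1 = g \<psi>" "g \<phi>2 = g \<psi>" using \<phi>12 by (auto simp: H_def)
    then show ?thesis by (simp add: g_def)
  qed
  have single: "\<phi>1 = \<phi>2" if "\<phi>1 \<in> G" "\<phi>2 \<in> G" for \<phi>1 \<phi>2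
  proof
    fix a show "\<phi>1 a = \<phi>2 a"
      using const[OF that, of 1 a] const[OF that, of "- \<i>" a] by (simp add: complex_eq_iff)
  qed
  obtain \<phi> where \<phi>: "\<phi> \<in> G" using faceD(3)[OF G] by auto
  have "\<phi>1 = \<phi>" if "\<phi>1 \<in> F" "\<phi>2 \<in> F" "\<forall>a. \<phi> a = (\<phi>1 a + \<phi>2 a) / 2" for \<phi>1 \<phi>2
  proof (rule single[OF _ \<phi>])
    have "\<phi> = (\<lambda>a. (\<phi>1 a + \<phi>2 a) / 2)" using that(3) by auto
    then show "\<phi>1 \<in> G" using faceD(4)[OF G that(1,2)] \<phi> by simp
  qed
  then show ?thesis using \<phi> faceD(1)[OF G] unfolding extreme_in_def by (intro exI[of _ \<phi>]) auto
qed

section \<open>Compactness of the set of states\<close>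

lemma closed_Collect_Ball: "(\<And>x. x \<in> S \<Longrightarrow> closed {\<phi>. P x \<phi>}) \<Longrightarrow> closed {\<phi>. \<forall>x\<in>S. P x \<phi>}"
proof -
  assume "\<And>x. x \<in> S \<Longrightarrow> closed {\<phi>. P x \<phi>}"
  then have "closed (\<Inter>x\<in>S. {\<phi>. P x \<phi>})" by (intro closed_INT) auto
  moreover have "(\<Inter>x\<in>S. {\<phi>. P x \<phi>}) = {\<phi>. \<forall>x\<in>S. P x \<phi>}" by auto
  ultimately show ?thesis by simp
qed

lemma closed_states: "closed (states A J e0 E)"
proof -
  have cont: "continuous_on UNIV (\<lambda>\<phi>::'a bop \<Rightarrow> complex. \<phi> a)" for a
    by (rule continuous_on_product_coordinates)
  show ?thesis
    unfolding states_def
    by (intro closed_Collect_conj closed_Collect_Ball closed_Collect_all closed_Collect_eq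
        closed_Collect_le continuous_intros cont)
qed

text \<open>Cauchy-Schwarz against e0 leaves \<phi> (adj a * a). As e0 acts as a unit, a may be
  replaced there by a * e0, and \<open>phi_contract\<close> applies.\<close>

lemma (in cstar) states_norm_le:
  assumes \<phi>: "\<phi> \<in> states A J e0 E" and e0: "e0 \<in> E" "e0 \<in> A" "adj e0 = e0"
  shows "cmod (\<phi> a) \<le> norm a"
proof (cases "a \<in> A")
  case True
  interpret pos_functional A \<phi> using states_pos_functional[OF \<phi>] .
  note e = statesD(3,4)[OF \<phi> e0(1)]
  have e0e0: "\<phi> (e0 * e0) = 1" using e(1)[OF e0(2)] statesD(5)[OF \<phi>] by simp
  have "(cmod (\<phi> a))\<^sup>2 = (cmod (\<phi> (adj e0 * a)))\<^sup>2" using e(1)[OF True] e0(3) by simp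
  also have "\<dots> \<le> Re (\<phi> (adj e0 * e0)) * Re (\<phi> (adj a * a))"
    by (rule phi_cauchy_schwarz[OF e0(2) True])
  also have "\<dots> = Re (\<phi> (adj (a * e0) * (a * e0)))"
  proof -
    have "adj (a * e0) * (a * e0) = e0 * ((adj a * a) * e0)" by (simp add: adj_simps e0 mult.assoc)
    then have "\<phi> (adj (a * e0) * (a * e0)) = \<phi> (adj a * a)"
      using e(1)[of "(adj a * a) * e0"] e(2)[of "adj a * a"] True e0(2) by (simp add: A_intros)
    then show ?thesis using e0e0 e0(3) by simp
  qed
  also have "\<dots> \<le> (norm a)\<^sup>2 * Re (\<phi> (adj e0 * e0))"
    by (rule phi_contract[OF True e0(2)])
  also have "\<dots> = (norm a)\<^sup>2" using e0e0 e0(3) by simp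
  finally show ?thesis by (rule power2_le_imp_le) simp
next
  case False
  then show ?thesis using statesD(1)[OF \<phi>] by simp
qed

text \<open>Tychonoff: the states form a closed subset of a product of discs.\<close>

lemma (in cstar) compact_states:
  assumes e0: "e0 \<in> E" "e0 \<in> A" "adj e0 = e0"
  shows "compact (states A J e0 E)"
proof -
  let ?B = "PiE UNIV (\<lambda>a::'h bop. cball (0::complex) (norm a))"
  have "compactin (product_topology (\<lambda>_. euclidean) UNIV) ?B"
    unfolding compactin_PiE by (simp add: compactin_euclidean_iff)
  then have "compact ?B" by (simp add: euclidean_product_topology)
  then have "compact (?B \<inter> states A J e0 E)" using closed_states by (rule compact_Int_closed)
  moreover have "?B \<inter> states A J e0 E = states A J e0 E"
    using states_norm_le[OF _ e0] by auto
  ultimately show ?thesis by simp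
qed

lemma (in cstar) vector_state:
  assumes v: "norm v = 1" "\<And>j. j \<in> J \<Longrightarrow> ap j v = 0" "\<And>e. e \<in> E \<Longrightarrow> ap e v = v"
    and E: "\<And>e. e \<in> E \<Longrightarrow> adj e = e" "E \<subseteq> A" and e0: "e0 \<in> E"
  shows "(\<lambda>a. if a \<in> A then cinner v (ap a v) else 0) \<in> states A J e0 E"
proof -
  have vv: "cinner v v = 1" using cinner_self[of v] v(1) by simp
  have pos: "0 \<le> Re (cinner v (ap (adj a) (ap a v)))" for a
    by (simp add: cinner_ap_right cinner_self del: of_real_power)
  have swap: "cinner v (ap (adj a) v) = cnj (cinner v (ap a v))" for a
    using cinner_commute[of "ap a v" v] by (simp add: cinner_ap_left)
  have Ev: "cinner v (ap e w) = cinner v w" if "e \<in> E" for e w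
    using that by (simp add: cinner_ap_right E v(3))
  show ?thesis
    unfolding states_def
    using E(2) e0 by (auto simp: A_intros ap_simps cinner_simps pos swap Ev v vv)
qed

text \<open>A vector fixed by \<open>e 0\<close>, ..., \<open>e n\<close> gives a state only for
  these units. The sets of such states decrease with n and are compact, so they have a common
  member, and their intersection has an extreme point.\<close>

lemma (in cstar) pure_state_exists:
  fixes e :: "nat \<Rightarrow> 'h bop"
  assumes e: "\<And>n. e n \<in> A" "\<And>n. adj (e n) = e n"
    and v: "\<And>n. \<exists>v. norm v = 1 \<and> (\<forall>j\<in>J. ap j v = 0) \<and> (\<forall>m\<le>n. ap (e m) v = v)"
  shows "\<exists>\<phi>. extreme_in (states A J (e 0) (range e)) \<phi>"
proof (rule extreme_exists[OF _ _ closed_states])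
  let ?F = "\<lambda>n. states A J (e 0) (e ` {..n})"
  have eq: "states A J (e 0) (range e) = ?F 0 \<inter> \<Inter> (range ?F)"
    unfolding states_def by auto
  show "compact (states A J (e 0) (range e))"
    using e by (intro compact_states) auto
  have ne: "?F n \<noteq> {}" for n
  proof -
    obtain v where "norm v = 1" "\<forall>j\<in>J. ap j v = 0" "\<forall>m\<le>n. ap (e m) v = v" using v by blast
    then have "(\<lambda>a. if a \<in> A then cinner v (ap a v) else 0) \<in> ?F n"
      by (intro vector_state) (auto simp: e)
    then show ?thesis by auto
  qed
  have mono: "?F n \<subseteq> ?F m" if "m \<le> n" for m n
    using that unfolding states_def by auto
  show "states A J (e 0) (range e) \<noteq> {}"
    unfolding eq
  proof (rule compact_imp_fip)
    show "compact (?F 0)" using e by (intro compact_states) auto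
    show "closed T" if "T \<in> range ?F" for T using that closed_states by auto
    fix \<F> assume fin: "finite \<F>" "\<F> \<subseteq> range ?F"
    then obtain N where N: "finite N" "\<F> = ?F ` N" by (metis finite_subset_image)
    then obtain n where n: "\<And>m. m \<in> N \<Longrightarrow> m \<le> n" using finite_nat_set_iff_bounded_le by auto
    have "?F n \<subseteq> ?F 0 \<inter> \<Inter> \<F>" using mono[of 0 n] mono[OF n] N(2) by auto
    then show "?F 0 \<inter> \<Inter> \<F> \<noteq> {}" by (metis ne subset_empty)
  qed
qed

section \<open>Operator sets and function sets\<close>

definition lift_ops :: "('h::chilbert_space \<Rightarrow> 'h) set \<Rightarrow> 'h bop set" where
  "lift_ops A = {x. ap x \<in> A}"

lemma ap_image_lift_ops: "\<forall>T\<in>A. bounded_clinear T \<Longrightarrow> ap ` lift_ops A = A"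
  unfolding lift_ops_def by (auto simp: image_iff) (metis ap_Bop)

lemma lift_ops_ap_image: "lift_ops (ap ` B) = B"
  unfolding lift_ops_def by (auto simp: ap_inject)

lemma ap_image_iff: "ap x \<in> ap ` B \<longleftrightarrow> x \<in> B"
  by (auto simp: ap_inject)

lemma zero_op_ap: "zero_op = ap 0"
  by (rule ext) (simp add: zero_op_def)

lemma ap_ops: "(\<lambda>v. ap x v + ap y v) = ap (x + y)" "(\<lambda>v. c *\<^sub>C ap x v) = ap (cmul c x)"
  "ap x \<circ> ap y = ap (x * y)" "cadj (ap x) = ap (adj x)" "(\<lambda>v. ap x v - ap y v) = ap (x - y)"
  by (rule ext; simp add: ap_simps adj.rep_eq)+

lemma onorm_ap: "onorm (ap x) = norm x"
  by (simp add: norm_bop.rep_eq)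

text \<open>Both \<open>cstar_algebra_on\<close> and \<open>closed_ideal\<close> end in this clause
  on limits of functions.\<close>

lemma lim_closed_iff:
  "(\<forall>f T. (\<forall>n. f n \<in> ap ` B) \<and> bounded_clinear T \<and> (\<lambda>n. onorm (\<lambda>x. f n x - T x)) \<longlonglongrightarrow> 0 \<longrightarrow> T \<in> ap ` B)
    \<longleftrightarrow> closed B"
  (is "?L \<longleftrightarrow> ?R")
proof
  assume L: ?L
  show ?R
    unfolding closed_sequential_limits
  proof (intro allI impI)
    fix x l assume xl: "(\<forall>n. x n \<in> B) \<and> x \<longlonglongrightarrow> l"
    then have "(\<lambda>n. norm (x n - l)) \<longlonglongrightarrow> 0" by (simp add: LIM_zero tendsto_norm_zero)
    then have "ap l \<in> ap ` B"
      using L[rule_format, of "\<lambda>n. ap (x n)" "ap l"] xl by (simp add: ap_ops onorm_ap)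
    then show "l \<in> B" by (simp add: ap_image_iff)
  qed
next
  assume R: ?R
  show ?L
  proof (intro allI impI, elim conjE)
    fix f and T :: "'a \<Rightarrow> 'a"
    assume f: "\<forall>n. f n \<in> ap ` B" and T: "bounded_clinear T"
      and lim: "(\<lambda>n. onorm (\<lambda>x. f n x - T x)) \<longlonglongrightarrow> 0"
    have "\<forall>n. \<exists>x. x \<in> B \<and> f n = ap x" using f by auto
    then obtain x where x: "\<And>n. x n \<in> B" "\<And>n. f n = ap (x n)" by metis
    have T': "T = ap (Bop T)" using T by (simp add: ap_Bop)
    have "(\<lambda>n. norm (x n - Bop T)) \<longlonglongrightarrow> 0"
      using lim unfolding x(2) by (subst (asm) T') (simp add: ap_ops onorm_ap)
    then have "x \<longlonglongrightarrow> Bop T" by (simp add: tendsto_norm_zero_iff LIM_zero_iff)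
    then have "Bop T \<in> B" using R x(1) unfolding closed_sequential_limits by auto
    then show "T \<in> ap ` B" using T' by auto
  qed
qed

lemma cstar_algebra_on_iff: "cstar_algebra_on (ap ` B) \<longleftrightarrow> cstar B"
  unfolding cstar_algebra_on_def lim_closed_iff cstar_def closed_alg_def
  by (simp add: zero_op_ap ap_ops ap_image_iff) (simp only: Ball_def, argo)

definition ideal_in :: "'h::chilbert_space bop set \<Rightarrow> 'h bop set \<Rightarrow> bool" where
  "ideal_in B J \<longleftrightarrow> closed_alg J \<and> J \<subseteq> B \<and> (\<forall>a\<in>B. \<forall>j\<in>J. a * j \<in> J \<and> j * a \<in> J)"

lemma closed_ideal_iff: "closed_ideal (ap ` B) (ap ` J) \<longleftrightarrow> ideal_in B J"
proof -
  have "(\<forall>a\<in>B. \<forall>j\<in>J. a * j \<in> J \<and> j * a \<in> J) \<and> J \<subseteq> B \<longrightarrow> (\<forall>x\<in>J. \<forall>y\<in>J. x * y \<in> J)" by blast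
  moreover have "ap ` J \<subseteq> ap ` B \<longleftrightarrow> J \<subseteq> B" by (auto simp: ap_inject)
  ultimately show ?thesis
    unfolding closed_ideal_def lim_closed_iff ideal_in_def closed_alg_def
    by (simp add: zero_op_ap ap_ops ap_image_iff) argo
qed

lemma ideal_inD:
  assumes "ideal_in B J"
  shows "closed_alg J" "J \<subseteq> B" "a \<in> B \<Longrightarrow> j \<in> J \<Longrightarrow> a * j \<in> J" "a \<in> B \<Longrightarrow> j \<in> J \<Longrightarrow> j * a \<in> J"
  using assms unfolding ideal_in_def by simp_all

section \<open>Abelian elements\<close>

definition pos_elts :: "'h::chilbert_space bop set \<Rightarrow> 'h bop set" where
  "pos_elts B = {adj b * b | b. b \<in> B}"

definition abelian_elt :: "'h::chilbert_space bop set \<Rightarrow> 'h bop \<Rightarrow> bool" where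
  "abelian_elt B x \<longleftrightarrow> (\<forall>a\<in>B. \<forall>b\<in>B. (x * a * x) * (x * b * x) = (x * b * x) * (x * a * x))"

text \<open>The last clause is what is remembered of e' = min(2 adj z * z, 1): a functional bounded
  by the norm with value 1 at e' has real part at least 1/2 at \<open>adj z * z\<close>. The clause
  e' * z = 0 makes all later links orthogonal to z.\<close>

definition chain_step :: "'h::chilbert_space bop set \<Rightarrow> 'h bop \<Rightarrow> 'h bop \<Rightarrow> 'h bop \<Rightarrow> bool" where
  "chain_step M e z e' \<longleftrightarrow> z \<in> M \<and> norm z = 1 \<and> e * z = z \<and> e * e' = e' \<and> e' * z = 0 \<and>
     (\<exists>Y\<in>M. norm Y \<le> 1 \<and> e' = adj z * z + (1/2) *\<^sub>R Y)"

text \<open>The second component certifies that the first has fixed vectors, namely its own range,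
  and marks the place where the next link is built.\<close>

definition unit_pair :: "'h::chilbert_space bop set \<Rightarrow> 'h bop \<times> 'h bop \<Rightarrow> bool" where
  "unit_pair M p \<longleftrightarrow> fst p \<in> M \<and> snd p \<in> M \<and> adj (fst p) = fst p \<and> adj (snd p) = snd p \<and>
     snd p \<noteq> 0 \<and> fst p * snd p = snd p \<and> snd p * fst p = snd p"

context cstar
begin

text \<open>The elements w * a * w do not all commute and have e as a unit. So there is a nilpotent
  z in the algebra of elements with unit e, and the cut-off of \<open>adj z * z\<close> stays in
  that algebra.\<close>

lemma unit_pair_step:
  assumes M: "ideal_in A M" and p: "unit_pair M (e, g)"
    and nab: "\<And>x. x \<in> M \<Longrightarrow> x \<in> pos_elts A \<Longrightarrow> x \<noteq> 0 \<Longrightarrow> \<not> abelian_elt A x"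
  shows "\<exists>z e' g'. unit_pair M (e', g') \<and> chain_step M e z e'"
proof -
  note Malg = ideal_inD(1)[OF M] and MA = ideal_inD(2)[OF M] and Mmult = ideal_inD(3,4)[OF M]
  have eg: "e \<in> M" "g \<in> M" "adj e = e" "adj g = g" "g \<noteq> 0" "e * g = g" "g * e = g"
    using p by (simp_all add: unit_pair_def)
  have gA: "g \<in> A" using eg MA by auto
  \<comment> \<open>g is only known to be selfadjoint; its square has the form required by
    \<open>pos_elts\<close>.\<close>
  define w where "w = g * g"
  have w: "w \<in> M" "w \<noteq> 0" "adj w = w" "e * w = w" "w * e = w"
  proof -
    show "w \<in> M" unfolding w_def using eg gA Mmult by simp
    show "w \<noteq> 0" using adj_mult_eq_0[of g] eg by (simp add: w_def)
    show "adj w = w" by (simp add: w_def adj_simps eg)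
    show "e * w = w" by (simp add: w_def eg flip: mult.assoc)
    show "w * e = w" by (simp add: w_def eg mult.assoc)
  qed
  have "w \<in> pos_elts A" unfolding pos_elts_def w_def using gA eg(4) by force
  then have "\<not> abelian_elt A w" using nab w by blast
  then obtain a b where ab: "a \<in> A" "b \<in> A"
    "(w * a * w) * (w * b * w) \<noteq> (w * b * w) * (w * a * w)"
    unfolding abelian_elt_def by blast
  \<comment> \<open>\<open>ideal_in\<close> does not mention adjoints, so membership of
    \<open>adj x\<close> is asked for separately. It holds for w * a * w since w is
    selfadjoint.\<close>
  define B where "B = {x. x \<in> M \<and> adj x \<in> M} \<inter> {x. e * x = x \<and> x * e = x}"
  have "closed_alg {x. x \<in> M \<and> adj x \<in> M}"
  proof (rule closed_algI)
    fix f x assume f: "\<And>n. f n \<in> {x. x \<in> M \<and> adj x \<in> M}" and lim: "f \<longlonglongrightarrow> x"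
    show "x \<in> {x. x \<in> M \<and> adj x \<in> M}"
      using closed_alg_lim[OF Malg _ lim] closed_alg_lim[OF Malg _ tendsto_adj[OF lim]] f by simp
  qed (simp_all add: adj_simps closed_alg_intros[OF Malg])
  then have Balg: "closed_alg B" unfolding B_def using closed_alg_fixed by (rule closed_alg_Int)
  have Bstar: "adj x \<in> B" if "x \<in> B" for x
  proof -
    have x: "x \<in> M" "adj x \<in> M" "e * x = x" "x * e = x" using that by (simp_all add: B_def)
    have "e * adj x = adj x" "adj x * e = adj x"
      using arg_cong[OF x(4), of adj] arg_cong[OF x(3), of adj] by (simp_all add: adj_simps eg)
    then show ?thesis using x by (simp add: B_def)
  qed
  have waw: "w * a * w \<in> B" if "a \<in> A" for a
  proof -
    have wA: "w \<in> A" using w MA by auto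
    have "w * c * w \<in> M" if "c \<in> A" for c using that w wA by (simp add: Mmult A_intros)
    then have "w * a * w \<in> M" "adj (w * a * w) \<in> M"
      using that by (simp_all add: adj_simps w mult.assoc A_intros flip: mult.assoc)
    moreover have "e * (w * a * w) = w * a * w" by (simp add: w flip: mult.assoc)
    moreover have "w * a * w * e = w * a * w" by (simp add: w mult.assoc)
    ultimately show ?thesis by (simp add: B_def)
  qed
  obtain z0 where z0: "z0 \<in> B" "z0 \<noteq> 0" "z0 * z0 = 0"
    by (rule exists_nilpotent[OF Balg Bstar waw[OF ab(1)] waw[OF ab(2)] ab(3)], assumption, rule that, assumption+)
  define z where "z = (1 / norm z0) *\<^sub>R z0"
  have zB: "z \<in> B" unfolding z_def using z0(1) by (rule closed_alg_scaleR[OF Balg])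
  have z: "norm z = 1" "z * z = 0" "z \<in> M" "adj z \<in> M" "e * z = z" "z * e = z"
    using z0 zB by (simp_all add: z_def B_def)
  have xM: "adj z * z \<in> M" using z closed_alg_times[OF Malg] by simp
  obtain e' g' Y where s: "e' = adj z * z + (1/2) *\<^sub>R Y" "adj e' = e'" "adj g' = g'" "norm Y \<le> 1"
    "e' \<in> M" "g' \<in> M" "Y \<in> M" "e' * g' = g'" "g' * e' = g'" "g' \<noteq> 0"
    "\<And>C. closed_alg C \<Longrightarrow> adj z * z \<in> C \<Longrightarrow> e' \<in> C"
    by (rule spike[OF z(1) Malg xM], rule that, assumption+)
  have "adj z * z \<in> B" using closed_alg_times[OF Balg Bstar[OF zB] zB] .
  then have "e' \<in> B" using s(11) Balg by simp
  then have "e * e' = e'" by (simp add: B_def)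
  \<comment> \<open>As z * z = 0, the closed algebra of all x with x * z = 0 contains
    \<open>adj z * z\<close>, and hence e'.\<close>
  moreover have "e' * z = 0"
    using s(11)[OF closed_alg_annihilated[of z]] z(2) by (simp add: mult.assoc)
  ultimately have "chain_step M e z e'"
    unfolding chain_step_def using z s by auto
  moreover have "unit_pair M (e', g')" unfolding unit_pair_def using s by simp
  ultimately show ?thesis by blast
qed

lemma unit_chain_exists:
  assumes M: "ideal_in A M" "M \<noteq> {0}"
    and nab: "\<And>x. x \<in> M \<Longrightarrow> x \<in> pos_elts A \<Longrightarrow> x \<noteq> 0 \<Longrightarrow> \<not> abelian_elt A x"
  shows "\<exists>p z. (\<forall>n. unit_pair M (p n)) \<and> (\<forall>n. chain_step M (fst (p n)) (z n) (fst (p (Suc n))))"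
proof -
  note Malg = ideal_inD(1)[OF M(1)]
  obtain m0 where m0: "m0 \<in> M" "m0 \<noteq> 0" using M(2) closed_alg_0[OF Malg] by auto
  define m where "m = (1 / norm m0) *\<^sub>R m0"
  have m: "m \<in> M" "norm m = 1" unfolding m_def using m0 by (simp_all add: closed_alg_scaleR[OF Malg])
  have "adj m * m \<in> M" using ideal_inD(2,3)[OF M(1)] m(1) star by auto
  from spike[OF m(2) Malg this] obtain e g where "unit_pair M (e, g)"
    unfolding unit_pair_def by (metis fst_conv snd_conv)
  then have "\<exists>p. \<forall>n. unit_pair M (p n) \<and> (\<exists>z. chain_step M (fst (p n)) z (fst (p (Suc n))))"
  proof (intro dependent_nat_choice)
    fix p n assume "unit_pair M p"
    then show "\<exists>q. unit_pair M q \<and> (\<exists>z. chain_step M (fst p) z (fst q))"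
      using unit_pair_step[OF M(1) _ nab, of "fst p" "snd p"] by (metis fst_conv prod.collapse)
  qed auto
  then show ?thesis by metis
qed

end

text \<open>A chain of units for nilpotents forces the eigenspace at 1 of the compact operator \<open>\<pi> (e 0)\<close>
  to contain an infinite separated set.\<close>

lemma CCR_contradiction:
  fixes A :: "('h::chilbert_space \<Rightarrow> 'h) set" and E :: "('h \<Rightarrow> 'h) \<Rightarrow> 'k::chilbert_space"
  assumes A: "cstar (lift_ops A)" and E: "orthonormal_family E"
    and J: "ideal_in (lift_ops A) J" and I: "ideal_in (lift_ops A) I"
    and ccr: "quot_CCR TYPE('k) (ap ` I) (ap ` J)"
    and M: "ideal_in (lift_ops A) M" "M \<subseteq> I" "\<And>j m. j \<in> J \<Longrightarrow> m \<in> M \<Longrightarrow> j * m = 0"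
    and p: "\<And>n. unit_pair M (p n)" and z: "\<And>n. chain_step M (fst (p n)) (z n) (fst (p (Suc n)))"
  shows False
proof -
  define B where "B = lift_ops A"
  interpret cstar B using A by (simp add: B_def)
  note J = J[folded B_def] and I = I[folded B_def] and M = M[folded B_def]
  define e where "e = (\<lambda>n. fst (p n))"
  define g where "g = (\<lambda>n. snd (p n))"
  have e: "e n \<in> M" "adj (e n) = e n" and g: "g n \<in> M" "g n \<noteq> 0" "e n * g n = g n" for n
    using p[of n] by (simp_all add: unit_pair_def e_def g_def)
  have step: "z n \<in> M" "norm (z n) = 1" "e n * z n = z n" "e n * e (Suc n) = e (Suc n)"
    "e (Suc n) * z n = 0" "\<exists>Y\<in>M. norm Y \<le> 1 \<and> e (Suc n) = adj (z n) * z n + (1/2) *\<^sub>R Y" for n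
    using z[of n] by (simp_all add: chain_step_def e_def)
  have MB: "x \<in> M \<Longrightarrow> x \<in> B" for x using ideal_inD(2)[OF M(1)] by auto
  have ee: "e m * e n = e n" if "m < n" for m n
    using that
  proof (induction n)
    case (Suc n)
    then show ?case
    proof (cases "m = n")
      case False
      then have "e m * e n = e n" using Suc by simp
      then show ?thesis by (metis mult.assoc step(4))
    qed (simp add: step)
  qed simp
  have ez: "e m * z n = z n" and eg: "e m * g n = g n" if "m \<le> n" for m n
  proof -
    have "e m * z n = z n \<and> e m * g n = g n"
    proof (cases "m = n")
      case False
      then have "e m * e n = e n" using ee that by simp
      then show ?thesis by (metis mult.assoc step(3) g(3))
    qed (simp add: step g)
    then show "e m * z n = z n" "e m * g n = g n" by auto
  qed
  \<comment> \<open>Vectors in the range of \<open>g n\<close> are killed by \<open>J\<close>, as j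
    * g n = 0, and are fixed by \<open>e m\<close> for m \<le> n.\<close>
  have "\<exists>v. norm v = 1 \<and> (\<forall>j\<in>J. ap j v = 0) \<and> (\<forall>m\<le>n. ap (e m) v = v)" for n
  proof -
    obtain u where u: "ap (g n) u \<noteq> 0" using g(2) by (metis ap_0 bop_eqI)
    define v where "v = (1 / norm (ap (g n) u)) *\<^sub>R ap (g n) u"
    have "norm v = 1" using u by (simp add: v_def)
    moreover have "ap j v = 0" if "j \<in> J" for j
    proof -
      have "ap (j * g n) u = 0" using M(3)[OF that g(1)] by simp
      then show ?thesis by (simp add: v_def ap_arg_scaleR ap_times)
    qed
    moreover have "ap (e m) v = v" if "m \<le> n" for m
    proof -
      have "ap (e m) (ap (g n) u) = ap (g n) u" using eg[OF that] by (simp flip: ap_times)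
      then show ?thesis by (simp add: v_def ap_arg_scaleR)
    qed
    ultimately show ?thesis by blast
  qed
  then obtain \<phi> where \<phi>: "extreme_in (states B J (e 0) (range e)) \<phi>"
    using pure_state_exists[of e J] e MB by blast
  then have st: "\<phi> \<in> states B J (e 0) (range e)" by (simp add: extreme_in_def)
  interpret pos_functional B \<phi> using states_pos_functional[OF st] .
  have "orthonormal_family (\<lambda>x. E (ap x))"
    using E unfolding orthonormal_family_def by (simp add: ap_inject)
  then obtain \<Lambda> :: "'h bop \<Rightarrow> 'k" where Lam: "\<And>a b. a \<in> B \<Longrightarrow> b \<in> B \<Longrightarrow> cinner (\<Lambda> a) (\<Lambda> b) = \<phi> (adj a * b)"
    using gns_vectors by blast
  interpret gns B \<phi> \<Lambda> by unfold_locales (rule Lam)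
  interpret irrep B \<phi> \<Lambda> I J "e 0" "range e"
    by unfold_locales
       (use \<phi> e M(2) ideal_inD(2-4)[OF I] ideal_inD(2-4)[OF J] in auto)
  have big: "1 / 2 \<le> Re (\<phi> (adj (z n) * z n))" for n
  proof -
    obtain Y where Y: "Y \<in> M" "norm Y \<le> 1" "e (Suc n) = adj (z n) * z n + (1/2) *\<^sub>R Y"
      using step(6) by blast
    have "\<phi> (e (Suc n)) = 1"
      using phi_e(2)[of "e 0" "e (Suc n)"] phi_e(1)[of "e (Suc n)" "e 0"] phi_e0 EA by simp
    then have "1 = \<phi> (adj (z n) * z n) + (1/2) * \<phi> Y"
      unfolding Y(3) using Y(1) step(1) MB by (simp add: phi_simps A_intros)
    from arg_cong[OF this, of Re]
    have "1 = Re (\<phi> (adj (z n) * z n)) + (1/2) * Re (\<phi> Y)" by simp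
    moreover have "cmod (\<phi> Y) \<le> norm Y"
      by (rule states_norm_le[OF st e0 EA[OF e0]]) (rule e)
    ultimately show ?thesis using complex_Re_le_cmod[of "\<phi> Y"] Y(2) by linarith
  qed
  \<comment> \<open>For m < n, \<open>e (Suc m)\<close> is a unit for \<open>z n\<close> and kills
    \<open>z m\<close>, so it can be inserted between them.\<close>
  have orth: "adj (z m) * z n = 0" if "m < n" for m n
  proof -
    have "adj (z m) * z n = adj (e (Suc m) * z m) * z n"
      using ez[of "Suc m" n] that e(2) by (simp add: adj_simps mult.assoc)
    then show ?thesis by (simp add: step(5))
  qed
  have nc: "\<not> compact (closure (\<pi> (e 0) ` {x \<in> K. norm x \<le> 1}))"
    by (rule pi_e0_not_compact[of z, OF MB[OF step(1)] _ ez[OF le0] big orth]) (simp add: step)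
  define \<rho> where "\<rho> = (\<lambda>T. \<pi> (Bop T))"
  have \<rho>: "\<rho> (ap x) = \<pi> x" for x by (simp add: \<rho>_def ap_inverse)
  have "quot_rep (ap ` I) (ap ` J) K \<rho>"
    unfolding quot_rep_def
    by (simp add: \<rho> ap_ops K_subspace IA bounded_op_pi pi_add pi_cmul pi_times pi_adj pi_J)
  moreover have "\<exists>x\<in>K. x \<noteq> 0"
    using norm_Lam_e0 Lam_K[OF EA[OF e0]] by (metis norm_zero zero_neq_one)
  moreover have "commutant_trivial (ap ` I) K \<rho>"
    unfolding commutant_trivial_def using commutant by (simp add: \<rho>)
  ultimately have "compact (closure (\<rho> (ap (e 0)) ` {x \<in> K. norm x \<le> 1}))"
    using ccr e(1) M(2) unfolding quot_CCR_def by blast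
  then show False using nc by (simp add: \<rho>)
qed

lemma abelian_element_exists:
  fixes A :: "('h::chilbert_space \<Rightarrow> 'h) set"
  assumes A: "cstar_algebra_on A" and E: "orthonormal_family (E :: ('h \<Rightarrow> 'h) \<Rightarrow> 'k::chilbert_space)"
    and gcr: "GCR TYPE('k) A" and L: "ideal_in (lift_ops A) L" "L \<noteq> {0}"
  shows "\<exists>x\<in>L. x \<noteq> 0 \<and> x \<in> pos_elts (lift_ops A) \<and> abelian_elt (lift_ops A) x"
proof (rule ccontr)
  assume "\<not> ?thesis"
  then have nab: "\<not> abelian_elt (lift_ops A) x" if "x \<in> L" "x \<in> pos_elts (lift_ops A)" "x \<noteq> 0" for x
    using that by auto
  define B where "B = lift_ops A"
  have AB: "A = ap ` B"
  proof -
    have "\<forall>T\<in>A. bounded_clinear T" using A unfolding cstar_algebra_on_def by (rule conjunct1)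
    then show ?thesis unfolding B_def by (rule ap_image_lift_ops[symmetric])
  qed
  have cB: "cstar B" using A cstar_algebra_on_iff[of B] by (simp flip: AB)
  then interpret cstar B .
  note L = L[folded B_def]
  note LB = ideal_inD(2)[OF L(1)]
  \<comment> \<open>Annihilation on one side suffices for a two-sided ideal, because
    \<open>L\<close> absorbs products from the left.\<close>
  define J where "J = {a \<in> B. \<forall>l\<in>L. a * l = 0}"
  have Jalg: "closed_alg J"
  proof (rule closed_algI)
    fix f x assume f: "\<And>n. f n \<in> J" and lim: "f \<longlonglongrightarrow> x"
    have "x \<in> B" using closed_alg_lim[OF alg _ lim] f by (simp add: J_def)
    moreover have "x * l = 0" if "l \<in> L" for l
      using closed_alg_lim[OF closed_alg_annihilated[of l] _ lim] f that by (simp add: J_def)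
    ultimately show "x \<in> J" by (simp add: J_def)
  qed (auto simp: J_def A_intros distrib_right cmul_simps mult.assoc)
  have J: "ideal_in B J"
    unfolding ideal_in_def using Jalg ideal_inD(3)[OF L(1)]
    by (auto simp: J_def A_intros mult.assoc)
  have "J \<noteq> B"
  proof
    assume "J = B"
    obtain l where l: "l \<in> L" "l \<noteq> 0" using L(2) closed_alg_0[OF ideal_inD(1)[OF L(1)]] by auto
    have "l \<in> B" using l(1) LB by auto
    then have "adj l \<in> J" unfolding \<open>J = B\<close> by (rule star)
    then have "adj l * l = 0" using l(1) by (simp add: J_def)
    then show False using l(2) by (simp add: adj_mult_eq_0)
  qed
  then have "ap ` J \<noteq> A" using lift_ops_ap_image[of J] by (auto simp: B_def)
  moreover have "closed_ideal A (ap ` J)" using J closed_ideal_iff[of B J] by (simp flip: AB)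
  ultimately obtain I0 where I0: "closed_ideal A I0" "ap ` J \<subset> I0" "quot_CCR TYPE('k) I0 (ap ` J)"
    using gcr unfolding GCR_def by metis
  define I where "I = lift_ops I0"
  have I0I: "I0 = ap ` I"
  proof -
    have "I0 \<subseteq> A" using I0(1) unfolding closed_ideal_def by (rule conjunct1)
    then have "\<forall>T\<in>I0. bounded_clinear T" using AB by auto
    then show ?thesis unfolding I_def by (rule ap_image_lift_ops[symmetric])
  qed
  have I: "ideal_in B I" using I0(1) closed_ideal_iff[of B I] by (simp add: I0I flip: AB)
  define M where "M = I \<inter> L"
  have M: "ideal_in B M"
    unfolding ideal_in_def M_def
    using closed_alg_Int[OF ideal_inD(1)[OF I] ideal_inD(1)[OF L(1)]] LB
      ideal_inD(3,4)[OF I] ideal_inD(3,4)[OF L(1)] by auto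
  \<comment> \<open>Some i in \<open>I\<close> lies outside \<open>J\<close>, so i * l is nonzero
    for some l in \<open>L\<close>, and this product belongs to both ideals.\<close>
  have "M \<noteq> {0}"
  proof
    assume M0: "M = {0}"
    obtain i where i: "i \<in> I" "i \<notin> J" using I0(2) unfolding I0I by blast
    have iB: "i \<in> B" using i ideal_inD(2)[OF I] by auto
    then obtain l where l: "l \<in> L" "i * l \<noteq> 0" using i(2) by (auto simp: J_def)
    have lB: "l \<in> B" using l(1) LB by auto
    have "i * l \<in> M" unfolding M_def
      using ideal_inD(4)[OF I lB i(1)] ideal_inD(3)[OF L(1) iB l(1)] by simp
    then show False using l M0 by auto
  qed
  moreover have "\<not> abelian_elt B x" if "x \<in> M" "x \<in> pos_elts B" "x \<noteq> 0" for x
    using that nab by (simp add: M_def B_def)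
  ultimately obtain p z where "\<And>n. unit_pair M (p n)"
    "\<And>n. chain_step M (fst (p n)) (z n) (fst (p (Suc n)))"
    using unit_chain_exists[OF M] by auto
  then show False
    by (intro CCR_contradiction[OF cB[unfolded B_def] E J[unfolded B_def] I[unfolded B_def] _ M[unfolded B_def]])
       (use I0(3) in \<open>auto simp: M_def J_def simp flip: I0I\<close>)
qed

section \<open>Annihilators\<close>

text \<open>The counterpart of \<open>Ann\<close> for operators. The arguments use the two-sided
  annihilator \<open>tann\<close>, which coincides with it for sets of positive elements and for
  selfadjoint closed algebras; \<open>dann\<close> is the counterpart of
  \<open>dset\<close>.\<close>

definition jann :: "'h::chilbert_space bop set \<Rightarrow> 'h bop set \<Rightarrow> 'h bop set" where
  "jann B S = {a \<in> B. \<forall>s\<in>S. a * s + s * a = 0}"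

definition tann :: "'h::chilbert_space bop set \<Rightarrow> 'h bop set \<Rightarrow> 'h bop set" where
  "tann B S = {a \<in> B. \<forall>s\<in>S. a * s = 0 \<and> s * a = 0}"

definition dann :: "'h::chilbert_space bop set \<Rightarrow> 'h bop set \<Rightarrow> 'h bop set" where
  "dann B V = {a \<in> B. \<forall>x\<in>V. \<forall>y\<in>V. x * a * y + y * a * x = 0}"

lemma pos_elts_posop: "s \<in> pos_elts B \<Longrightarrow> posop s"
  unfolding pos_elts_def using posop_adj_mult by auto

lemma pos_elts_adj: "s \<in> pos_elts B \<Longrightarrow> adj s = s"
  using pos_elts_posop by (auto simp: posop_def)

lemma jann_pos_elts:
  assumes S: "S \<subseteq> pos_elts B"
  shows "jann B S = tann B S"
proof -
  have "a * s + s * a = 0 \<longleftrightarrow> a * s = 0 \<and> s * a = 0" if "s \<in> S" for a s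
  proof
    have s: "posop s" using pos_elts_posop[of s B] S that by auto
    assume "a * s + s * a = 0"
    then show "a * s = 0 \<and> s * a = 0" using jordan_eq_0[OF s] by simp
  qed simp
  then show ?thesis unfolding jann_def tann_def by auto
qed

lemma mult_cancel_left_adj:
  assumes "adj s = s" "s * (s * c) = 0"
  shows "s * c = 0"
proof -
  have "adj (s * c) * (s * c) = 0" using assms by (simp add: adj_simps mult.assoc)
  then show ?thesis by (simp add: adj_mult_eq_0)
qed

context cstar
begin

lemma pos_elts_A: "s \<in> pos_elts A \<Longrightarrow> s \<in> A"
  unfolding pos_elts_def by (auto simp: A_intros)

lemma tann_A: "a \<in> tann A S \<Longrightarrow> a \<in> A"
  by (simp add: tann_def)

lemma closed_alg_tann: "closed_alg (tann A S)"
proof (rule closed_algI)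
  fix f x assume f: "\<And>n. f n \<in> tann A S" and lim: "f \<longlonglongrightarrow> x"
  have "x \<in> A" using closed_alg_lim[OF alg _ lim] f by (simp add: tann_def)
  moreover have "x * s = 0 \<and> s * x = 0" if s: "s \<in> S" for s
  proof
    show "x * s = 0"
      using closed_alg_lim[OF closed_alg_annihilated[of s] _ lim] f s by (simp add: tann_def)
    have "(\<lambda>n. s * f n) \<longlonglongrightarrow> s * x" by (intro tendsto_mult tendsto_const lim)
    moreover have "s * f n = 0" for n using f s by (simp add: tann_def)
    ultimately show "s * x = 0" using LIMSEQ_unique[OF _ tendsto_const[of 0]] by simp
  qed
  ultimately show "x \<in> tann A S" by (simp add: tann_def)
next
  fix x y assume "x \<in> tann A S" "y \<in> tann A S"
  then show "x * y \<in> tann A S"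
    unfolding tann_def by (simp add: A_intros mult.assoc) (simp flip: mult.assoc)
qed (simp_all add: tann_def A_intros distrib_left distrib_right cmul_simps)

lemma star_tann:
  assumes S: "\<And>s. s \<in> S \<Longrightarrow> adj s \<in> S" and x: "x \<in> tann A S"
  shows "adj x \<in> tann A S"
proof -
  have "adj x * s = 0 \<and> s * adj x = 0" if "s \<in> S" for s
  proof -
    have "x * adj s = 0" "adj s * x = 0" using S[OF that] x by (simp_all add: tann_def)
    from arg_cong[OF this(1), of adj] arg_cong[OF this(2), of adj] show ?thesis
      by (simp add: adj_simps)
  qed
  then show ?thesis using x by (simp add: tann_def A_intros)
qed

text \<open>The algebra contains \<open>adj m * m\<close> for each of its members m, and to these
  positive elements \<open>jordan_eq_0\<close> applies; the C*-identity then carries the result over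
  to the members themselves. It is needed for the second annihilator, which is not taken of a set of
  positive elements.\<close>

lemma jann_self_adjoint_alg:
  assumes N: "closed_alg N" "\<And>n. n \<in> N \<Longrightarrow> adj n \<in> N"
  shows "jann A N = tann A N"
proof -
  have zero: "a * n = 0 \<and> n * a = 0" if a: "a \<in> jann A N" and n: "n \<in> N" for a n
  proof
    have 1: "a * (adj m * m) = 0" "(adj m * m) * a = 0" if "m \<in> N" for m
    proof -
      have "adj m * m \<in> N" by (rule closed_alg_times[OF N(1) N(2)[OF that] that])
      then have "a * (adj m * m) + (adj m * m) * a = 0" using a by (simp add: jann_def)
      then show "a * (adj m * m) = 0" "(adj m * m) * a = 0" by (rule jordan_eq_0[OF posop_adj_mult])+
    qed
    have "a * n * adj (a * n) = a * (adj (adj n) * adj n) * adj a" by (simp add: adj_simps mult.assoc)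
    then have "a * n * adj (a * n) = 0" using 1(1)[OF N(2)[OF n]] by simp
    then show "a * n = 0" by (simp add: mult_adj_eq_0)
    have "adj (n * a) * (n * a) = adj a * ((adj n * n) * a)" by (simp add: adj_simps mult.assoc)
    then have "adj (n * a) * (n * a) = 0" using 1(2)[OF n] by simp
    then show "n * a = 0" by (simp add: adj_mult_eq_0)
  qed
  show ?thesis
  proof (intro set_eqI iffI)
    fix a
    show "a \<in> tann A N" if a: "a \<in> jann A N"
      using zero[OF a] a by (simp add: tann_def jann_def)
    show "a \<in> jann A N" if "a \<in> tann A N"
      using that by (simp add: tann_def jann_def)
  qed
qed

text \<open>The condition s * a * t = 0 for all a, stronger than s * t = 0, removes the off-diagonal
  compressions of every element of \<open>A\<close>, so that commutation can be tested on one member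
  of the family at a time.\<close>

definition orthogonal_abelian :: "'h bop set \<Rightarrow> bool" where
  "orthogonal_abelian S \<longleftrightarrow> S \<subseteq> pos_elts A \<and> (\<forall>s\<in>S. abelian_elt A s) \<and>
     (\<forall>s\<in>S. \<forall>t\<in>S. s \<noteq> t \<longrightarrow> (\<forall>a\<in>A. s * a * t = 0))"

lemma double_annihilator:
  assumes S: "S \<subseteq> pos_elts A"
  shows "jann A (jann A S) = tann A (tann A S)" "cstar (tann A (tann A S))" "S \<subseteq> tann A (tann A S)"
    "\<And>x. x \<in> tann A S \<Longrightarrow> x \<in> tann A (tann A S) \<Longrightarrow> x = 0"
proof -
  have Sstar: "adj s \<in> S" if "s \<in> S" for s using pos_elts_adj[of s A] S that by auto
  have Nstar: "adj x \<in> tann A S" if "x \<in> tann A S" for x using star_tann[of S, OF Sstar that] .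
  show "jann A (jann A S) = tann A (tann A S)"
    unfolding jann_pos_elts[OF S] by (rule jann_self_adjoint_alg[OF closed_alg_tann Nstar])
  show "cstar (tann A (tann A S))"
    using closed_alg_tann star_tann[of "tann A S", OF Nstar] by (simp add: cstar_def)
  show "S \<subseteq> tann A (tann A S)"
    using S pos_elts_A unfolding tann_def by auto
  fix x assume x: "x \<in> tann A S" "x \<in> tann A (tann A S)"
  then have "x * adj x = 0" using Nstar[OF x(1)] by (simp add: tann_def)
  then show "x = 0" by (simp add: mult_adj_eq_0)
qed

lemma double_annihilator_commutative:
  assumes S: "orthogonal_abelian S" and ab: "a \<in> tann A (tann A S)" "b \<in> tann A (tann A S)"
  shows "a * b = b * a"
proof -
  define V where "V = tann A (tann A S)"
  have Spos: "S \<subseteq> pos_elts A" using S by (simp add: orthogonal_abelian_def)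
  note dd = double_annihilator[OF Spos, folded V_def]
  interpret V: cstar V by (rule dd(2))
  have VA: "x \<in> A" if "x \<in> V" for x using that by (simp add: V_def tann_A)
  have SV: "s \<in> V" if "s \<in> S" for s using dd(3) that by auto
  have Sadj: "adj s = s" if "s \<in> S" for s using pos_elts_adj[of s A] Spos that by auto
  have orth: "s * (x * t) = 0" if "s \<in> S" "t \<in> S" "s \<noteq> t" "x \<in> A" for s t x
    using S that unfolding orthogonal_abelian_def by (simp add: mult.assoc)
  have abel: "(s * x * s) * (s * y * s) = (s * y * s) * (s * x * s)" if "s \<in> S" "x \<in> A" "y \<in> A" for s x y
    using S that unfolding orthogonal_abelian_def abelian_elt_def by simp
  \<comment> \<open>If all s * x * t vanish, then d = s * x has \<open>adj d * d\<close> in both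
    annihilators, so d = 0; the same works for x * s. Thus x itself lies in both
    annihilators.\<close>
  have zero: "x = 0" if x: "x \<in> V" and St: "\<And>s t. s \<in> S \<Longrightarrow> t \<in> S \<Longrightarrow> s * (x * t) = 0" for x
  proof -
    have sx: "s * x = 0" if s: "s \<in> S" for s
    proof -
      let ?d = "s * x"
      have dV: "adj ?d * ?d \<in> V" using SV[OF s] x by (intro V.A_intros)
      have "adj ?d * ?d * t = 0" if "t \<in> S" for t using St[OF s that] by (simp add: mult.assoc)
      moreover have "t * (adj ?d * ?d) = 0" if "t \<in> S" for t
        using arg_cong[OF \<open>\<And>t. t \<in> S \<Longrightarrow> adj ?d * ?d * t = 0\<close>[OF that], of adj] Sadj[OF that]
        by (simp add: adj_simps mult.assoc)
      ultimately have "adj ?d * ?d \<in> tann A S" using VA[OF dV] by (simp add: tann_def)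
      then have "adj ?d * ?d = 0" using dd(4) dV by simp
      then show ?thesis by (simp add: adj_mult_eq_0)
    qed
    have xs: "x * s = 0" if s: "s \<in> S" for s
    proof -
      let ?d = "x * s"
      have dV: "?d * adj ?d \<in> V" using SV[OF s] x by (intro V.A_intros)
      have "t * (?d * adj ?d) = 0" if "t \<in> S" for t using sx[OF that] by (simp flip: mult.assoc)
      moreover have "?d * adj ?d * t = 0" if "t \<in> S" for t
        using arg_cong[OF \<open>\<And>t. t \<in> S \<Longrightarrow> t * (?d * adj ?d) = 0\<close>[OF that], of adj] Sadj[OF that]
        by (simp add: adj_simps mult.assoc)
      ultimately have "?d * adj ?d \<in> tann A S" using VA[OF dV] by (simp add: tann_def)
      then have "?d * adj ?d = 0" using dd(4) dV by simp
      then show ?thesis by (simp add: mult_adj_eq_0)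
    qed
    have "x \<in> tann A S" using sx xs VA[OF x] by (simp add: tann_def)
    then show ?thesis using dd(4) x by simp
  qed
  \<comment> \<open>s * s * s has the form s * a * s with a = s, so it commutes with every s * x *
    s. Hence every compression of its commutator with x vanishes.\<close>
  have central: "(s * s * s) * x = x * (s * s * s)" if s: "s \<in> S" and x: "x \<in> V" for s x
  proof -
    define k where "k = s * s * s"
    have kV: "k \<in> V" unfolding k_def using SV[OF s] by (intro V.A_intros)
    have "k * x - x * k = 0"
    proof (rule zero)
      show "k * x - x * k \<in> V" using kV x by (intro V.A_intros)
      fix t u assume tu: "t \<in> S" "u \<in> S"
      have kxA: "k * x \<in> A" "x * k \<in> A" using VA V.A_intros kV x by auto
      show "t * ((k * x - x * k) * u) = 0"
      proof (cases "t = u")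
        case False
        have "t * ((k * x) * u) = 0" "t * ((x * k) * u) = 0"
          using orth[OF tu False] kxA by auto
        then show ?thesis by (simp add: left_diff_distrib right_diff_distrib)
      next
        case True
        show ?thesis
        proof (cases "t = s")
          case False
          have sA: "s \<in> A" using VA SV s by auto
          have "t * (s * s) = 0" "s * (s * t) = 0"
            using orth[OF tu(1) s False sA] orth[OF s tu(1) False[symmetric] sA] by auto
          then have "t * k = 0" "k * t = 0"
            unfolding k_def by (simp_all add: mult.assoc) (simp flip: mult.assoc)
          then show ?thesis unfolding True[symmetric]
            by (simp add: left_diff_distrib right_diff_distrib mult.assoc) (simp flip: mult.assoc)
        next
          case ts: True
          have "(s * x * s) * (s * s * s) = (s * s * s) * (s * x * s)"
            using abel[OF s VA[OF x] VA[OF SV[OF s]]] .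
          then show ?thesis unfolding True[symmetric] ts
            by (simp add: k_def left_diff_distrib right_diff_distrib mult.assoc)
        qed
      qed
    qed
    then show ?thesis by (simp add: k_def)
  qed
  define c where "c = a * b - b * a"
  have abV: "a \<in> V" "b \<in> V" using ab by (simp_all add: V_def)
  have cV: "c \<in> V" unfolding c_def using abV by (intro V.A_intros)
  \<comment> \<open>With k the cube of s, k * a * k and k * b * k are compressions by s and so
    commute. As k is central, their commutator is k^4 times c, and the selfadjoint factors k and s
    are cancelled until a single s is left.\<close>
  have sc: "s * c = 0" if s: "s \<in> S" for s
  proof -
    define k where "k = s * s * s"
    have ka: "k * a = a * k" and kb: "k * b = b * k"
      unfolding k_def using central[OF s] abV by auto
    have push: "a * (k * x) = k * (a * x)" "b * (k * x) = k * (b * x)" for x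
      by (simp_all add: ka kb flip: mult.assoc)
    have kadj: "adj k = k" unfolding k_def by (simp add: adj_simps Sadj[OF s] mult.assoc)
    have sA: "s \<in> A" using VA SV s by auto
    have in_A: "s * s * a * s * s \<in> A" "s * s * b * s * s \<in> A"
      using sA VA[OF abV(1)] VA[OF abV(2)] by (simp_all add: A_intros)
    have "(k * a * k) * (k * b * k) = (k * b * k) * (k * a * k)"
      using abel[OF s in_A] by (simp add: k_def mult.assoc)
    moreover have "(k * a * k) * (k * b * k) = k * (k * (k * (k * (a * b))))"
      by (simp add: mult.assoc push ka[symmetric] kb[symmetric])
    moreover have "(k * b * k) * (k * a * k) = k * (k * (k * (k * (b * a))))"
      by (simp add: mult.assoc push ka[symmetric] kb[symmetric])
    ultimately have "k * (k * (k * (k * c))) = 0" by (simp add: c_def right_diff_distrib)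
    note cancel = mult_cancel_left_adj[OF kadj]
    have "k * c = 0" by (rule cancel[OF cancel[OF cancel]]) fact
    then have "s * (s * (s * c)) = 0" by (simp add: k_def mult.assoc)
    note cancel = mult_cancel_left_adj[OF Sadj[OF s] this]
    show ?thesis by (rule mult_cancel_left_adj[OF Sadj[OF s] cancel])
  qed
  have "c = 0"
  proof (rule zero[OF cV])
    fix s t assume "s \<in> S" "t \<in> S"
    then show "s * (c * t) = 0" using sc by (simp flip: mult.assoc)
  qed
  then show ?thesis by (simp add: c_def)
qed

section \<open>A maximal family of abelian elements and central annihilators\<close>

lemma maximal_orthogonal_abelian:
  "\<exists>S. orthogonal_abelian S \<and> (\<forall>T. orthogonal_abelian T \<longrightarrow> S \<subseteq> T \<longrightarrow> T = S)"
proof -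
  have "\<exists>M\<in>Collect orthogonal_abelian. \<forall>X\<in>Collect orthogonal_abelian. M \<subseteq> X \<longrightarrow> X = M"
  proof (rule subset_Zorn_nonempty)
    have "orthogonal_abelian {}" by (simp add: orthogonal_abelian_def)
    then show "Collect orthogonal_abelian \<noteq> {}" by auto
  next
    fix \<C> assume "\<C> \<noteq> {}" and ch: "subset.chain (Collect orthogonal_abelian) \<C>"
    have oa: "orthogonal_abelian S" if "S \<in> \<C>" for S
      using ch that unfolding subset.chain_def by auto
    have lin: "S \<subseteq> T \<or> T \<subseteq> S" if "S \<in> \<C>" "T \<in> \<C>" for S T
      using ch that unfolding subset.chain_def by auto
    have orth: "s * a * t = 0" if st: "s \<in> \<Union>\<C>" "t \<in> \<Union>\<C>" "s \<noteq> t" "a \<in> A" for s t a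
    proof -
      obtain X Y where XY: "X \<in> \<C>" "Y \<in> \<C>" "s \<in> X" "t \<in> Y" using st(1,2) by auto
      have "\<exists>Z\<in>\<C>. s \<in> Z \<and> t \<in> Z"
        using lin[OF XY(1,2)] XY by auto
      then obtain Z where "Z \<in> \<C>" "s \<in> Z" "t \<in> Z" by auto
      then show ?thesis using oa[of Z] st(3,4) by (simp add: orthogonal_abelian_def)
    qed
    have pos: "s \<in> pos_elts A \<and> abelian_elt A s" if s: "s \<in> \<Union>\<C>" for s
    proof -
      obtain X where "X \<in> \<C>" "s \<in> X" using s by auto
      then show ?thesis using oa[of X] by (auto simp: orthogonal_abelian_def)
    qed
    show "\<Union>\<C> \<in> Collect orthogonal_abelian"
      unfolding orthogonal_abelian_def mem_Collect_eq
    proof (intro conjI subsetI ballI impI)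
      show "s \<in> pos_elts A" "abelian_elt A s" if "s \<in> \<Union>\<C>" for s using pos[OF that] by auto
    qed (rule orth)
  qed
  then show ?thesis by auto
qed

text \<open>The elements b with s * a * b = 0 throughout form a closed ideal. An abelian x in it
  could be added to a maximal family, so it already belongs to the family, and then x * x * x = 0
  forces x = 0.\<close>

lemma essential_abelian_family:
  assumes ab: "\<And>L. ideal_in A L \<Longrightarrow> L \<noteq> {0} \<Longrightarrow> \<exists>x\<in>L. x \<noteq> 0 \<and> x \<in> pos_elts A \<and> abelian_elt A x"
  shows "\<exists>S. orthogonal_abelian S \<and> (\<forall>b\<in>A. (\<forall>s\<in>S. \<forall>a\<in>A. s * a * b = 0) \<longrightarrow> b = 0)"
proof -
  obtain S where S: "orthogonal_abelian S" and max: "\<And>T. orthogonal_abelian T \<Longrightarrow> S \<subseteq> T \<Longrightarrow> T = S"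
    using maximal_orthogonal_abelian by auto
  have Spos: "s \<in> pos_elts A" if "s \<in> S" for s using S that by (auto simp: orthogonal_abelian_def)
  define L where "L = {b \<in> A. \<forall>s\<in>S. \<forall>a\<in>A. s * a * b = 0}"
  have LA: "L \<subseteq> A" by (auto simp: L_def)
  have Lmult: "c * b \<in> L" "b * c \<in> L" if "b \<in> L" "c \<in> A" for b c
  proof -
    have "s * a * (c * b) = 0" if "s \<in> S" "a \<in> A" for s a
    proof -
      have "s * (a * c) * b = 0" using \<open>b \<in> L\<close> \<open>c \<in> A\<close> that by (simp add: L_def A_intros)
      then show ?thesis by (simp add: mult.assoc)
    qed
    then show "c * b \<in> L" using that by (simp add: L_def A_intros)
    have "s * a * (b * c) = 0" if "s \<in> S" "a \<in> A" for s a
      using \<open>b \<in> L\<close> that by (simp add: L_def flip: mult.assoc)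
    then show "b * c \<in> L" using that by (simp add: L_def A_intros)
  qed
  have "closed_alg L"
  proof (rule closed_algI)
    fix f x assume f: "\<And>n. f n \<in> L" and lim: "f \<longlonglongrightarrow> x"
    have "x \<in> A" using closed_alg_lim[OF alg _ lim] f by (simp add: L_def)
    moreover have "s * a * x = 0" if "s \<in> S" "a \<in> A" for s a
    proof -
      have "(\<lambda>n. s * a * f n) \<longlonglongrightarrow> s * a * x" by (intro tendsto_mult tendsto_const lim)
      moreover have "s * a * f n = 0" for n using f that by (simp add: L_def)
      ultimately show ?thesis using LIMSEQ_unique[OF _ tendsto_const[of 0]] by simp
    qed
    ultimately show "x \<in> L" by (simp add: L_def)
  next
    show "x * y \<in> L" if "x \<in> L" "y \<in> L" for x y using Lmult(1)[OF that(2)] that(1) LA by auto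
  qed (auto simp: L_def A_intros distrib_left cmul_simps)
  then have L: "ideal_in A L" unfolding ideal_in_def using LA Lmult by simp
  have "L = {0}"
  proof (rule ccontr)
    assume "L \<noteq> {0}"
    then obtain x where x: "x \<in> L" "x \<noteq> 0" "x \<in> pos_elts A" "abelian_elt A x" using ab[OF L] by auto
    have sx: "s * a * x = 0" if "s \<in> S" "a \<in> A" for s a using x(1) that by (simp add: L_def)
    have xs: "x * a * s = 0" if "s \<in> S" "a \<in> A" for s a
      using arg_cong[OF sx[OF that(1) star[OF that(2)]], of adj] pos_elts_adj[OF x(3)] pos_elts_adj[OF Spos[OF that(1)]]
      by (simp add: adj_simps mult.assoc)
    have "orthogonal_abelian (insert x S)"
      using S x sx xs unfolding orthogonal_abelian_def by auto
    then have "x \<in> S" using max by auto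
    then have "x * x * x = 0" using sx x(1) LA by auto
    then have "x * (x * x) = 0" by (simp add: mult.assoc)
    then have "x * x = 0" by (rule mult_cancel_left_adj[OF pos_elts_adj[OF x(3)]])
    then have "adj x * x = 0" using pos_elts_adj[OF x(3)] by simp
    then show False using x(2) by (simp add: adj_mult_eq_0)
  qed
  then show ?thesis using S by (intro exI[of _ S]) (auto simp: L_def)
qed

text \<open>For s in the double annihilator and n in the annihilator, s * b * n lies in both sets of
  the centrality condition: n is killed by every element of the former, and s by every element of
  the latter.\<close>

lemma central_full:
  assumes ess: "\<forall>b\<in>A. (\<forall>s\<in>S. \<forall>a\<in>A. s * a * b = 0) \<longrightarrow> b = 0"
    and T: "T \<subseteq> pos_elts A" "S \<subseteq> jann A (jann A T)"
    and central: "dann A (jann A (jann A T)) \<inter> dann A (jann A T) = {0}"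
  shows "jann A (jann A T) = A"
proof -
  note W = double_annihilator(1)[OF T(1)] and N = jann_pos_elts[OF T(1)]
  have "n = 0" if n: "n \<in> tann A T" for n
  proof -
    have nA: "n \<in> A" using n by (rule tann_A)
    have "s * b * n = 0" if sb: "s \<in> S" "b \<in> A" for s b
    proof -
      have s: "s \<in> tann A (tann A T)" using T(2) sb unfolding W by auto
      then have sA: "s \<in> A" by (rule tann_A)
      have aA: "s * b * n \<in> A" using sA sb nA by (simp add: A_intros)
      have "s * b * n \<in> dann A (jann A (jann A T))"
        using aA n unfolding W dann_def by (simp add: tann_def mult.assoc)
      moreover have "s * b * n \<in> dann A (jann A T)"
        using aA s unfolding N dann_def by (simp add: tann_def flip: mult.assoc)
      ultimately show "s * b * n = 0" using central by auto
    qed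
    then show ?thesis using ess nA by auto
  qed
  then have "tann A T \<subseteq> {0}" by auto
  then show ?thesis unfolding W by (auto simp: tann_def)
qed

end

section \<open>Transfer to sets of functions, and the theorem\<close>

lemma inj_ap: "inj ap"
  by (rule injI) (simp add: ap_inject)

lemma Ann_ap: "Ann (ap ` B) (ap ` S) = ap ` jann B S"
proof -
  have "((\<lambda>v. ap x (ap y v) + ap y (ap x v)) = zero_op) \<longleftrightarrow> x * y + y * x = 0" for x y :: "'a bop"
  proof -
    have "(\<lambda>v. ap x (ap y v) + ap y (ap x v)) = ap (x * y + y * x)" by (rule ext) (simp add: ap_simps)
    then show ?thesis by (simp add: zero_op_ap ap_inject)
  qed
  then show ?thesis unfolding Ann_def jann_def by auto
qed

lemma dset_ap: "dset (ap ` B) (ap ` V) = ap ` dann B V"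
proof -
  have "((\<lambda>v. ap x (ap a (ap y v)) + ap y (ap a (ap x v))) = zero_op) \<longleftrightarrow> x * a * y + y * a * x = 0"
    for a x y :: "'a bop"
  proof -
    have "(\<lambda>v. ap x (ap a (ap y v)) + ap y (ap a (ap x v))) = ap (x * a * y + y * a * x)"
      by (rule ext) (simp add: ap_simps)
    then show ?thesis by (simp add: zero_op_ap ap_inject)
  qed
  then show ?thesis unfolding dset_def dann_def by auto
qed

lemma (in cstar) pos_part_ap: "pos_part (ap ` A) = ap ` pos_elts A"
  unfolding pos_part_def pos_elts_def by (auto simp: ap_ops ap_inject A_intros)

lemma (in cstar) annihilators_ap:
  "V \<in> annihilators (ap ` A) \<longleftrightarrow> (\<exists>S\<subseteq>pos_elts A. V = ap ` jann A (jann A S))"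
proof
  assume "V \<in> annihilators (ap ` A)"
  then obtain S where S: "S \<subseteq> ap ` pos_elts A" "V = Ann (ap ` A) (Ann (ap ` A) S)"
    unfolding annihilators_def pos_part_ap by auto
  then obtain T where T: "T \<subseteq> pos_elts A" "S = ap ` T" unfolding subset_image_iff by auto
  then show "\<exists>S\<subseteq>pos_elts A. V = ap ` jann A (jann A S)" using S(2) unfolding T(2) Ann_ap by auto
next
  assume "\<exists>S\<subseteq>pos_elts A. V = ap ` jann A (jann A S)"
  then obtain S where S: "S \<subseteq> pos_elts A" "V = ap ` jann A (jann A S)" by auto
  then have "ap ` S \<subseteq> pos_part (ap ` A)" "V = Ann (ap ` A) (Ann (ap ` A) (ap ` S))"
    unfolding pos_part_ap Ann_ap by (auto intro: image_mono)
  then show "V \<in> annihilators (ap ` A)" unfolding annihilators_def by auto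
qed

theorem theorem19:
  fixes A :: "('h::chilbert_space \<Rightarrow> 'h) set"
  assumes "cstar_algebra_on A"
    and "\<exists>e :: ('h \<Rightarrow> 'h) \<Rightarrow> 'k::chilbert_space. orthonormal_family e"
    and "GCR TYPE('k) A"
  shows "vN_type_I A"
proof -
  define B where "B = lift_ops A"
  have AB: "A = ap ` B"
  proof -
    have "\<forall>T\<in>A. bounded_clinear T" using assms(1) unfolding cstar_algebra_on_def by (rule conjunct1)
    then show ?thesis unfolding B_def by (rule ap_image_lift_ops[symmetric])
  qed
  have "cstar B" using assms(1) cstar_algebra_on_iff[of B] by (simp flip: AB)
  then interpret cstar B .
  obtain e :: "('h \<Rightarrow> 'h) \<Rightarrow> 'k" where e: "orthonormal_family e" using assms(2) by auto
  obtain S where S: "orthogonal_abelian S"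
    and ess: "\<forall>b\<in>B. (\<forall>s\<in>S. \<forall>a\<in>B. s * a * b = 0) \<longrightarrow> b = 0"
    using essential_abelian_family[OF abelian_element_exists[OF assms(1) e assms(3), folded B_def]]
    by auto
  have Spos: "S \<subseteq> pos_elts B" using S by (simp add: orthogonal_abelian_def)
  note V = double_annihilator[OF Spos]
  define V where "V = jann B (jann B S)"
  have "abelian_ann A (ap ` V)"
    unfolding abelian_ann_def
  proof (intro conjI)
    show "ap ` V \<in> annihilators A" unfolding AB annihilators_ap V_def using Spos by auto
    show "cstar_algebra_on (ap ` V)" unfolding cstar_algebra_on_iff V_def V(1) by (rule V(2))
    show "\<forall>a\<in>ap ` V. \<forall>b\<in>ap ` V. a \<circ> b = b \<circ> a"
      using double_annihilator_commutative[OF S] by (auto simp: V_def V(1) ap_ops)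
  qed
  \<comment> \<open>Every central annihilator above the chosen one turns out to be all of
    \<open>A\<close>, so \<open>A\<close> is their greatest lower bound once it is known to be an
    annihilator.\<close>
  moreover have "central_support_is A (ap ` V) A"
    unfolding central_support_is_def is_glb_in_def
  proof (intro conjI ballI impI)
    \<comment> \<open>Only 0 annihilates all positive elements: x is killed by x * adj x. So
      \<open>A\<close> is the double annihilator of its positive part.\<close>
    have zero: "x = 0" if "x \<in> jann B (pos_elts B)" for x
    proof -
      have x: "x \<in> tann B (pos_elts B)" using that by (simp add: jann_pos_elts)
      have "adj (adj x) * adj x \<in> pos_elts B" unfolding pos_elts_def using star[OF tann_A[OF x]] by fast
      then have "x * adj x * x = 0" using x by (simp add: tann_def)
      then have "adj (adj x * x) * (adj x * x) = 0" by (simp add: adj_simps mult.assoc)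
      then show "x = 0" by (simp add: adj_mult_eq_0)
    qed
    have "a * x + x * a = 0" if "x \<in> jann B (pos_elts B)" for a x using zero[OF that] by simp
    then have "jann B (jann B (pos_elts B)) = B" unfolding jann_def[of B "jann B (pos_elts B)"] by blast
    then show "A \<in> annihilators A" unfolding AB annihilators_ap by (intro exI[of _ "pos_elts B"]) simp
  next
    fix W assume W: "W \<in> {W \<in> annihilators A. central_ann A W \<and> ap ` V \<subseteq> W}"
    then obtain T0 where T0: "T0 \<subseteq> pos_part A" "W = Ann A (Ann A T0)"
      "dset A (Ann A (Ann A T0)) \<inter> dset A (Ann A T0) = {zero_op}"
      unfolding central_ann_def by auto
    obtain T where T: "T \<subseteq> pos_elts B" "T0 = ap ` T"
      using T0(1) unfolding AB pos_part_ap subset_image_iff by auto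
    have WT: "W = ap ` jann B (jann B T)" using T0(2) unfolding AB T(2) Ann_ap .
    have "dann B (jann B (jann B T)) \<inter> dann B (jann B T) = {0}"
    proof -
      have "ap ` (dann B (jann B (jann B T)) \<inter> dann B (jann B T)) = ap ` {0}"
        using T0(3) unfolding AB T(2) Ann_ap dset_ap by (simp add: zero_op_ap image_Int[OF inj_ap])
      then show ?thesis by (simp only: inj_image_eq_iff[OF inj_ap])
    qed
    moreover have "S \<subseteq> jann B (jann B T)"
    proof -
      have "ap ` V \<subseteq> ap ` jann B (jann B T)" using W WT by simp
      then have "V \<subseteq> jann B (jann B T)" by (auto simp: ap_inject)
      then show ?thesis using V(3) unfolding V_def V(1) by simp
    qed
    ultimately have "jann B (jann B T) = B" using central_full[OF ess T(1)] by simp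
    then show "A \<subseteq> W" unfolding WT AB by simp
  next
    fix c assume "c \<in> annihilators A"
    then show "c \<subseteq> A" unfolding AB annihilators_ap by (auto simp: jann_def)
  qed
  ultimately show ?thesis unfolding vN_type_I_def by auto
qed

end
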